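(* Let $(\mu,\nu,\{c_k\})$ be a Gårding–Wightman module modeled on the Hilbert space $H=\int_X^\oplus H_x\,d\mu(x)$, where $H_x=\mathbb C\otimes K_x$ and $K_x$ are real Hilbert spaces with $K_{x+\delta}=K_x=K_{\mathbf 1-x}$ for all $\delta\in\Delta$ and almost all $x$. If $\tilde\mu$ is equivalent to $\mu$ and, for almost all $x$ and all $k$, $$\nu(\mathbf 1-x)=\nu(x),\qquad \overline{c_k(\mathbf 1-x)}=(-1)^k c_k(x),$$ then $$H^{\mathbb R}=\Big\{f\in H:\ \overline{f(x)}=\sqrt{\tfrac{d\mu(\mathbf 1-x)}{d\mu(x)}}\;f(\mathbf 1-x)\ \text{ for almost all }x\Big\}$$ is an invariant real form of $H$. Conversely, any pair consisting of a Gårding–Wightman module together with an invariant real form is unitarily equivalent to a pair $(H,H^{\mathbb R})$, where $H=\int_X^\oplus H_x\,d\mu(x)$ is the Gårding–Wightman module of a triple $(\mu,\nu,\{c_k\})$ with $H_x=\mathbb C\otimes K_x$, $K_x$ real Hilbert spaces with $K_{x+\delta}=K_x=K_{\mathbf 1-x}$ for all $\delta\in\Delta$ and almost all $x$, such that $\tilde\mu$ is equivalent to $\mu$ and $\nu(\mathbf 1-x)=\nu(x)$, $\overline{c_k(\mathbf 1-x)}=(-1)^k c_k(x)$ for almost all $x$ and all $k$, and where $H^{\mathbb R}=\big\{f\in H:\ \overline{f(x)}=\sqrt{\tfrac{d\mu(\mathbf 1-x)}{d\mu(x)}}\;f(\mathbf 1-x)\ \text{ for almost all }x\big\}$.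
   Context: $Z$ is an infinite-dimensional real separable Hilbert space, and $C(Z)$ is its Clifford algebra: the quotient of the real tensor algebra of $Z$ by the ideal generated by the elements $zw+wz+2(z,w)1$, $z,w\in Z$; $C_{\mathbb C}(Z)=\mathbb C\otimes C(Z)$. Fix an orthogonal complex structure $\sigma$ on $Z$ and a unitary basis $z_1,z_2,\dots$ of $(Z,\sigma)$, so that $\{z_k,\sigma(z_k)\}_{k\in\mathbb N}$ is a real orthonormal basis of $Z$. $X$ is the set of sequences $x=(x_1,x_2,\dots)$ with $x_k\in\{0,1\}$, a group under componentwise addition mod 2; $\delta_k\in X$ has $k$-th entry $1$ and all others $0$; $\Delta\subset X$ is the subgroup of sequences with finitely many $1$'s; $\mathbf 1=(1,1,\dots)$, so $\mathbf 1-x=(1-x_1,1-x_2,\dots)$. $X$ carries the $\sigma$-algebra generated by the sets $X_k=\{x: x_k=1\}$. A Gårding–Wightman (GW) triple $(\mu,\nu,\{c_k\})$ consists of: (a) a nonzero $\sigma$-finite positive measure $\mu$ on $X$, quasi-invariant under $\Delta$: for each $\delta\in\Delta$ the measure $\mu_\delta(E)=\mu(E+\delta)$ has the same null sets as $\mu$; write $\frac{d\mu(x+\delta)}{d\mu(x)}$ for $\frac{d\mu_\delta}{d\mu}(x)$; (b) a measurable function $\nu:X\to\{1,2,\dots\}\cup\{\infty\}$ with $\nu(x+\delta)=\nu(x)$ for all $\delta\in\Delta$ and almost all $x$; (c) for a measurable field of separable complex Hilbert spaces $H_x$ with $\dim H_x=\nu(x)$, where $H_x$ depends only on $\nu(x)$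 (so $H_{x+\delta}=H_x$ for a.e. $x$, and $H_{\mathbf 1-x}=H_x$ whenever $\nu(\mathbf 1-x)=\nu(x)$), unitary operators $c_k(x):H_x\to H_{x+\delta_k}=H_x$, depending measurably on $x$, with $c_k(x)^*=c_k(x+\delta_k)$ and $c_k(x)c_l(x+\delta_k)=c_l(x)c_k(x+\delta_l)$ for all $k,l$ and almost all $x$. The associated GW module is the Hilbert space $H=\int_X^{\oplus}H_x\,d\mu(x)$ (elements: square-integrable measurable fields $f(x)\in H_x$) with the continuous representation $\mathbb J$ of $C_{\mathbb C}(Z)$, where $Z$ acts by skew-hermitian operators $\mathbb J_z$ (real linear in $z$), determined by $$(\mathbb J_{z_k}f)(x)=(-1)^{x_1+\dots+x_{k-1}+1}\,i\,c_k(x)\sqrt{\tfrac{d\mu(x+\delta_k)}{d\mu(x)}}\,f(x+\delta_k),\qquad (\mathbb J_{\sigma(z_k)}f)(x)=(-1)^{x_k}\,i\,(\mathbb J_{z_k}f)(x).$$ In the theorem, the fibers are complexifications: $K=\int_X^\oplus K_x\,d\mu(x)$ is a direct integral of real Hilbert spaces ($K_x$ depending only on $\nu(x)$), $H_x=\mathbb C\otimes K_x$, $H=\mathbb C\otimes K$. The bar denotes the conjugation of $H_x$ with respect to $K_x$, and for an operator $A$ on $H_x$, $\overline{A}$ is defined by $\overline{A}(v)=\overline{A(\bar v)}$. An invariant real structure on $H$ is an antilinear operator $S:H\to H$ with $S^2=1$, $\|Sf\|=\|f\|$ for all $f$, and $S\mathbb J_z=\mathbb J_zS$ for all $z\in Z$;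 an invariant real form of $H$ is the real subspace $\{f\in H: Sf=f\}$ of fixed points of such an $S$. Two pairs (GW module, invariant real form) are unitarily equivalent if there is a unitary operator between the modules intertwining the operators $\mathbb J_z$, $z\in Z$, and mapping one real form onto the other. $\tilde\mu$ is the measure $\tilde\mu(E)=\mu(\mathbf 1-E)$, where $\mathbf 1-E=\{\mathbf 1-x:x\in E\}$, and $\frac{d\mu(\mathbf 1-x)}{d\mu(x)}$ denotes $\frac{d\tilde\mu}{d\mu}(x)$. *)

theory Defs
  imports "HOL-Analysis.Analysis" "HOL-Library.Z2" "HOL-Library.Function_Algebras"
    "HOL-Library.Extended_Nat"
begin

section \<open>Complex Hilbert spaces\<close>

text \<open>
  The complex inner product is linear in the first argument.  The real Hilbert space underlying a
  complex one carries the real part of the complex inner product, hence the same norm.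
\<close>

class complex_hilbert = real_inner + complete_space +
  fixes scaleC :: "complex \<Rightarrow> 'a \<Rightarrow> 'a" (infixr "*\<^sub>C" 75)
    and cinner :: "'a \<Rightarrow> 'a \<Rightarrow> complex"
  assumes scaleC_add_right: "a *\<^sub>C (x + y) = a *\<^sub>C x + a *\<^sub>C y"
    and scaleC_add_left: "(a + b) *\<^sub>C x = a *\<^sub>C x + b *\<^sub>C x"
    and scaleC_scaleC: "a *\<^sub>C (b *\<^sub>C x) = (a * b) *\<^sub>C x"
    and scaleC_one: "1 *\<^sub>C x = x"
    and scaleR_eq_scaleC: "r *\<^sub>R x = complex_of_real r *\<^sub>C x"
    and cinner_commute: "cinner x y = cnj (cinner y x)"
    and cinner_add_left: "cinner (x + y) w = cinner x w + cinner y w"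
    and cinner_scaleC_left: "cinner (a *\<^sub>C x) y = a * cinner x y"
    and inner_eq_Re_cinner: "inner x y = Re (cinner x y)"

global_interpretation complex_vs: vector_space "scaleC :: complex \<Rightarrow> 'a \<Rightarrow> 'a::complex_hilbert"
  defines csubspace = complex_vs.subspace and cspan = complex_vs.span
  by unfold_locales (simp_all add: scaleC_add_right scaleC_add_left scaleC_scaleC scaleC_one)

definition orthonormal_basis_of :: "'a::complex_hilbert set \<Rightarrow> 'a set \<Rightarrow> bool" where
  "orthonormal_basis_of V B \<longleftrightarrow>
     B \<subseteq> V \<and> (\<forall>u\<in>B. \<forall>v\<in>B. cinner u v = (if u = v then 1 else 0)) \<and> closure (cspan B) = V"

text \<open>\<open>V\<close> is a separable complex Hilbert space (a closed subspace of the ambient type) of Hilbert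
  dimension \<open>n\<close>.\<close>

definition hilbert_subspace_of_dim :: "'a::complex_hilbert set \<Rightarrow> enat \<Rightarrow> bool" where
  "hilbert_subspace_of_dim V n \<longleftrightarrow> closed V \<and> csubspace V \<and>
     (\<exists>B. orthonormal_basis_of V B \<and> countable B \<and>
        (case n of enat m \<Rightarrow> finite B \<and> card B = m | \<infinity> \<Rightarrow> infinite B))"

definition unitary_on :: "'a::complex_hilbert set \<Rightarrow> ('a \<Rightarrow> 'a) \<Rightarrow> bool" where
  "unitary_on V A \<longleftrightarrow> A ` V = V \<and> (\<forall>v\<in>V. \<forall>w\<in>V. A (v + w) = A v + A w) \<and>
     (\<forall>a. \<forall>v\<in>V. A (a *\<^sub>C v) = a *\<^sub>C A v) \<and> (\<forall>v\<in>V. norm (A v) = norm v)"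

definition infinite_dimensional :: "'a::real_vector set \<Rightarrow> bool" where
  "infinite_dimensional V \<longleftrightarrow> \<not> (\<exists>B. finite B \<and> V \<subseteq> span B)"


section \<open>Complexification of a real Hilbert space\<close>

text \<open>\<open>Cplx a b\<close> stands for \<open>1 \<otimes> a + \<i> \<otimes> b\<close> in \<open>\<complex> \<otimes> 'k\<close>.\<close>

datatype 'k complexification = Cplx (re_part: 'k) (im_part: 'k)

instantiation complexification :: (real_inner) real_inner
begin

definition "0 = Cplx 0 0"
definition "u + v = Cplx (re_part u + re_part v) (im_part u + im_part v)"
definition "- u = Cplx (- re_part u) (- im_part u)" for u :: "'a complexification"
definition "u - v = Cplx (re_part u - re_part v) (im_part u - im_part v)"
definition "r *\<^sub>R u = Cplx (r *\<^sub>R re_part u) (r *\<^sub>R im_part u)"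
definition "inner u v = inner (re_part u) (re_part v) + inner (im_part u) (im_part v)"
definition "norm u = sqrt (inner u u)" for u :: "'a complexification"
definition "sgn u = inverse (norm u) *\<^sub>R u" for u :: "'a complexification"
definition "dist u v = norm (u - v)" for u v :: "'a complexification"
definition "uniformity =
  (INF e\<in>{0<..}. principal {(u, v :: 'a complexification). dist u v < e})"
definition "open U \<longleftrightarrow> (\<forall>u\<in>U. eventually (\<lambda>(u', v). u' = u \<longrightarrow> v \<in> U) uniformity)"
  for U :: "'a complexification set"

instance
proof
  fix u v w :: "'a complexification" and r s :: real
  show "inner u v = inner v u"
    by (simp add: inner_complexification_def inner_commute)
  show "inner (u + v) w = inner u w + inner v w"
    by (simp add: inner_complexification_def plus_complexification_def inner_add_left)
  show "inner (r *\<^sub>R u) v = r * inner u v"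
    by (simp add: inner_complexification_def scaleR_complexification_def distrib_left)
  show "0 \<le> inner u u"
    by (simp add: inner_complexification_def)
  show "inner u u = 0 \<longleftrightarrow> u = 0"
    by (cases u) (simp add: inner_complexification_def zero_complexification_def
        add_nonneg_eq_0_iff)
  show "u + v + w = u + (v + w)" "u + v = v + u" "0 + u = u" "- u + u = 0" "u - v = u + - v"
    by (simp_all add: zero_complexification_def plus_complexification_def
        uminus_complexification_def minus_complexification_def add_ac)
  show "r *\<^sub>R (u + v) = r *\<^sub>R u + r *\<^sub>R v" "(r + s) *\<^sub>R u = r *\<^sub>R u + s *\<^sub>R u"
    "r *\<^sub>R s *\<^sub>R u = (r * s) *\<^sub>R u" "1 *\<^sub>R u = u"
    by (simp_all add: plus_complexification_def scaleR_complexification_def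
        scaleR_add_right scaleR_add_left)
qed (rule sgn_complexification_def dist_complexification_def norm_complexification_def
      uniformity_complexification_def open_complexification_def)+

end

lemma dist_Cplx: "dist (Cplx a b) (Cplx c d) = dist (a, b) (c, d)"
  by (simp add: dist_complexification_def norm_complexification_def inner_complexification_def
      minus_complexification_def dist_norm norm_Pair power2_norm_eq_inner)

lemma continuous_on_Cplx: "continuous_on UNIV (\<lambda>p. Cplx (fst p) (snd p))"
proof (subst continuous_on_iff, intro ballI allI impI)
  fix p :: "'a \<times> 'a" and e :: real assume "0 < e"
  then show "\<exists>d>0. \<forall>q\<in>UNIV. dist q p < d \<longrightarrow> dist (Cplx (fst q) (snd q)) (Cplx (fst p) (snd p)) < e"
    by (intro exI[of _ e]) (simp add: dist_Cplx)
qed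

lemma continuous_on_parts: "continuous_on UNIV (\<lambda>u. (re_part u, im_part u))"
proof (subst continuous_on_iff, intro ballI allI impI)
  fix u :: "'a complexification" and e :: real assume "0 < e"
  moreover have "dist (re_part v, im_part v) (re_part u, im_part u) = dist v u"
    for v by (metis complexification.collapse dist_Cplx)
  ultimately show "\<exists>d>0. \<forall>v\<in>UNIV. dist v u < d \<longrightarrow>
      dist (re_part v, im_part v) (re_part u, im_part u) < e"
    by (intro exI[of _ e]) simp
qed

instance complexification :: ("{real_inner, complete_space}") complete_space
proof
  fix X :: "nat \<Rightarrow> 'a complexification" assume X: "Cauchy X"
  let ?Y = "\<lambda>n. (re_part (X n), im_part (X n))"
  have "dist (?Y m) (?Y n) = dist (X m) (X n)" for m n
    by (metis complexification.collapse dist_Cplx)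
  then have "Cauchy ?Y" using X by (simp add: Cauchy_def)
  then obtain p where p: "?Y \<longlonglongrightarrow> p" using Cauchy_convergent convergent_def by blast
  have "(\<lambda>n. Cplx (fst (?Y n)) (snd (?Y n))) \<longlonglongrightarrow> Cplx (fst p) (snd p)"
    using continuous_on_tendsto_compose[OF continuous_on_Cplx p] by simp
  then show "convergent X" by (auto simp: convergent_def)
qed

instance complexification :: ("{real_inner, second_countable_topology}") second_countable_topology
proof
  obtain B :: "('a \<times> 'a) set set" where B: "countable B" "topological_basis B"
    using ex_countable_basis by blast
  let ?f = "\<lambda>u :: 'a complexification. (re_part u, im_part u)"
  have "topological_basis ((\<lambda>b. ?f -` b) ` B)"
  proof (rule topological_basisI)
    fix C assume "C \<in> (\<lambda>b. ?f -` b) ` B"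
    then show "open C"
      using B(2) continuous_on_parts open_vimage topological_basis_open by blast
  next
    fix U and u :: "'a complexification" assume "open U" "u \<in> U"
    then have "open ((\<lambda>p. Cplx (fst p) (snd p)) -` U)" "?f u \<in> (\<lambda>p. Cplx (fst p) (snd p)) -` U"
      using continuous_on_Cplx open_vimage by auto
    then obtain b where "b \<in> B" "?f u \<in> b" "b \<subseteq> (\<lambda>p. Cplx (fst p) (snd p)) -` U"
      using B(2) topological_basisE by blast
    moreover from this have "?f -` b \<subseteq> U"
      by (metis (no_types, lifting) complexification.collapse fst_conv snd_conv subsetD subsetI vimageE vimageI2)
    ultimately show "\<exists>C\<in>(\<lambda>b. ?f -` b) ` B. u \<in> C \<and> C \<subseteq> U" by blast
  qed
  then show "\<exists>S :: 'a complexification set set. countable S \<and> open = generate_topology S"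
    using B(1) topological_basis_imp_subbasis by (metis countable_image)
qed

instantiation complexification :: ("{real_inner, complete_space}") complex_hilbert
begin

definition "a *\<^sub>C u =
  Cplx (Re a *\<^sub>R re_part u - Im a *\<^sub>R im_part u) (Re a *\<^sub>R im_part u + Im a *\<^sub>R re_part u)"

definition "cinner u v =
  Complex (inner (re_part u) (re_part v) + inner (im_part u) (im_part v))
          (inner (im_part u) (re_part v) - inner (re_part u) (im_part v))"

instance
proof
  fix a b :: complex and r :: real and u v w :: "'a complexification"
  note defs = scaleC_complexification_def cinner_complexification_def plus_complexification_def
    scaleR_complexification_def inner_complexification_def
  show "a *\<^sub>C (u + v) = a *\<^sub>C u + a *\<^sub>C v" "(a + b) *\<^sub>C u = a *\<^sub>C u + b *\<^sub>C u"
    "a *\<^sub>C b *\<^sub>C u = (a * b) *\<^sub>C u" "1 *\<^sub>C u = u" "r *\<^sub>R u = complex_of_real r *\<^sub>C u"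
    by (simp_all add: defs algebra_simps)
  show "cinner u v = cnj (cinner v u)"
    unfolding defs complex_eq_iff by (simp add: inner_commute)
  show "cinner (u + v) w = cinner u w + cinner v w" "cinner (a *\<^sub>C u) v = a * cinner u v"
    by (simp_all add: defs complex_eq_iff inner_add_left inner_diff_left algebra_simps)
  show "inner u v = Re (cinner u v)"
    by (simp add: defs)
qed

end

definition conj_vec :: "'k::real_inner complexification \<Rightarrow> 'k complexification" where
  "conj_vec v = Cplx (re_part v) (- im_part v)"

definition conj_op ::
    "('k::real_inner complexification \<Rightarrow> 'k complexification) \<Rightarrow> 'k complexification \<Rightarrow> 'k complexification"
  where "conj_op A v = conj_vec (A (conj_vec v))"

definition complexified :: "'k set \<Rightarrow> 'k complexification set" where
  "complexified K = {Cplx a b | a b. a \<in> K \<and> b \<in> K}"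


section \<open>The group \<open>X\<close> and measures on it\<close>

text \<open>
  Sequences are indexed from \<open>0\<close>: the coordinate \<open>x k\<close> is the entry of \<open>x\<close> with one-based index
  \<open>k + 1\<close>, and likewise for all other sequences below.  Addition, \<open>1\<close> and \<open>1 - x\<close> are the
  pointwise operations on functions into the two-element field.
\<close>

type_synonym X = "nat \<Rightarrow> bit"

definition delta :: "nat \<Rightarrow> X" where
  "delta k = (\<lambda>j. if j = k then 1 else 0)"

definition Delta :: "X set" where
  "Delta = {x. finite {k. x k = 1}}"

definition X_algebra :: "X measure" where
  "X_algebra = sigma UNIV (range (\<lambda>k. {x. x k = 1}))"

text \<open>\<open>E \<mapsto> \<mu> (E + d)\<close>; the image measure uses preimages, and \<open>x + d \<in> E\<close> iff \<open>x \<in> E + d\<close>.\<close>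

definition translate :: "X measure \<Rightarrow> X \<Rightarrow> X measure" where
  "translate \<mu> d = distr \<mu> X_algebra (\<lambda>x. x + d)"

definition reflect :: "X measure \<Rightarrow> X measure" where
  "reflect \<mu> = distr \<mu> X_algebra (\<lambda>x. 1 - x)"

definition equivalent_measures :: "X measure \<Rightarrow> X measure \<Rightarrow> bool" where
  "equivalent_measures \<mu> \<mu>' \<longleftrightarrow> null_sets \<mu> = null_sets \<mu>'"

definition density_of :: "X measure \<Rightarrow> X measure \<Rightarrow> X \<Rightarrow> real" where
  "density_of \<mu>' \<mu> x = enn2real (RN_deriv \<mu> \<mu>' x)"


section \<open>Garding-Wightman triples\<close>

text \<open>
  The triple \<open>(\<mu>, \<nu>, {c\<^sub>k})\<close> together with the spaces \<open>H\<^sub>x\<close>, which are closed subspaces of one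
  separable Hilbert space.  As \<open>H\<^sub>x\<close> depends only on \<open>\<nu> x\<close>, the measurable fields are the
  measurable maps into the ambient space with \<open>f x \<in> H\<^sub>x\<close>.
\<close>

record 'h gw =
  gw_measure :: "X measure"
  gw_mult :: "X \<Rightarrow> enat"
  gw_coeff :: "nat \<Rightarrow> X \<Rightarrow> 'h \<Rightarrow> 'h"
  gw_fiber :: "X \<Rightarrow> 'h set"

definition measurable_fields ::
    "'h::{complex_hilbert, second_countable_topology} gw \<Rightarrow> (X \<Rightarrow> 'h) set" where
  "measurable_fields G =
     {f. f \<in> borel_measurable (gw_measure G) \<and> (\<forall>x. f x \<in> gw_fiber G x)}"

definition gw_triple :: "'h::{complex_hilbert, second_countable_topology} gw \<Rightarrow> bool" where
  "gw_triple G \<longleftrightarrow>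
     (let \<mu> = gw_measure G; \<nu> = gw_mult G; c = gw_coeff G; H = gw_fiber G in
       sets \<mu> = sets X_algebra \<and> sigma_finite_measure \<mu> \<and> emeasure \<mu> UNIV \<noteq> 0 \<and>
       (\<forall>d\<in>Delta. equivalent_measures (translate \<mu> d) \<mu>) \<and>
       \<nu> \<in> measurable X_algebra (count_space UNIV) \<and> (\<forall>x. \<nu> x \<ge> 1) \<and>
       (AE x in \<mu>. \<forall>d\<in>Delta. \<nu> (x + d) = \<nu> x) \<and>
       (\<forall>x. hilbert_subspace_of_dim (H x) (\<nu> x)) \<and>
       (\<forall>x y. \<nu> x = \<nu> y \<longrightarrow> H x = H y) \<and>
       (AE x in \<mu>. \<forall>k. unitary_on (H x) (c k x)) \<and>
       (\<forall>k. \<forall>f\<in>measurable_fields G. (\<lambda>x. c k x (f x)) \<in> borel_measurable \<mu>) \<and>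
       (AE x in \<mu>. \<forall>k. \<forall>v\<in>H x. \<forall>w\<in>H x.
          cinner (c k x v) w = cinner v (c k (x + delta k) w)) \<and>
       (AE x in \<mu>. \<forall>k l. \<forall>v\<in>H x.
          c k x (c l (x + delta k) v) = c l x (c k (x + delta l) v)))"


section \<open>The direct integral and operators on it\<close>

text \<open>
  Elements of \<open>H\<close> are represented by square-integrable measurable fields, two of which are the same
  element iff they agree almost everywhere.  Accordingly a map between such spaces is a function on
  representatives that respects almost-everywhere equality, and equations in \<open>H\<close> are stated
  almost everywhere.
\<close>

definition gw_space :: "'h::{complex_hilbert, second_countable_topology} gw \<Rightarrow> (X \<Rightarrow> 'h) set" where
  "gw_space G = {f \<in> measurable_fields G. integrable (gw_measure G) (\<lambda>x. (norm (f x))\<^sup>2)}"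

definition eq_ae :: "'h::{complex_hilbert, second_countable_topology} gw \<Rightarrow>
    (X \<Rightarrow> 'h) \<Rightarrow> (X \<Rightarrow> 'h) \<Rightarrow> bool" where
  "eq_ae G f g \<longleftrightarrow> (AE x in gw_measure G. f x = g x)"

definition gw_inner :: "'h::{complex_hilbert, second_countable_topology} gw \<Rightarrow>
    (X \<Rightarrow> 'h) \<Rightarrow> (X \<Rightarrow> 'h) \<Rightarrow> complex" where
  "gw_inner G f g = (LINT x|gw_measure G. cinner (f x) (g x))"

definition gw_norm :: "'h::{complex_hilbert, second_countable_topology} gw \<Rightarrow> (X \<Rightarrow> 'h) \<Rightarrow> real" where
  "gw_norm G f = sqrt (LINT x|gw_measure G. (norm (f x))\<^sup>2)"

text \<open>Additive maps with \<open>T (a f) = h a T f\<close>: linear for \<open>h = id\<close>, antilinear for \<open>h = cnj\<close>.\<close>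

definition semilinear_map :: "(complex \<Rightarrow> complex) \<Rightarrow>
    'h::{complex_hilbert, second_countable_topology} gw \<Rightarrow>
    'h'::{complex_hilbert, second_countable_topology} gw \<Rightarrow>
    ((X \<Rightarrow> 'h) \<Rightarrow> (X \<Rightarrow> 'h')) \<Rightarrow> bool" where
  "semilinear_map h G G' T \<longleftrightarrow>
     (\<forall>f\<in>gw_space G. T f \<in> gw_space G') \<and>
     (\<forall>f\<in>gw_space G. \<forall>g\<in>gw_space G. eq_ae G f g \<longrightarrow> eq_ae G' (T f) (T g)) \<and>
     (\<forall>f\<in>gw_space G. \<forall>g\<in>gw_space G.
        eq_ae G' (T (\<lambda>x. f x + g x)) (\<lambda>x. T f x + T g x)) \<and>
     (\<forall>a. \<forall>f\<in>gw_space G. eq_ae G' (T (\<lambda>x. a *\<^sub>C f x)) (\<lambda>x. h a *\<^sub>C T f x))"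

definition orthogonal_complex_structure :: "('z::real_inner \<Rightarrow> 'z) \<Rightarrow> bool" where
  "orthogonal_complex_structure \<sigma> \<longleftrightarrow>
     linear \<sigma> \<and> (\<forall>v. \<sigma> (\<sigma> v) = - v) \<and> (\<forall>v w. inner (\<sigma> v) (\<sigma> w) = inner v w)"

text \<open>
  The hermitian inner product of \<open>(Z, \<sigma>)\<close> has real part \<open>inner v w\<close> and imaginary part
  \<open>\<plusminus> inner v (\<sigma> w)\<close>; the complex span is the real span of the vectors and their images under \<open>\<sigma>\<close>.
\<close>

definition unitary_basis :: "('z::real_inner \<Rightarrow> 'z) \<Rightarrow> (nat \<Rightarrow> 'z) \<Rightarrow> bool" where
  "unitary_basis \<sigma> z \<longleftrightarrow>
     (\<forall>j k. inner (z j) (z k) = (if j = k then 1 else 0) \<and> inner (z j) (\<sigma> (z k)) = 0) \<and>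
     closure (span (range z \<union> range (\<lambda>k. \<sigma> (z k)))) = UNIV"

text \<open>
  A continuous representation of the complex Clifford algebra over \<open>Z\<close> on \<open>H\<close> in which \<open>Z\<close> acts by
  skew-hermitian operators.  Since the Clifford algebra is the tensor algebra of \<open>Z\<close> modulo
  \<open>z w + w z + 2 (z, w) 1\<close>, such a representation is given by its restriction to \<open>Z\<close>, a real linear
  map into the operators on \<open>H\<close> that satisfies these relations.
\<close>

definition clifford_module :: "'h::{complex_hilbert, second_countable_topology} gw \<Rightarrow>
    ('z::real_inner \<Rightarrow> (X \<Rightarrow> 'h) \<Rightarrow> (X \<Rightarrow> 'h)) \<Rightarrow> bool" where
  "clifford_module G J \<longleftrightarrow>
     (\<forall>v. semilinear_map id G G (J v)) \<and>
     (\<forall>v w. \<forall>f\<in>gw_space G. eq_ae G (J (v + w) f) (\<lambda>x. J v f x + J w f x)) \<and>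
     (\<forall>r v. \<forall>f\<in>gw_space G. eq_ae G (J (r *\<^sub>R v) f) (\<lambda>x. r *\<^sub>R J v f x)) \<and>
     (\<forall>v w. \<forall>f\<in>gw_space G.
        eq_ae G (\<lambda>x. J v (J w f) x + J w (J v f) x) (\<lambda>x. - (2 * inner v w) *\<^sub>R f x)) \<and>
     (\<forall>v. \<forall>f\<in>gw_space G. \<forall>g\<in>gw_space G. gw_inner G (J v f) g = - gw_inner G f (J v g)) \<and>
     (\<exists>C. \<forall>v. \<forall>f\<in>gw_space G. gw_norm G (J v f) \<le> C * norm v * gw_norm G f)"

text \<open>In one-based indices the exponent below is \<open>x\<^sub>1 + \<dots> + x\<^sub>k\<^sub>-\<^sub>1 + 1\<close>.\<close>

definition gw_module :: "('z::real_inner \<Rightarrow> 'z) \<Rightarrow> (nat \<Rightarrow> 'z) \<Rightarrow>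
    'h::{complex_hilbert, second_countable_topology} gw \<Rightarrow>
    ('z \<Rightarrow> (X \<Rightarrow> 'h) \<Rightarrow> (X \<Rightarrow> 'h)) \<Rightarrow> bool" where
  "gw_module \<sigma> z G J \<longleftrightarrow> gw_triple G \<and> clifford_module G J \<and>
     (\<forall>k. \<forall>f\<in>gw_space G.
        eq_ae G (J (z k) f)
          (\<lambda>x. ((-1) ^ ((\<Sum>j<k. of_bool (x j = 1)) + 1) * \<i> *
                 complex_of_real (sqrt (density_of (translate (gw_measure G) (delta k)) (gw_measure G) x)))
               *\<^sub>C gw_coeff G k x (f (x + delta k))) \<and>
        eq_ae G (J (\<sigma> (z k)) f)
          (\<lambda>x. ((-1) ^ of_bool (x k = 1) * \<i>) *\<^sub>C J (z k) f x))"


section \<open>Invariant real forms\<close>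

definition invariant_real_structure :: "'h::{complex_hilbert, second_countable_topology} gw \<Rightarrow>
    ('z::real_inner \<Rightarrow> (X \<Rightarrow> 'h) \<Rightarrow> (X \<Rightarrow> 'h)) \<Rightarrow> ((X \<Rightarrow> 'h) \<Rightarrow> (X \<Rightarrow> 'h)) \<Rightarrow> bool" where
  "invariant_real_structure G J S \<longleftrightarrow>
     semilinear_map cnj G G S \<and>
     (\<forall>f\<in>gw_space G. eq_ae G (S (S f)) f) \<and>
     (\<forall>f\<in>gw_space G. gw_norm G (S f) = gw_norm G f) \<and>
     (\<forall>v. \<forall>f\<in>gw_space G. eq_ae G (S (J v f)) (J v (S f)))"

definition invariant_real_form :: "'h::{complex_hilbert, second_countable_topology} gw \<Rightarrow>
    ('z::real_inner \<Rightarrow> (X \<Rightarrow> 'h) \<Rightarrow> (X \<Rightarrow> 'h)) \<Rightarrow> (X \<Rightarrow> 'h) set \<Rightarrow> bool" where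
  "invariant_real_form G J R \<longleftrightarrow>
     (\<exists>S. invariant_real_structure G J S \<and> R = {f \<in> gw_space G. eq_ae G (S f) f})"

definition unitarily_equivalent ::
    "'h::{complex_hilbert, second_countable_topology} gw \<Rightarrow>
     ('z::real_inner \<Rightarrow> (X \<Rightarrow> 'h) \<Rightarrow> (X \<Rightarrow> 'h)) \<Rightarrow> (X \<Rightarrow> 'h) set \<Rightarrow>
     'h'::{complex_hilbert, second_countable_topology} gw \<Rightarrow>
     ('z \<Rightarrow> (X \<Rightarrow> 'h') \<Rightarrow> (X \<Rightarrow> 'h')) \<Rightarrow> (X \<Rightarrow> 'h') set \<Rightarrow> bool" where
  "unitarily_equivalent G J R G' J' R' \<longleftrightarrow>
     (\<exists>U. semilinear_map id G G' U \<and>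
        (\<forall>f\<in>gw_space G. \<forall>g\<in>gw_space G. gw_inner G' (U f) (U g) = gw_inner G f g) \<and>
        (\<forall>g\<in>gw_space G'. \<exists>f\<in>gw_space G. eq_ae G' (U f) g) \<and>
        (\<forall>v. \<forall>f\<in>gw_space G. eq_ae G' (U (J v f)) (J' v (U f))) \<and>
        (\<forall>f\<in>R. U f \<in> R') \<and> (\<forall>g\<in>R'. \<exists>f\<in>R. eq_ae G' (U f) g))"

text \<open>
  The spaces \<open>H\<^sub>x\<close> of \<open>G\<close> are the complexifications of real Hilbert spaces \<open>K\<^sub>x\<close> that depend only on
  \<open>\<nu> x\<close> and are invariant under \<open>x \<mapsto> x + d\<close> and \<open>x \<mapsto> 1 - x\<close>.
\<close>

definition complexified_fibers ::
    "'k::{real_inner, complete_space, second_countable_topology} complexification gw \<Rightarrow>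
     (X \<Rightarrow> 'k set) \<Rightarrow> bool" where
  "complexified_fibers G K \<longleftrightarrow>
     (\<forall>x. closed (K x) \<and> subspace (K x) \<and> gw_fiber G x = complexified (K x)) \<and>
     (\<forall>x y. gw_mult G x = gw_mult G y \<longrightarrow> K x = K y) \<and>
     (AE x in gw_measure G. (\<forall>d\<in>Delta. K (x + d) = K x) \<and> K (1 - x) = K x)"

text \<open>With one-based indices the sign in the last condition is \<open>(-1)\<^sup>k\<close>.\<close>

definition reflection_compatible ::
    "'k::{real_inner, complete_space, second_countable_topology} complexification gw \<Rightarrow> bool" where
  "reflection_compatible G \<longleftrightarrow>
     equivalent_measures (reflect (gw_measure G)) (gw_measure G) \<and>
     (AE x in gw_measure G. gw_mult G (1 - x) = gw_mult G x) \<and>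
     (AE x in gw_measure G. \<forall>k. \<forall>v\<in>gw_fiber G x.
        conj_op (gw_coeff G k (1 - x)) v = (-1) ^ (k + 1) *\<^sub>C gw_coeff G k x v)"

definition standard_real_form ::
    "'k::{real_inner, complete_space, second_countable_topology} complexification gw \<Rightarrow>
     (X \<Rightarrow> 'k complexification) set" where
  "standard_real_form G =
     {f \<in> gw_space G. AE x in gw_measure G.
        conj_vec (f x) = sqrt (density_of (reflect (gw_measure G)) (gw_measure G) x) *\<^sub>R f (1 - x)}"

end

theory Submission
  imports Defs
begin

text \<open>
  Write \<open>D\<close> for the density of the reflected measure with respect to \<open>\<mu>\<close>.
  The set in the theorem is the fixed-point set of \<open>S\<^sub>0 f (x) = sqrt (D x) \<cdot> conj (f (1 - x))\<close>
  (\<open>std_structure\<close>).  When the reflected measure is equivalent to \<open>\<mu>\<close> and \<open>\<nu>\<close> is symmetric, \<open>S\<^sub>0\<close> is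
  an isometric antilinear involution, because \<open>D x * D (1 - x) = 1\<close>.  The chain rule for densities
  (\<open>density_chain\<close>) turns both \<open>S\<^sub>0 J f\<close> and \<open>J S\<^sub>0 f\<close>, for a generator \<open>J = J (z k)\<close>, into the same
  scalar times \<open>\<plusminus> conj (c\<^sub>k (1 - x) \<dots>)\<close> and \<open>c\<^sub>k (x) conj (\<dots>)\<close> (lemmas \<open>S0_generator\<close> and
  \<open>generator_S0\<close>).  Hence \<open>S\<^sub>0\<close> commutes with the generators exactly if the compatibility condition
  on the \<open>c\<^sub>k\<close> holds; by continuity (\<open>commutes_with_clifford\<close>) it then commutes with the whole
  Clifford action.  This is the direct half, and both formulas are used again in the converse.

  For the converse let \<open>S\<close> be any invariant real structure.  The operator
  \<open>J (\<sigma> (z k)) \<circ> J (z k)\<close> is multiplication by \<open>\<plusminus> \<i>\<close>, with a sign that depends on the coordinate \<open>x k\<close>;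
  since \<open>S\<close> is antilinear and commutes with it, \<open>S\<close> intertwines the indicators of a cylinder set
  \<open>E\<close> and of \<open>1 - E\<close>.  Comparing two finite measures on cylinder sets yields that the reflected
  measure is equivalent to \<open>\<mu>\<close> and, pointwise almost everywhere,
  \<open>\<langle>S f (x), S g (x)\<rangle> = D x \<cdot> cnj \<langle>f (1 - x), g (1 - x)\<rangle>\<close> (\<open>S_cinner\<close>).

  The key point (\<open>adapted_frame\<close>) is that no cohomological obstruction arises: the reflection
  \<open>x \<mapsto> 1 - x\<close> exchanges the sets \<open>x 0 = 0\<close> and \<open>x 0 = 1\<close>.  Choose any measurable field of
  orthonormal bases of the fibres over the first set and let \<open>S\<close> carry it to the second set.  The
  pointwise identity shows that the result is a field of orthonormal bases there, that
  \<open>\<nu> (1 - x) = \<nu> x\<close>, and that in these coordinates \<open>S\<close> is coordinatewise conjugation combined with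
  the reflection.  Sending the adapted bases to real bases of model fibres is a field of unitary
  operators along which the module is transported (locale \<open>frame_transport\<close>); it carries \<open>S\<close> to
  \<open>S\<^sub>0\<close>.  Since \<open>S\<^sub>0\<close> therefore commutes with the transported generators, the two formulas above,
  tested on weighted basis fields, give the compatibility condition for the new \<open>c\<^sub>k\<close>
  (\<open>normal_form\<close>).
\<close>

section \<open>Complex Hilbert spaces\<close>

instance complex_hilbert \<subseteq> banach ..

lemma cinner_add_right: "cinner x (y + w) = cinner x y + cinner x w"
  for x :: "'a::complex_hilbert"
  by (metis cinner_add_left cinner_commute complex_cnj_add)

lemma cinner_scaleC_right: "cinner x (a *\<^sub>C y) = cnj a * cinner x y"
  for x :: "'a::complex_hilbert"
  by (metis cinner_scaleC_left cinner_commute complex_cnj_mult)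

lemma scaleC_zero [simp]: "0 *\<^sub>C x = 0" "a *\<^sub>C 0 = 0" "1 *\<^sub>C x = x" for x :: "'a::complex_hilbert"
  by (simp_all)

lemma scaleC_minus [simp]: "(- a) *\<^sub>C x = - (a *\<^sub>C x)" "a *\<^sub>C (- x) = - (a *\<^sub>C x)"
  for x :: "'a::complex_hilbert"
  by simp_all

lemma cinner_zero [simp]: "cinner 0 x = 0" "cinner x 0 = 0" for x :: "'a::complex_hilbert"
  using cinner_scaleC_left[of 0 0 x] cinner_scaleC_right[of x 0 0] by simp_all

lemma cinner_sum_left: "cinner (sum f A) y = (\<Sum>i\<in>A. cinner (f i) y)"
  for y :: "'a::complex_hilbert"
  by (induction A rule: infinite_finite_induct) (auto simp: cinner_add_left)

lemma cinner_sum_right: "cinner y (sum f A) = (\<Sum>i\<in>A. cinner y (f i))"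
  for y :: "'a::complex_hilbert"
  by (induction A rule: infinite_finite_induct) (auto simp: cinner_add_right)

lemma cinner_eq_inner: "cinner x y = complex_of_real (inner x y) + \<i> * complex_of_real (inner x (\<i> *\<^sub>C y))"
  for x :: "'a::complex_hilbert"
  by (simp add: inner_eq_Re_cinner cinner_scaleC_right complex_eq_iff)

lemma cinner_self: "cinner x x = complex_of_real ((norm x)\<^sup>2)" for x :: "'a::complex_hilbert"
proof -
  have "Im (cinner x x) = 0"
    using cinner_commute[of x x] by (metis complex_cnj complex.sel(2) neg_equal_zero complex.collapse)
  then show ?thesis
    by (simp add: complex_eq_iff power2_norm_eq_inner inner_eq_Re_cinner)
qed

lemma norm_scaleC [simp]: "norm (a *\<^sub>C x) = cmod a * norm x" for x :: "'a::complex_hilbert"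
proof -
  have "complex_of_real ((norm (a *\<^sub>C x))\<^sup>2) = complex_of_real ((cmod a * norm x)\<^sup>2)"
    unfolding cinner_self[symmetric] cinner_scaleC_left cinner_scaleC_right
    by (simp add: cinner_self power_mult_distrib complex_norm_square[of a] del: of_real_power)
  then have "(norm (a *\<^sub>C x))\<^sup>2 = (cmod a * norm x)\<^sup>2"
    using of_real_eq_iff by blast
  then show ?thesis by simp
qed

lemma bounded_linear_scaleC: "bounded_linear (\<lambda>x::'a::complex_hilbert. a *\<^sub>C x)"
  by (rule bounded_linear_intro[of _ "cmod a"])
    (auto simp: scaleC_add_right scaleR_eq_scaleC scaleC_scaleC mult.commute)

lemma scaleC_decompose: "a *\<^sub>C x = Re a *\<^sub>R x + Im a *\<^sub>R (\<i> *\<^sub>C x)" for x :: "'a::complex_hilbert"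
proof -
  have "a *\<^sub>C x = (complex_of_real (Re a) + complex_of_real (Im a) * \<i>) *\<^sub>C x"
    using complex_eq[of a] by (simp add: mult.commute)
  then show ?thesis
    by (simp only: scaleC_add_left scaleR_eq_scaleC scaleC_scaleC)
qed

lemma scaleC_scaleR: "a *\<^sub>C (r *\<^sub>R x) = r *\<^sub>R (a *\<^sub>C x)"
  "(a * complex_of_real r) *\<^sub>C x = r *\<^sub>R (a *\<^sub>C x)" 
  "(complex_of_real r) *\<^sub>C x = r *\<^sub>R x"  for x :: "'a::complex_hilbert"
  by (simp_all add: scaleR_eq_scaleC scaleC_scaleC mult.commute)

lemma tendsto_cinner:
  fixes f :: "'b \<Rightarrow> 'a::complex_hilbert"
  assumes "(f \<longlongrightarrow> a) F" "(g \<longlongrightarrow> b) F"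
  shows "((\<lambda>x. cinner (f x) (g x)) \<longlongrightarrow> cinner a b) F"
  unfolding cinner_eq_inner[abs_def]
  by (intro tendsto_intros assms bounded_linear.tendsto[OF bounded_linear_scaleC])

lemma measurable_scaleC [measurable]:
  fixes f :: "'b \<Rightarrow> 'a::{complex_hilbert, second_countable_topology}"
  assumes [measurable]: "\<phi> \<in> borel_measurable M" "f \<in> borel_measurable M"
  shows "(\<lambda>x. \<phi> x *\<^sub>C f x) \<in> borel_measurable M"
proof -
  have "(\<lambda>x. \<i> *\<^sub>C f x) \<in> borel_measurable M"
    by (rule borel_measurable_continuous_on[OF bounded_linear.continuous_on[OF bounded_linear_scaleC]])
      (auto intro!: continuous_intros)
  then show ?thesis
    by (subst scaleC_decompose) measurable
qed

lemma measurable_cinner [measurable]: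
  fixes f :: "'b \<Rightarrow> 'a::{complex_hilbert, second_countable_topology}"
  assumes [measurable]: "f \<in> borel_measurable M" "g \<in> borel_measurable M"
  shows "(\<lambda>x. cinner (f x) (g x)) \<in> borel_measurable M"
  by (subst cinner_eq_inner) measurable

lemma closure_csubspace:
  assumes "csubspace V" shows "csubspace (closure V)"
proof (rule complex_vs.subspaceI)
  show "0 \<in> closure V"
    using assms closure_subset complex_vs.subspace_0 by blast
next
  fix x y assume "x \<in> closure V" "y \<in> closure V"
  then obtain f g where "\<forall>n. f n \<in> V" "f \<longlonglongrightarrow> x" "\<forall>n. g n \<in> V" "g \<longlonglongrightarrow> y"
    unfolding closure_sequential by blast
  then have "(\<forall>n. f n + g n \<in> V) \<and> (\<lambda>n. f n + g n) \<longlonglongrightarrow> x + y"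
    using assms by (auto intro: complex_vs.subspace_add tendsto_add)
  then show "x + y \<in> closure V"
    unfolding closure_sequential by (intro exI[of _ "\<lambda>n. f n + g n"])
next
  fix a x assume "x \<in> closure V"
  then obtain f where "\<forall>n. f n \<in> V" "f \<longlonglongrightarrow> x"
    unfolding closure_sequential by blast
  then have "(\<forall>n. a *\<^sub>C f n \<in> V) \<and> (\<lambda>n. a *\<^sub>C f n) \<longlonglongrightarrow> a *\<^sub>C x"
    using assms by (auto intro: complex_vs.subspace_scale bounded_linear.tendsto[OF bounded_linear_scaleC])
  then show "a *\<^sub>C x \<in> closure V"
    unfolding closure_sequential by (intro exI[of _ "\<lambda>n. a *\<^sub>C f n"])
qed

lemma csubspace_closure_cspan: "csubspace (closure (cspan B))"
  by (simp add: closure_csubspace complex_vs.subspace_span)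

lemma closure_cspan_least:
  assumes "closed V" "csubspace V" "B \<subseteq> V" shows "closure (cspan B) \<subseteq> V"
  using assms by (simp add: closure_minimal complex_vs.span_minimal)

lemma csubspace_imp_scaleR: "csubspace V \<Longrightarrow> v \<in> V \<Longrightarrow> r *\<^sub>R v \<in> V"
  by (simp add: scaleR_eq_scaleC complex_vs.subspace_scale)

section \<open>Frames\<close>

text \<open>
  The first \<open>n\<close> entries of \<open>e\<close> enumerate an orthonormal basis of \<open>V\<close>, the others are zero.  With this
  padding, finite and infinite dimensions are handled alike and a field of bases is a sequence of
  fields of vectors.
\<close>

definition frame :: "enat \<Rightarrow> 'a::complex_hilbert set \<Rightarrow> (nat \<Rightarrow> 'a) \<Rightarrow> bool" where
  "frame n V e \<longleftrightarrow> (\<forall>i j. cinner (e i) (e j) = of_bool (i = j \<and> enat i < n)) \<and>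
     closure (cspan (range e)) = V"

lemma frameD:
  assumes "frame n V e"
  shows "cinner (e i) (e j) = of_bool (i = j \<and> enat i < n)" "closure (cspan (range e)) = V"
    "e i \<in> V" "csubspace V" "closed V"
proof -
  show *: "closure (cspan (range e)) = V" using assms by (simp add: frame_def)
  have "e i \<in> closure (cspan (range e))"
    by (rule subsetD[OF closure_subset]) (simp add: complex_vs.span_base)
  then show "e i \<in> V" using * by simp
  show "csubspace V" "closed V" unfolding *[symmetric] by (rule csubspace_closure_cspan closed_closure)+
qed (use assms in \<open>simp add: frame_def\<close>)

lemma frame_zero: "frame n V e \<Longrightarrow> \<not> enat i < n \<Longrightarrow> e i = 0"
  using frameD(1)[of n V e i i] by (simp add: cinner_self)

text \<open>The norm of a linear combination depends only on the Gram matrix.\<close>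

lemma gram_norm_eq:
  fixes p :: "'i \<Rightarrow> 'a::complex_hilbert" and q :: "'i \<Rightarrow> 'b::complex_hilbert"
  assumes "\<And>i j. i \<in> F \<Longrightarrow> j \<in> F \<Longrightarrow> cinner (p i) (p j) = cinner (q i) (q j)"
  shows "norm (\<Sum>i\<in>F. a i *\<^sub>C p i) = norm (\<Sum>i\<in>F. a i *\<^sub>C q i)"
proof -
  have "complex_of_real ((norm (\<Sum>i\<in>F. a i *\<^sub>C p i))\<^sup>2) = complex_of_real ((norm (\<Sum>i\<in>F. a i *\<^sub>C q i))\<^sup>2)"
    unfolding cinner_self[symmetric] cinner_sum_left cinner_sum_right cinner_scaleC_left cinner_scaleC_right
    by (intro sum.cong refl) (simp add: assms)
  then have "(norm (\<Sum>i\<in>F. a i *\<^sub>C p i))\<^sup>2 = (norm (\<Sum>i\<in>F. a i *\<^sub>C q i))\<^sup>2"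
    using of_real_eq_iff by blast
  then show ?thesis by simp
qed

text \<open>The antilinear version: coefficients and Gram matrix are conjugated.\<close>

lemma gram_norm_cnj:
  fixes p :: "'i \<Rightarrow> 'a::complex_hilbert" and q :: "'i \<Rightarrow> 'b::complex_hilbert"
  assumes "\<And>i j. i \<in> F \<Longrightarrow> j \<in> F \<Longrightarrow> cinner (p i) (p j) = complex_of_real d * cnj (cinner (q i) (q j))"
    and "d \<ge> 0"
  shows "norm (\<Sum>i\<in>F. cnj (a i) *\<^sub>C p i) = sqrt d * norm (\<Sum>i\<in>F. a i *\<^sub>C q i)"
proof -
  have "complex_of_real ((norm (\<Sum>i\<in>F. cnj (a i) *\<^sub>C p i))\<^sup>2)
      = complex_of_real d * cnj (complex_of_real ((norm (\<Sum>i\<in>F. a i *\<^sub>C q i))\<^sup>2))"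
    unfolding cinner_self[symmetric] cinner_sum_left cinner_sum_right cinner_scaleC_left cinner_scaleC_right
    by (auto simp add: assms sum_distrib_left intro!: sum.cong)
  then have "(norm (\<Sum>i\<in>F. cnj (a i) *\<^sub>C p i))\<^sup>2 = (sqrt d * norm (\<Sum>i\<in>F. a i *\<^sub>C q i))\<^sup>2"
    using assms(2) by (simp only: complex_cnj_complex_of_real of_real_mult[symmetric] of_real_eq_iff
        power_mult_distrib real_sqrt_pow2)
  then show ?thesis using assms(2) by simp
qed

lemma frame_sum_coeff:
  assumes "frame n V e"
  shows "(\<Sum>i<N. a i * cinner (e i) (e j)) = (if j < N \<and> enat j < n then a j else 0)"
proof -
  have "(\<Sum>i<N. a i * cinner (e i) (e j)) = (\<Sum>i<N. if i = j then (if enat j < n then a j else 0) else 0)"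
    by (intro sum.cong refl) (auto simp: frameD(1)[OF assms])
  then show ?thesis by (simp add: sum.delta)
qed

lemma frame_bessel_proj:
  assumes e: "frame n V e"
  defines "P \<equiv> \<lambda>N v. (\<Sum>i<N. cinner v (e i) *\<^sub>C e i)"
  shows "(norm (P N v))\<^sup>2 = (\<Sum>i<N. (cmod (cinner v (e i)))\<^sup>2)" "norm (P N v) \<le> norm v"
proof -
  have "cinner (P N v) (e j) = (if j < N then cinner v (e j) else 0)" for j
    unfolding P_def cinner_sum_left cinner_scaleC_left frame_sum_coeff[OF e]
    by (auto simp: frame_zero[OF e])
  then have "complex_of_real ((norm (P N v))\<^sup>2) = (\<Sum>i<N. complex_of_real ((cmod (cinner v (e i)))\<^sup>2))"
    unfolding cinner_self[symmetric]
    by (subst (2) P_def, unfold cinner_sum_right cinner_scaleC_right, intro sum.cong)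
      (auto simp: complex_norm_square mult.commute simp del: of_real_power)
  then show 1: "(norm (P N v))\<^sup>2 = (\<Sum>i<N. (cmod (cinner v (e i)))\<^sup>2)"
    by (simp only: of_real_sum[symmetric] of_real_eq_iff)
  have "cinner v (P N v) = complex_of_real (\<Sum>i<N. (cmod (cinner v (e i)))\<^sup>2)"
    unfolding P_def cinner_sum_right cinner_scaleC_right
    by (simp add: complex_norm_square mult.commute del: of_real_power)
  then have "inner v (P N v) = (norm (P N v))\<^sup>2"
    using 1 by (simp add: inner_eq_Re_cinner)
  then have "(norm (P N v))\<^sup>2 \<le> norm v * norm (P N v)"
    using norm_cauchy_schwarz[of v "P N v"] by simp
  then show "norm (P N v) \<le> norm v"
    by (cases "norm (P N v) = 0") (auto simp: power2_eq_square)
qed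

lemma frame_expansion:
  assumes e: "frame n V e" and v: "v \<in> V"
  shows "(\<lambda>i. cinner v (e i) *\<^sub>C e i) sums v"
proof -
  define P where "P = (\<lambda>N v. (\<Sum>i<N. cinner v (e i) *\<^sub>C e i))"
  have P_add: "P N (a + b) = P N a + P N b" and P_scale: "P N (c *\<^sub>C a) = c *\<^sub>C P N a" for N a b c
    by (simp_all add: P_def cinner_add_left cinner_scaleC_left scaleC_add_left sum.distrib
        scaleC_scaleC complex_vs.scale_sum_right)
  have P_diff: "P N (a - b) = P N a - P N b" for N a b
    using P_add[of N "a - b" b] by simp
  have fin: "\<exists>M. \<forall>N\<ge>M. P N u = u" if "u \<in> cspan (range e)" for u
    using that
  proof (induction u rule: complex_vs.span_induct_alt)
    case base
    then show ?case by (simp add: P_def)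
  next
    case (step c x y)
    then obtain M i where M: "\<forall>N\<ge>M. P N y = y" "x = e i" by auto
    have "P N (e i) = e i" if "N > i" for N
    proof -
      have "P N (e i) = (\<Sum>j<N. if j = i then e i else 0)"
        unfolding P_def by (intro sum.cong refl) (auto simp: frameD(1)[OF e] of_bool_def frame_zero[OF e])
      then show ?thesis using that by (simp add: sum.delta)
    qed
    then have "\<forall>N\<ge>max M (Suc i). P N (c *\<^sub>C x + y) = c *\<^sub>C x + y"
      using M by (simp add: P_add P_scale)
    then show ?case by blast
  qed
  have "(\<lambda>N. P N v) \<longlonglongrightarrow> v"
  proof (rule LIMSEQ_I)
    fix r :: real assume "r > 0"
    have "v \<in> closure (cspan (range e))" using v frameD(2)[OF e] by simp
    then obtain u where u: "u \<in> cspan (range e)" "dist u v < r / 2"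
      unfolding closure_approachable using \<open>r > 0\<close> by (metis half_gt_zero)
    obtain M where M: "\<forall>N\<ge>M. P N u = u" using fin u by blast
    have "norm (P N v - v) < r" if "N \<ge> M" for N
    proof -
      have *: "P N v - v = P N (v - u) + (u - v)" using M that by (simp add: P_diff)
      have "norm (P N (v - u)) \<le> norm (v - u)"
        using frame_bessel_proj(2)[OF e] by (simp add: P_def)
      then have "norm (P N v - v) \<le> norm (v - u) + norm (u - v)"
        unfolding * using norm_triangle_ineq[of "P N (v - u)" "u - v"] by linarith
      also have "\<dots> < r" using u(2) by (simp add: dist_norm norm_minus_commute)
      finally show ?thesis .
    qed
    then show "\<exists>M. \<forall>N\<ge>M. norm (P N v - v) < r" by blast
  qed
  then show ?thesis by (simp add: sums_def P_def)
qed

lemma frame_parseval: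
  assumes e: "frame n V e" and v: "v \<in> V"
  shows "(\<lambda>i. (cmod (cinner v (e i)))\<^sup>2) sums (norm v)\<^sup>2"
proof -
  have "(\<lambda>N. (norm (\<Sum>i<N. cinner v (e i) *\<^sub>C e i))\<^sup>2) \<longlonglongrightarrow> (norm v)\<^sup>2"
    using frame_expansion[OF e v] unfolding sums_def by (intro tendsto_intros)
  then show ?thesis by (simp add: sums_def frame_bessel_proj(1)[OF e])
qed

lemma frame_ext:
  assumes e: "frame n V e" and v: "v \<in> V" "w \<in> V" "\<And>j. cinner v (e j) = cinner w (e j)"
  shows "v = w"
  using frame_expansion[OF e v(1)] frame_expansion[OF e v(2)] v(3) sums_unique2 by fastforce

text \<open>Double counting of the squared coefficients of one frame with respect to the other: Parseval's
  identity for \<open>a\<close> and Bessel's inequality for \<open>e\<close>.\<close>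

lemma frame_dimension_le:
  assumes a: "frame n V a" and e: "frame m V e"
  shows "m \<le> n"
proof (rule ccontr)
  assume "\<not> m \<le> n"
  then obtain k where k: "n = enat k" and km: "enat k < m" by (cases n) auto
  have "real (Suc k) = (\<Sum>i<Suc k. (norm (e i))\<^sup>2)"
  proof -
    have "(norm (e i))\<^sup>2 = 1" if "i < Suc k" for i
    proof -
      have "enat i < m" using km that by (metis enat_ord_simps(1) less_Suc_eq_le order.strict_trans1)
      then have "complex_of_real ((norm (e i))\<^sup>2) = 1"
        using frameD(1)[OF e, of i i] unfolding cinner_self by simp
      then show ?thesis using of_real_eq_1_iff by blast
    qed
    then have "(\<Sum>i<Suc k. (norm (e i))\<^sup>2) = (\<Sum>i<Suc k. 1)" by (intro sum.cong) auto
    then show ?thesis by simp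
  qed
  also have "\<dots> = (\<Sum>i<Suc k. \<Sum>j<k. (cmod (cinner (a j) (e i)))\<^sup>2)"
  proof (intro sum.cong refl)
    fix i
    have "(\<lambda>j. (cmod (cinner (e i) (a j)))\<^sup>2) sums (norm (e i))\<^sup>2"
      by (rule frame_parseval[OF a frameD(3)[OF e]])
    moreover have "(\<lambda>j. (cmod (cinner (e i) (a j)))\<^sup>2) sums (\<Sum>j<k. (cmod (cinner (e i) (a j)))\<^sup>2)"
    proof (rule sums_finite)
      fix j assume "j \<notin> {..<k}"
      then have "a j = 0" using frame_zero[OF a, of j] k by simp
      then show "(cmod (cinner (e i) (a j)))\<^sup>2 = 0" by simp
    qed simp
    ultimately have "(norm (e i))\<^sup>2 = (\<Sum>j<k. (cmod (cinner (e i) (a j)))\<^sup>2)"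
      by (rule sums_unique2)
    moreover have "cmod (cinner (e i) (a j)) = cmod (cinner (a j) (e i))" for j
      by (subst cinner_commute) simp
    ultimately show "(norm (e i))\<^sup>2 = (\<Sum>j<k. (cmod (cinner (a j) (e i)))\<^sup>2)" by simp
  qed
  also have "\<dots> = (\<Sum>j<k. \<Sum>i<Suc k. (cmod (cinner (a j) (e i)))\<^sup>2)" by (rule sum.swap)
  also have "\<dots> \<le> (\<Sum>j<k. (norm (a j))\<^sup>2)"
  proof (intro sum_mono)
    fix j
    show "(\<Sum>i<Suc k. (cmod (cinner (a j) (e i)))\<^sup>2) \<le> (norm (a j))\<^sup>2"
      unfolding frame_bessel_proj(1)[OF e, symmetric]
      by (intro power_mono frame_bessel_proj(2)[OF e] norm_ge_zero)
  qed
  also have "\<dots> \<le> (\<Sum>j<k. 1)"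
  proof (intro sum_mono)
    fix j
    have "complex_of_real ((norm (a j))\<^sup>2) = complex_of_real (of_bool (enat j < n))"
      using frameD(1)[OF a, of j j] unfolding cinner_self by simp
    then have "(norm (a j))\<^sup>2 = of_bool (enat j < n)" using of_real_eq_iff by blast
    then show "(norm (a j))\<^sup>2 \<le> 1" by simp
  qed
  finally show False by simp
qed

lemma frame_dimension_unique: "frame n V a \<Longrightarrow> frame m V e \<Longrightarrow> m = n"
  by (intro antisym frame_dimension_le)

text \<open>The vector whose coordinates with respect to \<open>e'\<close> are those of \<open>v\<close> with respect to \<open>e\<close>.  If
  \<open>e\<close> and \<open>e'\<close> are frames of \<open>V\<close> and \<open>V'\<close> with the same \<open>n\<close>, this is a unitary map from \<open>V\<close> onto \<open>V'\<close>.\<close>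

definition frame_map :: "(nat \<Rightarrow> 'a::complex_hilbert) \<Rightarrow> (nat \<Rightarrow> 'b::complex_hilbert) \<Rightarrow> 'a \<Rightarrow> 'b" where
  "frame_map e e' v = (\<Sum>i. cinner v (e i) *\<^sub>C e' i)"

lemma frame_map_sums:
  assumes e: "frame n V e" and e': "frame n V' e'" and v: "v \<in> V"
  shows "(\<lambda>i. cinner v (e i) *\<^sub>C e' i) sums frame_map e e' v"
proof -
  have "Cauchy (\<lambda>N. \<Sum>i<N. cinner v (e i) *\<^sub>C e i)"
    using frame_expansion[OF e v] unfolding sums_def by (rule LIMSEQ_imp_Cauchy)
  moreover have "dist (\<Sum>i<M. cinner v (e i) *\<^sub>C e' i) (\<Sum>i<N. cinner v (e i) *\<^sub>C e' i)
     = dist (\<Sum>i<M. cinner v (e i) *\<^sub>C e i) (\<Sum>i<N. cinner v (e i) *\<^sub>C e i)" for M N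
  proof (induction M N rule: linorder_wlog)
    case (le a b)
    have "norm (\<Sum>i\<in>{..<b} - {..<a}. cinner v (e i) *\<^sub>C e' i) = norm (\<Sum>i\<in>{..<b} - {..<a}. cinner v (e i) *\<^sub>C e i)"
      by (rule gram_norm_eq) (simp add: frameD(1)[OF e] frameD(1)[OF e'])
    moreover have "(\<Sum>i\<in>{..<b} - {..<a}. cinner v (e i) *\<^sub>C e' i)
        = (\<Sum>i<b. cinner v (e i) *\<^sub>C e' i) - (\<Sum>i<a. cinner v (e i) *\<^sub>C e' i)"
      using le by (intro sum_diff) auto
    moreover have "(\<Sum>i\<in>{..<b} - {..<a}. cinner v (e i) *\<^sub>C e i)
        = (\<Sum>i<b. cinner v (e i) *\<^sub>C e i) - (\<Sum>i<a. cinner v (e i) *\<^sub>C e i)"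
      using le by (intro sum_diff) auto
    ultimately have "dist (\<Sum>i<b. cinner v (e i) *\<^sub>C e' i) (\<Sum>i<a. cinner v (e i) *\<^sub>C e' i)
        = dist (\<Sum>i<b. cinner v (e i) *\<^sub>C e i) (\<Sum>i<a. cinner v (e i) *\<^sub>C e i)"
      by (simp only: dist_norm)
    then show ?case by (simp only: dist_commute)
  next
    case (sym a b)
    then show ?case by (simp only: dist_commute)
  qed
  ultimately have "Cauchy (\<lambda>N. \<Sum>i<N. cinner v (e i) *\<^sub>C e' i)"
    by (simp add: Cauchy_def)
  then have "summable (\<lambda>i. cinner v (e i) *\<^sub>C e' i)"
    by (simp add: summable_iff_convergent Cauchy_convergent)
  then show ?thesis by (simp add: frame_map_def summable_sums)
qed

lemma frame_map:
  assumes e: "frame n V e" and e': "frame n V' e'" and v: "v \<in> V"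
  shows frame_map_in: "frame_map e e' v \<in> V'"
    and norm_frame_map: "norm (frame_map e e' v) = norm v"
    and cinner_frame_map: "cinner (frame_map e e' v) (e' j) = cinner v (e j)"
proof -
  note S = frame_map_sums[OF assms, unfolded sums_def]
  have "(\<Sum>i<N. cinner v (e i) *\<^sub>C e' i) \<in> V'" for N
    using frameD(3,4)[OF e'] by (intro complex_vs.subspace_sum complex_vs.subspace_scale)
  then show "frame_map e e' v \<in> V'"
    by (rule closed_sequentially[OF frameD(5)[OF e'] _ S])
  have "norm (\<Sum>i<N. cinner v (e i) *\<^sub>C e' i) = norm (\<Sum>i<N. cinner v (e i) *\<^sub>C e i)" for N
    by (rule gram_norm_eq) (simp add: frameD(1)[OF e] frameD(1)[OF e'])
  then have "(\<lambda>N. norm (\<Sum>i<N. cinner v (e i) *\<^sub>C e i)) \<longlonglongrightarrow> norm (frame_map e e' v)"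
    using tendsto_norm[OF S] by (simp only:)
  moreover have "(\<lambda>N. norm (\<Sum>i<N. cinner v (e i) *\<^sub>C e i)) \<longlonglongrightarrow> norm v"
    using frame_expansion[OF e v] unfolding sums_def by (rule tendsto_norm)
  ultimately show "norm (frame_map e e' v) = norm v" by (rule LIMSEQ_unique)
  have "(\<lambda>N. cinner (\<Sum>i<N. cinner v (e i) *\<^sub>C e' i) (e' j)) \<longlonglongrightarrow> cinner (frame_map e e' v) (e' j)"
    by (rule tendsto_cinner[OF S tendsto_const])
  moreover have "cinner (\<Sum>i<N. cinner v (e i) *\<^sub>C e' i) (e' j) = cinner v (e j)" if "N > j" for N
    using that unfolding cinner_sum_left cinner_scaleC_left frame_sum_coeff[OF e']
    by (auto simp: frame_zero[OF e])
  then have "eventually (\<lambda>N. cinner (\<Sum>i<N. cinner v (e i) *\<^sub>C e' i) (e' j) = cinner v (e j)) sequentially"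
    by (rule eventually_mono[OF eventually_gt_at_top[of j]])
  then have "(\<lambda>N. cinner (\<Sum>i<N. cinner v (e i) *\<^sub>C e' i) (e' j)) \<longlonglongrightarrow> cinner v (e j)"
    by (rule tendsto_eventually)
  ultimately show "cinner (frame_map e e' v) (e' j) = cinner v (e j)" by (rule LIMSEQ_unique)
qed

lemma frame_map_inverse:
  assumes e: "frame n V e" and e': "frame n V' e'" and v: "v \<in> V"
  shows "frame_map e' e (frame_map e e' v) = v"
proof -
  have "frame_map e' e (frame_map e e' v) = (\<Sum>i. cinner v (e i) *\<^sub>C e i)"
    unfolding frame_map_def[of e'] using cinner_frame_map[OF assms] by simp
  then show ?thesis using frame_expansion[OF e v] sums_unique by metis
qed

lemma frame_map_linear:
  assumes e: "frame n V e" and e': "frame n V' e'" and v: "v \<in> V" and w: "w \<in> V"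
  shows "frame_map e e' (v + w) = frame_map e e' v + frame_map e e' w"
    and "frame_map e e' (a *\<^sub>C v) = a *\<^sub>C frame_map e e' v"
proof -
  note V = frameD(4)[OF e]
  have "(\<lambda>i. cinner (v + w) (e i) *\<^sub>C e' i) sums (frame_map e e' v + frame_map e e' w)"
    using sums_add[OF frame_map_sums[OF e e' v] frame_map_sums[OF e e' w]]
    by (simp add: cinner_add_left scaleC_add_left)
  then show "frame_map e e' (v + w) = frame_map e e' v + frame_map e e' w"
    by (simp add: frame_map_def sums_iff)
  have "(\<lambda>i. cinner (a *\<^sub>C v) (e i) *\<^sub>C e' i) sums (a *\<^sub>C frame_map e e' v)"
    using bounded_linear.sums[OF bounded_linear_scaleC frame_map_sums[OF e e' v], of a]
    by (simp add: cinner_scaleC_left scaleC_scaleC)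
  then show "frame_map e e' (a *\<^sub>C v) = a *\<^sub>C frame_map e e' v"
    by (simp add: frame_map_def sums_iff)
qed

section \<open>Quasi-invariant involutions of \<open>X\<close>\<close>

lemma space_X_algebra [simp]: "space X_algebra = UNIV"
  by (simp add: X_algebra_def)

lemma coordinate_set_in_X_algebra [measurable]: "{x. x k = 1} \<in> sets X_algebra"
  by (auto simp: X_algebra_def)

lemma translate_measurable [measurable]: "(\<lambda>x. x + d) \<in> measurable X_algebra X_algebra"
  unfolding X_algebra_def
proof (rule measurable_sigma_sets[OF sets_measure_of])
  fix A assume "A \<in> range (\<lambda>k. {x :: X. x k = 1})"
  then obtain k where A: "A = {x. x k = 1}" by auto
  have "(\<lambda>x. x + d) -` A \<inter> space X_algebra = (if d k = 0 then {x. x k = 1} else UNIV - {x. x k = 1})"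
  proof (rule set_eqI)
    fix x :: X
    show "x \<in> (\<lambda>x. x + d) -` A \<inter> space X_algebra \<longleftrightarrow>
        x \<in> (if d k = 0 then {x. x k = 1} else UNIV - {x. x k = 1})"
      by (cases "x k"; cases "d k") (simp_all add: A)
  qed
  also have "\<dots> \<in> sets X_algebra"
    using coordinate_set_in_X_algebra[of k] sets.compl_sets[OF coordinate_set_in_X_algebra[of k]] by auto
  finally show "(\<lambda>x. x + d) -` A \<inter> space (sigma UNIV (range (\<lambda>k. {x. x k = 1})))
      \<in> sets (sigma UNIV (range (\<lambda>k. {x. x k = 1})))"
    by (simp add: X_algebra_def)
qed auto

lemma reflect_measurable [measurable]: "(\<lambda>x. 1 - x) \<in> measurable X_algebra X_algebra"
  unfolding X_algebra_def
proof (rule measurable_sigma_sets[OF sets_measure_of])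
  fix A assume "A \<in> range (\<lambda>k. {x :: X. x k = 1})"
  then obtain k where A: "A = {x. x k = 1}" by auto
  have "(\<lambda>x. 1 - x) -` A \<inter> space X_algebra = UNIV - {x. x k = 1}"
  proof (rule set_eqI)
    fix x :: X
    show "x \<in> (\<lambda>x. 1 - x) -` A \<inter> space X_algebra \<longleftrightarrow> x \<in> UNIV - {x. x k = 1}"
      by (cases "x k") (simp_all add: A)
  qed
  also have "\<dots> \<in> sets X_algebra"
    using sets.compl_sets[OF coordinate_set_in_X_algebra[of k]] by auto
  finally show "(\<lambda>x. 1 - x) -` A \<inter> space (sigma UNIV (range (\<lambda>k. {x. x k = 1})))
      \<in> sets (sigma UNIV (range (\<lambda>k. {x. x k = 1})))"
    by (simp add: X_algebra_def)
qed auto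

lemma translate_translate [simp]: "x + d + d = x" for x d :: X
  by (rule ext) (simp add: add.assoc)

lemma reflect_reflect [simp]: "1 - (1 - x) = x" for x :: X
  by (rule ext) simp

lemma reflect_translate: "1 - (x + d) = 1 - x + d" for x d :: X
  by (rule ext) (simp add: diff_diff_eq[symmetric])

lemma reflect_apply_eq_1 [simp]: "(1 - x) k = 1 \<longleftrightarrow> x k \<noteq> 1" for x :: X
  by (cases "x k") simp_all

lemma delta_in_Delta [simp]: "delta k \<in> Delta"
  by (simp add: delta_def Delta_def)

text \<open>An involution \<open>\<theta>\<close> of \<open>X\<close> under which \<open>\<mu>\<close> is quasi-invariant.  Both the translations by elements
  of \<open>Delta\<close> and the reflection \<open>x \<mapsto> 1 - x\<close> are treated as instances.\<close>

locale quasi_invariant =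
  fixes \<mu> :: "X measure" and \<theta> :: "X \<Rightarrow> X"
  assumes sets_mu: "sets \<mu> = sets X_algebra"
    and sigma_finite_mu: "sigma_finite_measure \<mu>"
    and theta_measurable: "\<theta> \<in> measurable X_algebra X_algebra"
    and theta_theta: "\<theta> (\<theta> x) = x"
    and null_sets_theta: "null_sets (distr \<mu> X_algebra \<theta>) = null_sets \<mu>"
begin

abbreviation D :: "X \<Rightarrow> real" where "D \<equiv> density_of (distr \<mu> X_algebra \<theta>) \<mu>"

sublocale sigma_finite_measure \<mu> by (rule sigma_finite_mu)

lemma theta_measurable_mu [measurable]: "\<theta> \<in> measurable \<mu> \<mu>"
  using theta_measurable sets_mu measurable_cong_sets by blast

lemma AE_theta: "AE x in \<mu>. P x \<Longrightarrow> AE x in \<mu>. P (\<theta> x)"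
proof -
  assume "AE x in \<mu>. P x"
  then have "AE x in distr \<mu> X_algebra \<theta>. P x"
    unfolding eventually_ae_filter null_sets_theta
    using sets_eq_imp_space_eq[OF sets_mu] by simp
  then show ?thesis
    by (rule AE_distrD[rotated]) (use theta_measurable sets_mu measurable_cong_sets in blast)
qed

lemma theta_compose [measurable (raw)]: "f \<in> measurable \<mu> N \<Longrightarrow> (\<lambda>x. f (\<theta> x)) \<in> measurable \<mu> N"
  by (rule measurable_compose[OF theta_measurable_mu])

lemma theta_X [simp]: "\<theta> \<in> measurable \<mu> X_algebra"
  using theta_measurable sets_mu measurable_cong_sets by blast

lemma D_measurable [measurable]: "D \<in> borel_measurable \<mu>"
  unfolding density_of_def by measurable

lemma D_nonneg [simp]: "0 \<le> D x"
  by (simp add: density_of_def)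

text \<open>As \<open>\<theta>\<close> is an involution, \<open>\<mu>\<close> is the image of its own image.\<close>

lemma sigma_finite_distr: "sigma_finite_measure (distr \<mu> X_algebra \<theta>)"
proof (rule sigma_finite_measure_distr)
  show "\<theta> \<in> measurable (distr \<mu> X_algebra \<theta>) X_algebra" using theta_measurable by simp
  have "distr (distr \<mu> X_algebra \<theta>) X_algebra \<theta> = distr \<mu> X_algebra (\<theta> \<circ> \<theta>)"
    using theta_measurable by (simp add: distr_distr)
  also have "\<dots> = \<mu>"
    using distr_id2[OF sets_mu[symmetric]] by (simp add: comp_def theta_theta)
  finally show "sigma_finite_measure (distr (distr \<mu> X_algebra \<theta>) X_algebra \<theta>)"
    using sigma_finite_mu by simp
qed

lemma ennreal_D: "AE x in \<mu>. ennreal (D x) = RN_deriv \<mu> (distr \<mu> X_algebra \<theta>) x"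
proof -
  have "AE x in \<mu>. RN_deriv \<mu> (distr \<mu> X_algebra \<theta>) x \<noteq> \<infinity>"
    by (rule RN_deriv_finite[OF sigma_finite_distr])
      (simp_all add: absolutely_continuous_def null_sets_theta sets_mu)
  then show ?thesis
    by eventually_elim (simp add: density_of_def less_top)
qed

lemma nn_integral_theta:
  assumes [measurable]: "f \<in> borel_measurable \<mu>"
  shows "(\<integral>\<^sup>+x. f (\<theta> x) \<partial>\<mu>) = (\<integral>\<^sup>+x. ennreal (D x) * f x \<partial>\<mu>)"
proof -
  have "f \<in> borel_measurable X_algebra"
    using assms sets_mu measurable_cong_sets by blast
  then have "(\<integral>\<^sup>+x. f (\<theta> x) \<partial>\<mu>) = (\<integral>\<^sup>+x. f x \<partial>distr \<mu> X_algebra \<theta>)"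
    by (simp add: nn_integral_distr)
  also have "\<dots> = (\<integral>\<^sup>+x. RN_deriv \<mu> (distr \<mu> X_algebra \<theta>) x * f x \<partial>\<mu>)"
    by (rule RN_deriv_nn_integral)
      (simp_all add: absolutely_continuous_def null_sets_theta sets_mu)
  also have "\<dots> = (\<integral>\<^sup>+x. ennreal (D x) * f x \<partial>\<mu>)"
    using ennreal_D by (intro nn_integral_cong_AE) auto
  finally show ?thesis .
qed

lemma nn_integral_theta':
  assumes [measurable]: "f \<in> borel_measurable \<mu>"
  shows "(\<integral>\<^sup>+x. ennreal (D x) * f (\<theta> x) \<partial>\<mu>) = (\<integral>\<^sup>+x. f x \<partial>\<mu>)"
  using nn_integral_theta[of "\<lambda>x. f (\<theta> x)"] by (simp add: theta_theta)

lemma D_pos: "AE x in \<mu>. 0 < D x"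
proof -
  let ?f = "\<lambda>x. indicator {x. D x = 0} x :: ennreal"
  have [measurable]: "?f \<in> borel_measurable \<mu>" by measurable
  have "(\<integral>\<^sup>+x. ?f (\<theta> x) \<partial>\<mu>) = (\<integral>\<^sup>+x. ennreal (D x) * ?f x \<partial>\<mu>)"
    by (rule nn_integral_theta) simp
  also have "\<dots> = (\<integral>\<^sup>+x. 0 \<partial>\<mu>)"
    by (intro nn_integral_cong) (auto simp: indicator_def)
  finally have "AE x in \<mu>. ?f (\<theta> x) = 0"
    by (simp add: nn_integral_0_iff_AE)
  then have "AE x in \<mu>. ?f (\<theta> (\<theta> x)) = 0" by (rule AE_theta)
  then show ?thesis
    by eventually_elim (auto simp: theta_theta indicator_def less_le split: if_splits)
qed

end

text \<open>Both sides are the density of the image of \<open>\<mu>\<close> under \<open>\<theta> \<circ> \<tau>\<close>.\<close>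

lemma density_chain:
  assumes \<theta>: "quasi_invariant \<mu> \<theta>" and \<tau>: "quasi_invariant \<mu> \<tau>"
    and commute: "\<And>x. \<theta> (\<tau> x) = \<tau> (\<theta> x)"
  defines "A \<equiv> density_of (distr \<mu> X_algebra \<theta>) \<mu>" and "B \<equiv> density_of (distr \<mu> X_algebra \<tau>) \<mu>"
  shows "AE x in \<mu>. A (\<tau> x) * B x = B (\<theta> x) * A x"
proof -
  interpret t: quasi_invariant \<mu> \<theta> by fact
  interpret u: quasi_invariant \<mu> \<tau> by fact
  have [measurable]: "A \<in> borel_measurable \<mu>" "B \<in> borel_measurable \<mu>"
    by (simp_all add: A_def B_def)
  have [measurable]: "\<theta> \<in> measurable \<mu> \<mu>" "\<tau> \<in> measurable \<mu> \<mu>"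
    by simp_all
  have 1: "(\<integral>\<^sup>+x. f (\<tau> (\<theta> x)) \<partial>\<mu>) = (\<integral>\<^sup>+x. ennreal (A (\<tau> x) * B x) * f x \<partial>\<mu>)"
    if [measurable]: "f \<in> borel_measurable \<mu>" for f
  proof -
    have "(\<integral>\<^sup>+x. f (\<tau> (\<theta> x)) \<partial>\<mu>) = (\<integral>\<^sup>+x. ennreal (A x) * f (\<tau> x) \<partial>\<mu>)"
      using t.nn_integral_theta[of "\<lambda>x. f (\<tau> x)"] by (simp add: A_def)
    also have "\<dots> = (\<integral>\<^sup>+x. ennreal (A (\<tau> (\<tau> x))) * f (\<tau> x) \<partial>\<mu>)"
      by (simp add: u.theta_theta)
    also have "\<dots> = (\<integral>\<^sup>+x. ennreal (B x) * (ennreal (A (\<tau> x)) * f x) \<partial>\<mu>)"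
      using u.nn_integral_theta[of "\<lambda>x. ennreal (A (\<tau> x)) * f x"] by (simp add: B_def)
    finally show ?thesis by (simp add: ennreal_mult' A_def B_def mult_ac)
  qed
  have 2: "(\<integral>\<^sup>+x. f (\<tau> (\<theta> x)) \<partial>\<mu>) = (\<integral>\<^sup>+x. ennreal (B (\<theta> x) * A x) * f x \<partial>\<mu>)"
    if [measurable]: "f \<in> borel_measurable \<mu>" for f
  proof -
    have "(\<integral>\<^sup>+x. f (\<theta> (\<tau> x)) \<partial>\<mu>) = (\<integral>\<^sup>+x. ennreal (B x) * f (\<theta> x) \<partial>\<mu>)"
      using u.nn_integral_theta[of "\<lambda>x. f (\<theta> x)"] by (simp add: B_def)
    also have "\<dots> = (\<integral>\<^sup>+x. ennreal (B (\<theta> (\<theta> x))) * f (\<theta> x) \<partial>\<mu>)"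
      by (simp add: t.theta_theta)
    also have "\<dots> = (\<integral>\<^sup>+x. ennreal (A x) * (ennreal (B (\<theta> x)) * f x) \<partial>\<mu>)"
      using t.nn_integral_theta[of "\<lambda>x. ennreal (B (\<theta> x)) * f x"] by (simp add: A_def)
    finally show ?thesis by (simp add: ennreal_mult' A_def B_def mult_ac commute)
  qed
  have "density \<mu> (\<lambda>x. ennreal (A (\<tau> x) * B x)) = density \<mu> (\<lambda>x. ennreal (B (\<theta> x) * A x))"
  proof (rule measure_eqI)
    fix E assume "E \<in> sets (density \<mu> (\<lambda>x. ennreal (A (\<tau> x) * B x)))"
    then have [measurable]: "E \<in> sets \<mu>" by simp
    show "emeasure (density \<mu> (\<lambda>x. ennreal (A (\<tau> x) * B x))) E
        = emeasure (density \<mu> (\<lambda>x. ennreal (B (\<theta> x) * A x))) E"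
      using 1[of "indicator E"] 2[of "indicator E"] by (simp add: emeasure_density)
  qed simp
  then have "AE x in \<mu>. ennreal (A (\<tau> x) * B x) = ennreal (B (\<theta> x) * A x)"
    by (subst (asm) t.density_unique_iff) auto
  then show ?thesis
    by eventually_elim (simp add: A_def B_def)
qed

context quasi_invariant
begin

lemma D_theta: "AE x in \<mu>. D (\<theta> x) * D x = 1"
proof -
  have "density \<mu> (\<lambda>x. ennreal (D (\<theta> x) * D x)) = density \<mu> (\<lambda>x. 1)"
  proof (rule measure_eqI)
    fix E assume "E \<in> sets (density \<mu> (\<lambda>x. ennreal (D (\<theta> x) * D x)))"
    then have [measurable]: "E \<in> sets \<mu>" by simp
    have "(\<integral>\<^sup>+x. ennreal (D (\<theta> x) * D x) * indicator E x \<partial>\<mu>)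
       = (\<integral>\<^sup>+x. ennreal (D x) * (ennreal (D (\<theta> x)) * indicator E x) \<partial>\<mu>)"
      by (simp add: ennreal_mult' mult_ac)
    also have "\<dots> = (\<integral>\<^sup>+x. ennreal (D x) * indicator E (\<theta> x) \<partial>\<mu>)"
      by (subst nn_integral_theta[symmetric]) (simp_all add: theta_theta)
    also have "\<dots> = (\<integral>\<^sup>+x. indicator E x \<partial>\<mu>)"
      by (rule nn_integral_theta') simp
    finally show "emeasure (density \<mu> (\<lambda>x. ennreal (D (\<theta> x) * D x))) E = emeasure (density \<mu> (\<lambda>x. 1)) E"
      by (simp add: emeasure_density)
  qed simp
  then have "AE x in \<mu>. ennreal (D (\<theta> x) * D x) = 1"
    by (subst (asm) density_unique_iff) auto
  then show ?thesis
    by eventually_elim (metis D_nonneg ennreal_eq_1)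
qed

end

section \<open>Square-integrable fields\<close>

text \<open>A Garding-Wightman triple, with short names for its components; \<open>V x\<close> is the fibre at \<open>x\<close>.\<close>

locale garding_wightman =
  fixes G :: "'h::{complex_hilbert, second_countable_topology} gw"
  assumes triple: "gw_triple G"
begin

abbreviation \<mu> where "\<mu> \<equiv> gw_measure G"
abbreviation \<nu> where "\<nu> \<equiv> gw_mult G"
abbreviation c where "c \<equiv> gw_coeff G"
abbreviation V where "V \<equiv> gw_fiber G"

lemma sets_mu: "sets \<mu> = sets X_algebra"
  and sigma_finite_mu: "sigma_finite_measure \<mu>"
  and translate_null: "d \<in> Delta \<Longrightarrow> null_sets (translate \<mu> d) = null_sets \<mu>"
  and nu_measurable_X: "\<nu> \<in> measurable X_algebra (count_space UNIV)"
  and AE_nu: "AE x in \<mu>. \<forall>d\<in>Delta. \<nu> (x + d) = \<nu> x"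
  and fiber_dim: "hilbert_subspace_of_dim (V x) (\<nu> x)"
  and fiber_eq: "\<nu> x = \<nu> y \<Longrightarrow> V x = V y"
  and AE_unitary: "AE x in \<mu>. \<forall>k. unitary_on (V x) (c k x)"
  and coeff_measurable: "f \<in> measurable_fields G \<Longrightarrow> (\<lambda>x. c k x (f x)) \<in> borel_measurable \<mu>"
  and AE_adjoint: "AE x in \<mu>. \<forall>k. \<forall>v\<in>V x. \<forall>w\<in>V x.
          cinner (c k x v) w = cinner v (c k (x + delta k) w)"
  and AE_commute: "AE x in \<mu>. \<forall>k l. \<forall>v\<in>V x.
          c k x (c l (x + delta k) v) = c l x (c k (x + delta l) v)"
  using triple unfolding gw_triple_def Let_def equivalent_measures_def by blast+

sublocale sigma_finite_measure \<mu> by (rule sigma_finite_mu)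

lemma nu_measurable [measurable]: "\<nu> \<in> measurable \<mu> (count_space UNIV)"
  using nu_measurable_X sets_mu measurable_cong_sets by blast

lemma nu_equal_measurable:
  assumes [measurable]: "\<theta> \<in> measurable \<mu> \<mu>"
  shows "Measurable.pred \<mu> (\<lambda>x. \<nu> (\<theta> x) = \<nu> x)"
proof -
  have 1: "(\<lambda>x. \<nu> (\<theta> x)) \<in> measurable \<mu> (count_space UNIV)"
    by (rule measurable_compose[OF assms nu_measurable])
  have "{x \<in> space \<mu>. \<nu> (\<theta> x) = \<nu> x}
      = (\<Union>n. ((\<lambda>x. \<nu> (\<theta> x)) -` {n} \<inter> space \<mu>) \<inter> (\<nu> -` {n} \<inter> space \<mu>))"
    by auto
  also have "\<dots> \<in> sets \<mu>"
    by (intro sets.countable_UN' sets.Int measurable_sets[OF 1] measurable_sets[OF nu_measurable]) auto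
  finally show ?thesis by (simp add: pred_def)
qed

lemma quasi_invariant_translate: "d \<in> Delta \<Longrightarrow> quasi_invariant \<mu> (\<lambda>x. x + d)"
  using translate_null[of d]
  by unfold_locales (auto simp: sets_mu translate_def sigma_finite simp del: add_bit_eq_xor)

lemma fiber_closed: "closed (V x)" and fiber_csubspace: "csubspace (V x)"
  using fiber_dim[of x] by (auto simp: hilbert_subspace_of_dim_def)

lemma fiber_add: "v \<in> V x \<Longrightarrow> w \<in> V x \<Longrightarrow> v + w \<in> V x"
  and fiber_scale: "v \<in> V x \<Longrightarrow> a *\<^sub>C v \<in> V x"
  and fiber_scaleR: "v \<in> V x \<Longrightarrow> r *\<^sub>R v \<in> V x"
  and fiber_zero [simp]: "0 \<in> V x"
  using fiber_csubspace[of x] complex_vs.subspace_add complex_vs.subspace_scale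
    complex_vs.subspace_0 csubspace_imp_scaleR by blast+

lemma spaceD:
  assumes "f \<in> gw_space G"
  shows "f \<in> borel_measurable \<mu>" "f x \<in> V x" "integrable \<mu> (\<lambda>x. (norm (f x))\<^sup>2)"
    "f \<in> measurable_fields G" "(\<integral>\<^sup>+x. ennreal ((norm (f x))\<^sup>2) \<partial>\<mu>) < \<infinity>"
    "ennreal ((gw_norm G f)\<^sup>2) = (\<integral>\<^sup>+x. ennreal ((norm (f x))\<^sup>2) \<partial>\<mu>)"
proof -
  show *: "f \<in> borel_measurable \<mu>" "f x \<in> V x" "integrable \<mu> (\<lambda>x. (norm (f x))\<^sup>2)"
    "f \<in> measurable_fields G"
    using assms unfolding gw_space_def measurable_fields_def by auto
  have "(\<integral>\<^sup>+x. ennreal ((norm (f x))\<^sup>2) \<partial>\<mu>) = ennreal (LINT x|\<mu>. (norm (f x))\<^sup>2)"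
    using * by (intro nn_integral_eq_integral) auto
  moreover have "(gw_norm G f)\<^sup>2 = (LINT x|\<mu>. (norm (f x))\<^sup>2)"
    unfolding gw_norm_def by (intro real_sqrt_pow2 integral_nonneg_AE) auto
  ultimately show "ennreal ((gw_norm G f)\<^sup>2) = (\<integral>\<^sup>+x. ennreal ((norm (f x))\<^sup>2) \<partial>\<mu>)"
    "(\<integral>\<^sup>+x. ennreal ((norm (f x))\<^sup>2) \<partial>\<mu>) < \<infinity>" by simp_all
qed

lemma spaceI:
  assumes "f \<in> borel_measurable \<mu>" "\<And>x. f x \<in> V x" "(\<integral>\<^sup>+x. ennreal ((norm (f x))\<^sup>2) \<partial>\<mu>) < \<infinity>"
  shows "f \<in> gw_space G"
  using assms unfolding gw_space_def measurable_fields_def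
  by (auto intro!: integrableI_nonneg)

lemma space_dominated:
  assumes f: "f \<in> gw_space G" and g [measurable]: "g \<in> borel_measurable \<mu>" "\<And>x. g x \<in> V x"
    and le: "AE x in \<mu>. norm (g x) \<le> norm (f x)"
  shows "g \<in> gw_space G"
proof (rule spaceI)
  have "(\<integral>\<^sup>+x. ennreal ((norm (g x))\<^sup>2) \<partial>\<mu>) \<le> (\<integral>\<^sup>+x. ennreal ((norm (f x))\<^sup>2) \<partial>\<mu>)"
    using le by (intro nn_integral_mono_AE) (auto intro!: ennreal_leI power_mono elim!: eventually_mono)
  then show "(\<integral>\<^sup>+x. ennreal ((norm (g x))\<^sup>2) \<partial>\<mu>) < \<infinity>"
    using spaceD(5)[OF f] by (rule order.strict_trans1)
qed (use g in auto)

lemma space_scale: "f \<in> gw_space G \<Longrightarrow> (\<lambda>x. a *\<^sub>C f x) \<in> gw_space G"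
proof -
  assume f: "f \<in> gw_space G"
  note [measurable] = spaceD(1)[OF f]
  show ?thesis
  proof (rule spaceI)
    have "(\<integral>\<^sup>+x. ennreal ((norm (a *\<^sub>C f x))\<^sup>2) \<partial>\<mu>)
        = ennreal ((cmod a)\<^sup>2) * (\<integral>\<^sup>+x. ennreal ((norm (f x))\<^sup>2) \<partial>\<mu>)"
      by (subst nn_integral_cmult[symmetric]) (auto simp: power_mult_distrib ennreal_mult')
    also have "\<dots> < \<infinity>" using spaceD(5)[OF f] by (simp add: ennreal_mult_less_top)
    finally show "(\<integral>\<^sup>+x. ennreal ((norm (a *\<^sub>C f x))\<^sup>2) \<partial>\<mu>) < \<infinity>" .
  qed (use spaceD[OF f] fiber_scale in auto)
qed

lemma space_add: "f \<in> gw_space G \<Longrightarrow> g \<in> gw_space G \<Longrightarrow> (\<lambda>x. f x + g x) \<in> gw_space G"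
proof -
  assume f: "f \<in> gw_space G" and g: "g \<in> gw_space G"
  note [measurable] = spaceD(1)[OF f] spaceD(1)[OF g]
  show ?thesis
  proof (rule spaceI)
    have "(\<integral>\<^sup>+x. ennreal ((norm (f x + g x))\<^sup>2) \<partial>\<mu>)
        \<le> (\<integral>\<^sup>+x. 2 * ennreal ((norm (f x))\<^sup>2) + 2 * ennreal ((norm (g x))\<^sup>2) \<partial>\<mu>)"
    proof (rule nn_integral_mono)
      fix x
      have "(norm (f x + g x))\<^sup>2 \<le> (norm (f x) + norm (g x))\<^sup>2"
        by (intro power_mono norm_triangle_ineq norm_ge_zero)
      also have "\<dots> \<le> 2 * (norm (f x))\<^sup>2 + 2 * (norm (g x))\<^sup>2"
        using sum_squares_bound[of "norm (f x)" "norm (g x)"] by (simp add: power2_sum)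
      finally have *: "(norm (f x + g x))\<^sup>2 \<le> 2 * (norm (f x))\<^sup>2 + 2 * (norm (g x))\<^sup>2" .
      show "ennreal ((norm (f x + g x))\<^sup>2) \<le> 2 * ennreal ((norm (f x))\<^sup>2) + 2 * ennreal ((norm (g x))\<^sup>2)"
      proof -
        have "2 * ennreal a + 2 * ennreal b = ennreal (2 * a + 2 * b)" if "0 \<le> a" "0 \<le> b" for a b
          using that by (simp add: ennreal_mult')
        then show ?thesis by (simp only: zero_le_power2) (intro ennreal_leI *)
      qed
    qed
    also have "\<dots> = 2 * (\<integral>\<^sup>+x. ennreal ((norm (f x))\<^sup>2) \<partial>\<mu>) + 2 * (\<integral>\<^sup>+x. ennreal ((norm (g x))\<^sup>2) \<partial>\<mu>)"
      by (simp add: nn_integral_add nn_integral_cmult)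
    also have "\<dots> < \<infinity>" using spaceD(5)[OF f] spaceD(5)[OF g] by (simp add: ennreal_mult_less_top)
    finally show "(\<integral>\<^sup>+x. ennreal ((norm (f x + g x))\<^sup>2) \<partial>\<mu>) < \<infinity>" .
  qed (use spaceD[OF f] spaceD[OF g] fiber_add in auto)
qed

lemma space_minus: "f \<in> gw_space G \<Longrightarrow> (\<lambda>x. - f x) \<in> gw_space G"
  using space_scale[of f "-1"] by simp

lemma space_diff: "f \<in> gw_space G \<Longrightarrow> g \<in> gw_space G \<Longrightarrow> (\<lambda>x. f x - g x) \<in> gw_space G"
  using space_add[of f "\<lambda>x. - g x"] space_minus[of g] by simp

lemma space_restrict:
  assumes f: "f \<in> gw_space G" and [measurable]: "Measurable.pred \<mu> P"
  shows "(\<lambda>x. if P x then f x else 0) \<in> gw_space G"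
proof (rule space_dominated[OF f])
  note [measurable] = spaceD(1)[OF f]
  show "(\<lambda>x. if P x then f x else 0) \<in> borel_measurable \<mu>" by measurable
qed (use spaceD[OF f] in auto)

lemma gw_norm_zero_AE:
  assumes f: "f \<in> gw_space G" and "gw_norm G f = 0"
  shows "AE x in \<mu>. f x = 0"
proof -
  note [measurable] = spaceD(1)[OF f]
  have "(\<integral>\<^sup>+x. ennreal ((norm (f x))\<^sup>2) \<partial>\<mu>) = 0" using spaceD(6)[OF f] assms(2) by simp
  then show ?thesis by (simp add: nn_integral_0_iff_AE)
qed

lemma gw_norm_cong_AE:
  assumes "f \<in> gw_space G" "g \<in> gw_space G" "AE x in \<mu>. norm (f x) = norm (g x)"
  shows "gw_norm G f = gw_norm G g"
proof -
  note [measurable] = spaceD(1)[OF assms(1)] spaceD(1)[OF assms(2)]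
  have "(LINT x|\<mu>. (norm (f x))\<^sup>2) = (LINT x|\<mu>. (norm (g x))\<^sup>2)"
    by (rule integral_cong_AE) (use assms(3) in auto)
  then show ?thesis by (simp add: gw_norm_def)
qed

lemma gw_norm_nonneg: "0 \<le> gw_norm G f"
  unfolding gw_norm_def by (intro real_sqrt_ge_zero integral_nonneg_AE) auto

lemma gw_norm_diff_square:
  assumes f: "f \<in> gw_space G" and g: "g \<in> gw_space G"
  shows "(gw_norm G (\<lambda>x. f x - g x))\<^sup>2 \<le> 2 * (gw_norm G f)\<^sup>2 + 2 * (gw_norm G g)\<^sup>2"
proof -
  note fg = space_diff[OF f g]
  have sq: "(gw_norm G h)\<^sup>2 = (LINT x|\<mu>. (norm (h x))\<^sup>2)" for h
    unfolding gw_norm_def by (intro real_sqrt_pow2 integral_nonneg_AE) auto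
  have "(LINT x|\<mu>. (norm (f x - g x))\<^sup>2) \<le> (LINT x|\<mu>. 2 * (norm (f x))\<^sup>2 + 2 * (norm (g x))\<^sup>2)"
  proof (rule integral_mono)
    fix x
    have "(norm (f x - g x))\<^sup>2 \<le> (norm (f x) + norm (g x))\<^sup>2"
      by (intro power_mono norm_triangle_ineq4 norm_ge_zero)
    also have "\<dots> \<le> 2 * (norm (f x))\<^sup>2 + 2 * (norm (g x))\<^sup>2"
      using sum_squares_bound[of "norm (f x)" "norm (g x)"] by (simp add: power2_sum)
    finally show "(norm (f x - g x))\<^sup>2 \<le> 2 * (norm (f x))\<^sup>2 + 2 * (norm (g x))\<^sup>2" .
  qed (use spaceD(3)[OF f] spaceD(3)[OF g] spaceD(3)[OF fg] in auto)
  also have "\<dots> = 2 * (LINT x|\<mu>. (norm (f x))\<^sup>2) + 2 * (LINT x|\<mu>. (norm (g x))\<^sup>2)"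
    using spaceD(3)[OF f] spaceD(3)[OF g] by simp
  finally show ?thesis by (simp add: sq)
qed

text \<open>Multiplication by \<open>w\<close> makes bounded fields square-integrable.\<close>

lemma obtain_weight:
  obtains w :: "X \<Rightarrow> real" where "w \<in> borel_measurable \<mu>" "\<And>x. w x > 0" "(\<integral>\<^sup>+x. ennreal ((w x)\<^sup>2) \<partial>\<mu>) < \<infinity>"
proof -
  obtain f :: "X \<Rightarrow> real" where f: "f \<in> borel_measurable \<mu>" "\<And>x. f x > 0" "\<And>x. f x \<le> 1" "integrable \<mu> f"
    using obtain_positive_integrable_function by blast
  show ?thesis
  proof (rule that[of "\<lambda>x. sqrt (f x)"])
    show "(\<integral>\<^sup>+x. ennreal ((sqrt (f x))\<^sup>2) \<partial>\<mu>) < \<infinity>"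
      using f(4) f(2) by (simp add: less_imp_le nn_integral_eq_integral)
  qed (use f in auto)
qed

text \<open>A basis that depends only on \<open>\<nu> x\<close> is measurable because \<open>\<nu>\<close> is.\<close>

lemma obtain_frame:
  obtains e :: "X \<Rightarrow> nat \<Rightarrow> 'h" where "\<And>x. frame (\<nu> x) (V x) (e x)"
    "\<And>j. (\<lambda>x. e x j) \<in> borel_measurable \<mu>"
proof -
  have ex: "\<exists>e. frame n W e" if W: "hilbert_subspace_of_dim W n" for W :: "'h set" and n
  proof -
    obtain B where B: "orthonormal_basis_of W B" "countable B"
      "case n of enat m \<Rightarrow> finite B \<and> card B = m | \<infinity> \<Rightarrow> infinite B"
      using W unfolding hilbert_subspace_of_dim_def by blast
    have "\<exists>b. bij_betw b {j. enat j < n} B"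
    proof (cases n)
      case (enat m)
      then have "finite B" "card B = m" using B(3) by auto
      then obtain b where "bij_betw b {0..<m} B" using ex_bij_betw_nat_finite by blast
      then show ?thesis using enat by (auto simp: atLeast0LessThan lessThan_def)
    next
      case infinity
      then have "infinite B" using B(3) by auto
      then have "bij_betw (from_nat_into B) UNIV B"
        using B(2) by (simp add: bij_betw_from_nat_into)
      then show ?thesis using infinity by auto
    qed
    then obtain b where b: "bij_betw b {j. enat j < n} B" ..
    define e where "e j = (if enat j < n then b j else 0)" for j
    have "cspan (range e) = cspan B"
    proof (rule antisym)
      have "range e \<subseteq> cspan B"
        using b by (auto simp: e_def bij_betw_def intro: complex_vs.span_base complex_vs.span_zero)
      then show "cspan (range e) \<subseteq> cspan B"
        by (simp add: complex_vs.span_minimal complex_vs.subspace_span)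
      have "B \<subseteq> range e"
      proof
        fix u assume "u \<in> B"
        then obtain j where "enat j < n" "u = b j" using b by (auto simp: bij_betw_def)
        then have "u = e j" by (simp add: e_def)
        then show "u \<in> range e" by simp
      qed
      then show "cspan B \<subseteq> cspan (range e)" by (rule complex_vs.span_mono)
    qed
    moreover have "cinner (e i) (e j) = of_bool (i = j \<and> enat i < n)" for i j
    proof (cases "enat i < n \<and> enat j < n")
      case True
      then have "b i \<in> B" "b j \<in> B" "b i = b j \<longleftrightarrow> i = j"
        using b by (auto simp: bij_betw_def inj_on_def)
      then show ?thesis using True B(1) by (simp add: orthonormal_basis_of_def e_def)
    qed (auto simp: e_def)
    ultimately have "frame n W e" using B(1) by (simp add: frame_def orthonormal_basis_of_def)
    then show ?thesis by blast
  qed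
  define E where "E n = (SOME e. \<forall>x. \<nu> x = n \<longrightarrow> frame n (V x) e)" for n
  have E: "frame (\<nu> x) (V x) (E (\<nu> x))" for x
  proof -
    obtain e where "frame (\<nu> x) (V x) e" using ex[OF fiber_dim] by blast
    then have "\<forall>y. \<nu> y = \<nu> x \<longrightarrow> frame (\<nu> x) (V y) e" using fiber_eq by metis
    then have "\<forall>y. \<nu> y = \<nu> x \<longrightarrow> frame (\<nu> x) (V y) (E (\<nu> x))"
      unfolding E_def by (rule someI[where P="\<lambda>e. \<forall>y. \<nu> y = \<nu> x \<longrightarrow> frame (\<nu> x) (V y) e"])
    then show ?thesis by simp
  qed
  show ?thesis
  proof (rule that[of "\<lambda>x. E (\<nu> x)"])
    fix j show "(\<lambda>x. E (\<nu> x) j) \<in> borel_measurable \<mu>"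
      by (rule measurable_compose[OF nu_measurable]) simp
  qed (use E in auto)
qed

end

lemma eq_ae_sym: "eq_ae G f g \<Longrightarrow> eq_ae G g f"
  unfolding eq_ae_def by (auto elim: eventually_mono)

lemma eq_ae_trans [trans]: "eq_ae G f g \<Longrightarrow> eq_ae G g h \<Longrightarrow> eq_ae G f h"
  unfolding eq_ae_def by (auto elim: eventually_elim2)

lemma semilinearD:
  assumes "semilinear_map h G G' T" and "f \<in> gw_space G"
  shows "T f \<in> gw_space G'"
    and "g \<in> gw_space G \<Longrightarrow> eq_ae G f g \<Longrightarrow> eq_ae G' (T f) (T g)"
    and "g \<in> gw_space G \<Longrightarrow> eq_ae G' (T (\<lambda>x. f x + g x)) (\<lambda>x. T f x + T g x)"
    and "eq_ae G' (T (\<lambda>x. a *\<^sub>C f x)) (\<lambda>x. h a *\<^sub>C T f x)"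
  using assms unfolding semilinear_map_def by blast+

lemma cinner_polarization:
  "cinner x y = complex_of_real (((norm (x + y))\<^sup>2 - (norm (x - y))\<^sup>2) / 4)
     + \<i> * complex_of_real (((norm (x + \<i> *\<^sub>C y))\<^sup>2 - (norm (x - \<i> *\<^sub>C y))\<^sup>2) / 4)"
  for x y :: "'a::complex_hilbert"
proof -
  have *: "((norm (x + y))\<^sup>2 - (norm (x - y))\<^sup>2) / 4 = inner x y" for x y :: 'a
    by (simp add: power2_norm_eq_inner inner_add_left inner_add_right inner_diff_left inner_diff_right
        inner_commute)
  show ?thesis unfolding * by (rule cinner_eq_inner)
qed

section \<open>Operators that commute with the Clifford action\<close>

lemma semilinear_diff:
  assumes T: "semilinear_map h G G' T" and G: "gw_triple G" and h: "h (-1) = -1"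
    and f: "f \<in> gw_space G" and g: "g \<in> gw_space G"
  shows "eq_ae G' (T (\<lambda>x. f x - g x)) (\<lambda>x. T f x - T g x)"
proof -
  interpret garding_wightman G by unfold_locales (rule G)
  have "eq_ae G' (T (\<lambda>x. f x + - g x)) (\<lambda>x. T f x + T (\<lambda>x. - g x) x)"
    by (rule semilinearD(3)[OF T f space_minus[OF g]])
  moreover have "eq_ae G' (T (\<lambda>x. (-1) *\<^sub>C g x)) (\<lambda>x. h (-1) *\<^sub>C T g x)"
    by (rule semilinearD(4)[OF T g])
  ultimately show ?thesis
    unfolding eq_ae_def by eventually_elim (simp add: h)
qed

lemma cliffordD:
  assumes J: "clifford_module G J" and f: "f \<in> gw_space G"
  shows "semilinear_map id G G (J v)" "J v f \<in> gw_space G"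
    "g \<in> gw_space G \<Longrightarrow> eq_ae G f g \<Longrightarrow> eq_ae G (J v f) (J v g)"
    "eq_ae G (J (v + w) f) (\<lambda>x. J v f x + J w f x)"
    "eq_ae G (J (r *\<^sub>R v) f) (\<lambda>x. r *\<^sub>R J v f x)"
    "eq_ae G (\<lambda>x. J v (J w f) x + J w (J v f) x) (\<lambda>x. - (2 * inner v w) *\<^sub>R f x)"
proof -
  show *: "semilinear_map id G G (J v)" for v using J unfolding clifford_module_def by blast
  show "J v f \<in> gw_space G" using semilinearD(1)[OF * f] .
  show "g \<in> gw_space G \<Longrightarrow> eq_ae G f g \<Longrightarrow> eq_ae G (J v f) (J v g)" using semilinearD(2)[OF * f] .
  show "eq_ae G (J (v + w) f) (\<lambda>x. J v f x + J w f x)"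
    "eq_ae G (J (r *\<^sub>R v) f) (\<lambda>x. r *\<^sub>R J v f x)"
    "eq_ae G (\<lambda>x. J v (J w f) x + J w (J v f) x) (\<lambda>x. - (2 * inner v w) *\<^sub>R f x)"
    using J f unfolding clifford_module_def by blast+
qed

text \<open>The set of vectors \<open>v\<close> for which \<open>S\<close> commutes with \<open>J v\<close> is a closed real subspace, so it suffices
  that it contains a unitary basis and its image under \<open>\<sigma>\<close>.\<close>

lemma (in garding_wightman) commutes_with_clifford:
  assumes J: "clifford_module G J" and basis: "unitary_basis \<sigma> z"
    and S: "semilinear_map cnj G G S"
    and S_norm: "\<And>f. f \<in> gw_space G \<Longrightarrow> gw_norm G (S f) = gw_norm G f"
    and gen: "\<And>k f. f \<in> gw_space G \<Longrightarrow> eq_ae G (S (J (z k) f)) (J (z k) (S f))"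
      "\<And>k f. f \<in> gw_space G \<Longrightarrow> eq_ae G (S (J (\<sigma> (z k)) f)) (J (\<sigma> (z k)) (S f))"
    and f: "f \<in> gw_space G"
  shows "eq_ae G (S (J v f)) (J v (S f))"
proof -
  define W where "W = {v. \<forall>f\<in>gw_space G. eq_ae G (S (J v f)) (J v (S f))}"
  note SS = semilinearD(1)[OF S] and JS = cliffordD(2)[OF J]
  have add: "v + w \<in> W" if "v \<in> W" "w \<in> W" for v w
    unfolding W_def
  proof safe
    fix f assume f: "f \<in> gw_space G"
    have "eq_ae G (S (J (v + w) f)) (S (\<lambda>x. J v f x + J w f x))"
      by (intro semilinearD(2)[OF S] JS f space_add cliffordD(4)[OF J])
    moreover have "eq_ae G (S (\<lambda>x. J v f x + J w f x)) (\<lambda>x. S (J v f) x + S (J w f) x)"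
      by (intro semilinearD(3)[OF S] JS f)
    moreover have "eq_ae G (S (J v f)) (J v (S f))" "eq_ae G (S (J w f)) (J w (S f))"
      using that f unfolding W_def by auto
    moreover have "eq_ae G (J (v + w) (S f)) (\<lambda>x. J v (S f) x + J w (S f) x)"
      by (intro cliffordD(4)[OF J] SS f)
    ultimately show "eq_ae G (S (J (v + w) f)) (J (v + w) (S f))"
      unfolding eq_ae_def by eventually_elim simp
  qed
  have scale: "r *\<^sub>R v \<in> W" if "v \<in> W" for r v
    unfolding W_def
  proof safe
    fix f assume f: "f \<in> gw_space G"
    have "eq_ae G (S (J (r *\<^sub>R v) f)) (S (\<lambda>x. complex_of_real r *\<^sub>C J v f x))"
      using cliffordD(5)[OF J f, of r v]
      by (intro semilinearD(2)[OF S] JS f space_scale) (simp add: scaleR_eq_scaleC)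
    moreover have "eq_ae G (S (\<lambda>x. complex_of_real r *\<^sub>C J v f x)) (\<lambda>x. cnj (complex_of_real r) *\<^sub>C S (J v f) x)"
      by (intro semilinearD(4)[OF S] JS f)
    moreover have "eq_ae G (S (J v f)) (J v (S f))"
      using that f unfolding W_def by auto
    moreover have "eq_ae G (J (r *\<^sub>R v) (S f)) (\<lambda>x. r *\<^sub>R J v (S f) x)"
      by (intro cliffordD(5)[OF J] SS f)
    ultimately show "eq_ae G (S (J (r *\<^sub>R v) f)) (J (r *\<^sub>R v) (S f))"
      unfolding eq_ae_def by eventually_elim (simp add: scaleR_eq_scaleC)
  qed
  obtain C where C: "\<And>v f. f \<in> gw_space G \<Longrightarrow> gw_norm G (J v f) \<le> C * norm v * gw_norm G f"
    using J unfolding clifford_module_def by blast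
  have closed: "closed W"
    unfolding closed_sequential_limits
  proof (intro allI impI, elim conjE)
    fix u v assume u: "\<forall>n. u n \<in> W" and lim: "u \<longlonglongrightarrow> v"
    show "v \<in> W"
      unfolding W_def
    proof safe
      fix f assume f: "f \<in> gw_space G"
      define d where "d = (\<lambda>x. S (J v f) x - J v (S f) x)"
      have d: "d \<in> gw_space G" unfolding d_def by (intro space_diff SS JS f)
      \<comment> \<open>Replacing \<open>v\<close> by \<open>v - u n\<close> changes \<open>d\<close> only on a null set, as \<open>u n\<close> lies in \<open>W\<close>.\<close>
      have bound: "(gw_norm G d)\<^sup>2 \<le> 4 * (C * norm (v - u n) * gw_norm G f)\<^sup>2" for n
      proof -
        have "eq_ae G (J ((v - u n) + u n) f) (\<lambda>x. J (v - u n) f x + J (u n) f x)"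
          by (intro cliffordD(4)[OF J f])
        then have "eq_ae G (S (J v f)) (S (\<lambda>x. J (v - u n) f x + J (u n) f x))"
          by (intro semilinearD(2)[OF S] JS f space_add) simp
        moreover have "eq_ae G (S (\<lambda>x. J (v - u n) f x + J (u n) f x)) (\<lambda>x. S (J (v - u n) f) x + S (J (u n) f) x)"
          by (intro semilinearD(3)[OF S] JS f)
        moreover have "eq_ae G (J ((v - u n) + u n) (S f)) (\<lambda>x. J (v - u n) (S f) x + J (u n) (S f) x)"
          by (intro cliffordD(4)[OF J] SS f)
        moreover have "eq_ae G (S (J (u n) f)) (J (u n) (S f))"
          using u f unfolding W_def by auto
        ultimately have "AE x in \<mu>. d x = S (J (v - u n) f) x - J (v - u n) (S f) x"
          unfolding eq_ae_def by eventually_elim (simp add: d_def)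
        then have "gw_norm G d = gw_norm G (\<lambda>x. S (J (v - u n) f) x - J (v - u n) (S f) x)"
          by (intro gw_norm_cong_AE d space_diff SS JS f) (auto elim: eventually_mono)
        then have "(gw_norm G d)\<^sup>2 \<le> 2 * (gw_norm G (S (J (v - u n) f)))\<^sup>2 + 2 * (gw_norm G (J (v - u n) (S f)))\<^sup>2"
          using gw_norm_diff_square[OF SS[OF JS[OF f]] JS[OF SS[OF f]]] by simp
        also have "\<dots> \<le> 2 * (C * norm (v - u n) * gw_norm G f)\<^sup>2 + 2 * (C * norm (v - u n) * gw_norm G f)\<^sup>2"
        proof -
          have "gw_norm G (S (J (v - u n) f)) \<le> C * norm (v - u n) * gw_norm G f"
            using C[OF f] S_norm[OF JS[OF f]] by simp
          moreover have "gw_norm G (J (v - u n) (S f)) \<le> C * norm (v - u n) * gw_norm G f"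
            using C[OF SS[OF f]] S_norm[OF f] by simp
          ultimately show ?thesis
            by (intro add_mono mult_left_mono power_mono gw_norm_nonneg) auto
        qed
        finally show ?thesis by simp
      qed
      have "(\<lambda>n. 4 * (C * norm (v - u n) * gw_norm G f)\<^sup>2) \<longlonglongrightarrow> 4 * (C * norm (v - v) * gw_norm G f)\<^sup>2"
        by (intro tendsto_intros lim)
      then have "(gw_norm G d)\<^sup>2 \<le> 4 * (C * norm (v - v) * gw_norm G f)\<^sup>2"
        by (rule LIMSEQ_le_const) (use bound in auto)
      then have "gw_norm G d = 0" by simp
      from gw_norm_zero_AE[OF d this] show "eq_ae G (S (J v f)) (J v (S f))"
        unfolding eq_ae_def by eventually_elim (simp add: d_def)
    qed
  qed
  have sub: "subspace W"
  proof (rule subspaceI)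
    have "z 0 \<in> W" using gen by (simp add: W_def)
    then show "0 \<in> W" using scale[of "z 0" 0] by simp
  qed (use add scale in auto)
  have "range z \<union> range (\<lambda>k. \<sigma> (z k)) \<subseteq> W" using gen by (auto simp: W_def)
  then have "closure (span (range z \<union> range (\<lambda>k. \<sigma> (z k)))) \<subseteq> W"
    by (intro closure_minimal span_minimal sub closed)
  then have "v \<in> W" using basis unfolding unitary_basis_def by auto
  then show ?thesis using f by (simp add: W_def)
qed

section \<open>Conjugation\<close>

lemma conj_vec_add: "conj_vec (u + v) = conj_vec u + conj_vec v"
  by (simp add: conj_vec_def plus_complexification_def)

lemma conj_vec_scaleC: "conj_vec (a *\<^sub>C v) = cnj a *\<^sub>C conj_vec v"
  for v :: "'k::{real_inner, complete_space} complexification"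
  by (simp add: conj_vec_def scaleC_complexification_def)

lemma conj_vec_scaleR: "conj_vec (r *\<^sub>R v) = r *\<^sub>R conj_vec v"
  by (simp add: conj_vec_def scaleR_complexification_def)

lemma conj_vec_conj_vec [simp]: "conj_vec (conj_vec v) = v"
  by (simp add: conj_vec_def)

lemma norm_conj_vec [simp]: "norm (conj_vec v) = norm v"
  by (simp add: conj_vec_def norm_complexification_def inner_complexification_def)

lemma conj_vec_zero [simp]: "conj_vec 0 = 0"
  by (simp add: conj_vec_def zero_complexification_def)

lemma bounded_linear_conj_vec: "bounded_linear conj_vec"
  by (rule bounded_linear_intro[of _ 1]) (auto simp: conj_vec_add conj_vec_scaleR)

lemma conj_vec_measurable [measurable]:
  assumes "f \<in> borel_measurable M"
  shows "(\<lambda>x. conj_vec (f x)) \<in> borel_measurable M"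
  by (rule borel_measurable_continuous_on[OF _ assms])
    (intro bounded_linear.continuous_on[OF bounded_linear_conj_vec] continuous_on_id)

lemma cinner_conj_vec: "cinner (conj_vec u) (conj_vec v) = cnj (cinner u v)"
  for v :: "'k::{real_inner, complete_space} complexification"
  by (simp add: conj_vec_def cinner_complexification_def complex_eq_iff)

lemma conj_vec_complexified: "subspace K \<Longrightarrow> v \<in> complexified K \<Longrightarrow> conj_vec v \<in> complexified K"
  by (auto simp: complexified_def conj_vec_def intro: subspace_neg)

section \<open>The standard real structure\<close>

text \<open>
  The antilinear operator whose fixed points form the standard real form.  The value \<open>0\<close> where the
  fibres at \<open>x\<close> and \<open>1 - x\<close> may differ keeps the field in its fibres; under the symmetry hypotheses
  this happens only on a null set.
\<close>

definition std_structure ::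
    "'k::{real_inner, complete_space, second_countable_topology} complexification gw \<Rightarrow>
     (X \<Rightarrow> 'k complexification) \<Rightarrow> (X \<Rightarrow> 'k complexification)" where
  "std_structure G f = (\<lambda>x. if gw_mult G (1 - x) = gw_mult G x
     then sqrt (density_of (reflect (gw_measure G)) (gw_measure G) x) *\<^sub>R conj_vec (f (1 - x)) else 0)"

lemma sign_reflect:
  "(- 1) ^ ((\<Sum>j<k. of_bool ((1 - x) j = 1)) + 1) = (- 1) ^ k * (- 1 :: complex) ^ ((\<Sum>j<k. of_bool (x j = 1)) + 1)"
  for x :: X
  by (induction k) (auto simp: reflect_apply_eq_1 simp del: one_fun_apply minus_apply)

lemma unitary_onD:
  assumes "unitary_on V A" "v \<in> V"
  shows "A v \<in> V" "A (a *\<^sub>C v) = a *\<^sub>C A v" "norm (A v) = norm v" "w \<in> V \<Longrightarrow> A (v + w) = A v + A w"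
  using assms unfolding unitary_on_def by auto

text \<open>The symmetry hypotheses on fibres, measure and multiplicity, without the condition on the operators
  \<open>c k\<close>; they make \<open>S0\<close> an isometric antilinear involution.\<close>

locale reflection_symmetric = garding_wightman G
  for G :: "'k::{real_inner, complete_space, second_countable_topology} complexification gw" +
  fixes K :: "X \<Rightarrow> 'k set"
  assumes fibers: "complexified_fibers G K"
    and reflect_equiv: "equivalent_measures (reflect (gw_measure G)) (gw_measure G)"
    and AE_nu_reflect: "AE x in gw_measure G. gw_mult G (1 - x) = gw_mult G x"
begin

abbreviation S0 where "S0 \<equiv> std_structure G"

sublocale r: quasi_invariant \<mu> "\<lambda>x. 1 - x"
  using reflect_equiv by unfold_locales
    (auto simp: sets_mu sigma_finite reflect_def equivalent_measures_def simp del: add_bit_eq_xor)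

lemma D_reflect: "density_of (reflect \<mu>) \<mu> = r.D"
  by (simp add: reflect_def)

lemma conj_vec_fiber: "v \<in> V x \<Longrightarrow> conj_vec v \<in> V x"
proof -
  have "subspace (K x)" "V x = complexified (K x)"
    using fibers unfolding complexified_fibers_def by blast+
  then show "v \<in> V x \<Longrightarrow> conj_vec v \<in> V x" by (simp only: conj_vec_complexified)
qed

lemma S0_AE: "AE x in \<mu>. S0 f x = sqrt (r.D x) *\<^sub>R conj_vec (f (1 - x))"
  using AE_nu_reflect by eventually_elim (simp add: std_structure_def D_reflect)

lemma S0_measurable:
  assumes [measurable]: "f \<in> borel_measurable \<mu>"
  shows "S0 f \<in> borel_measurable \<mu>"
proof -
  have [measurable]: "(\<lambda>x. conj_vec (f (1 - x))) \<in> borel_measurable \<mu>"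
    by (intro conj_vec_measurable r.theta_compose assms)
  have [measurable]: "Measurable.pred \<mu> (\<lambda>x. \<nu> (1 - x) = \<nu> x)"
    by (rule nu_equal_measurable[OF r.theta_measurable_mu])
  show ?thesis
    unfolding std_structure_def D_reflect by measurable
qed

lemma S0_fiber: "(\<And>x. f x \<in> V x) \<Longrightarrow> S0 f x \<in> V x"
proof -
  assume f: "\<And>x. f x \<in> V x"
  show "S0 f x \<in> V x"
  proof (cases "\<nu> (1 - x) = \<nu> x")
    case True
    then have "conj_vec (f (1 - x)) \<in> V x"
      using conj_vec_fiber[OF f[of "1 - x"]] fiber_eq[OF True] by (simp only:)
    then show ?thesis using True by (simp add: std_structure_def fiber_scaleR)
  qed (simp add: std_structure_def)
qed

lemma S0_nn_norm:
  assumes f: "f \<in> gw_space G"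
  shows "(\<integral>\<^sup>+x. ennreal ((norm (S0 f x))\<^sup>2) \<partial>\<mu>) = (\<integral>\<^sup>+x. ennreal ((norm (f x))\<^sup>2) \<partial>\<mu>)"
proof -
  note [measurable] = spaceD(1)[OF f]
  have "(\<integral>\<^sup>+x. ennreal ((norm (S0 f x))\<^sup>2) \<partial>\<mu>) = (\<integral>\<^sup>+x. ennreal (r.D x) * ennreal ((norm (f (1 - x)))\<^sup>2) \<partial>\<mu>)"
    using S0_AE[of f] by (intro nn_integral_cong_AE)
      (auto elim!: eventually_mono simp: power_mult_distrib ennreal_mult')
  also have "\<dots> = (\<integral>\<^sup>+x. ennreal ((norm (f x))\<^sup>2) \<partial>\<mu>)"
    by (rule r.nn_integral_theta') measurable
  finally show ?thesis .
qed

lemma S0_space: "f \<in> gw_space G \<Longrightarrow> S0 f \<in> gw_space G"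
  using spaceD(5)[of f] by (intro spaceI) (simp_all add: S0_nn_norm S0_measurable S0_fiber spaceD)

lemma S0_norm: "f \<in> gw_space G \<Longrightarrow> gw_norm G (S0 f) = gw_norm G f"
proof -
  assume f: "f \<in> gw_space G"
  have "ennreal ((gw_norm G (S0 f))\<^sup>2) = ennreal ((gw_norm G f)\<^sup>2)"
    using spaceD(6)[OF f] spaceD(6)[OF S0_space[OF f]] S0_nn_norm[OF f] by simp
  then have "(gw_norm G (S0 f))\<^sup>2 = (gw_norm G f)\<^sup>2" by simp
  then show ?thesis using gw_norm_nonneg power2_eq_imp_eq by blast
qed

lemma S0_cong: "eq_ae G f g \<Longrightarrow> eq_ae G (S0 f) (S0 g)"
  unfolding eq_ae_def std_structure_def
  by (drule r.AE_theta) (auto elim!: eventually_mono)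

lemma S0_semilinear: "semilinear_map cnj G G S0"
  unfolding semilinear_map_def
  by (auto simp: S0_space S0_cong)
    (auto simp: eq_ae_def std_structure_def conj_vec_add conj_vec_scaleC scaleR_add_right scaleC_scaleR)

lemma S0_S0: "eq_ae G (S0 (S0 f)) f"
proof -
  have "AE x in \<mu>. S0 (S0 f) x = sqrt (r.D x) *\<^sub>R conj_vec (S0 f (1 - x))" by (rule S0_AE)
  moreover have "AE x in \<mu>. S0 f (1 - x) = sqrt (r.D (1 - x)) *\<^sub>R conj_vec (f (1 - (1 - x)))"
    using r.AE_theta[OF S0_AE[of f]] .
  ultimately show ?thesis
    unfolding eq_ae_def using r.D_theta
  proof eventually_elim
    case (elim x)
    have "sqrt (r.D x) * sqrt (r.D (1 - x)) = 1"
      using elim(3) by (simp add: mult.commute flip: real_sqrt_mult)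
    then show ?case unfolding elim(1,2) reflect_reflect by (simp add: conj_vec_scaleR)
  qed
qed

lemma standard_real_form_eq: "standard_real_form G = {f \<in> gw_space G. eq_ae G (S0 f) f}"
proof -
  have "(AE x in \<mu>. conj_vec (f x) = sqrt (r.D x) *\<^sub>R f (1 - x)) \<longleftrightarrow> (AE x in \<mu>. S0 f x = f x)" for f
  proof -
    have "AE x in \<mu>. (conj_vec (f x) = sqrt (r.D x) *\<^sub>R f (1 - x)) \<longleftrightarrow> S0 f x = f x"
      using S0_AE[of f] by eventually_elim (metis conj_vec_conj_vec conj_vec_scaleR)
    then show ?thesis by (rule eventually_subst)
  qed
  then show ?thesis by (auto simp: standard_real_form_def eq_ae_def D_reflect)
qed

text \<open>The two orders of applying \<open>S0\<close> and a generator.  The sign \<open>(- 1) ^ (k + 1)\<close> collects \<open>k\<close> factors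
  from the reflection of the coordinates below \<open>k\<close> and one from the conjugation of \<open>\<i>\<close>; the densities
  agree by the chain rule.\<close>

lemma
  assumes M: "gw_module \<sigma> z G J" and f: "f \<in> gw_space G"
  defines "a \<equiv> \<lambda>k x. ((- 1) ^ ((\<Sum>j<k. of_bool (x j = 1)) + 1) * \<i>) *
      complex_of_real (sqrt (density_of (translate \<mu> (delta k)) \<mu> x * r.D (x + delta k)))"
  shows S0_generator: "AE x in \<mu>. S0 (J (z k) f) x =
      (a k x * (- 1) ^ (k + 1)) *\<^sub>C conj_vec (c k (1 - x) (f (1 - x + delta k)))"
    and generator_S0: "AE x in \<mu>. J (z k) (S0 f) x = a k x *\<^sub>C c k x (conj_vec (f (1 - x + delta k)))"
    and AE_generator_fiber: "AE x in \<mu>. conj_vec (f (1 - x + delta k)) \<in> V x"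
proof -
  interpret t: quasi_invariant \<mu> "\<lambda>x. x + delta k" by (simp add: quasi_invariant_translate)
  have tD: "density_of (translate \<mu> (delta k)) \<mu> = t.D" by (simp add: translate_def)
  let ?s = "\<lambda>x::X. (- 1 :: complex) ^ ((\<Sum>j<k. of_bool (x j = 1)) + 1)"
  have J: "AE x in \<mu>. J (z k) g x = (?s x * \<i> * complex_of_real (sqrt (t.D x))) *\<^sub>C c k x (g (x + delta k))"
    if "g \<in> gw_space G" for g
    using M that unfolding gw_module_def eq_ae_def tD[symmetric] by blast
  have chain: "AE x in \<mu>. r.D (x + delta k) * t.D x = t.D (1 - x) * r.D x"
    by (rule density_chain[OF r.quasi_invariant_axioms t.quasi_invariant_axioms]) (simp only: reflect_translate)
  show "AE x in \<mu>. S0 (J (z k) f) x =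
      (a k x * (- 1) ^ (k + 1)) *\<^sub>C conj_vec (c k (1 - x) (f (1 - x + delta k)))"
    using S0_AE[of "J (z k) f"] r.AE_theta[OF J[OF f]] chain
  proof eventually_elim
    case (elim x)
    have "sqrt (r.D x) * sqrt (t.D (1 - x)) = sqrt (t.D x * r.D (x + delta k))"
      using elim(3) by (simp add: mult.commute flip: real_sqrt_mult)
    then have *: "complex_of_real (sqrt (r.D x)) * complex_of_real (sqrt (t.D (1 - x)))
        = complex_of_real (sqrt (t.D x * r.D (x + delta k)))"
      by (metis of_real_mult)
    have "S0 (J (z k) f) x = (complex_of_real (sqrt (r.D x)) *
        cnj (?s (1 - x) * \<i> * complex_of_real (sqrt (t.D (1 - x))))) *\<^sub>C conj_vec (c k (1 - x) (f (1 - x + delta k)))"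
      unfolding elim(1,2) by (simp only: conj_vec_scaleC scaleR_eq_scaleC scaleC_scaleC)
    also have "complex_of_real (sqrt (r.D x)) * cnj (?s (1 - x) * \<i> * complex_of_real (sqrt (t.D (1 - x))))
      = (complex_of_real (sqrt (r.D x)) * complex_of_real (sqrt (t.D (1 - x)))) * (?s (1 - x) * (- \<i>))"
      by simp
    also have "\<dots> = a k x * (- 1) ^ (k + 1)"
      unfolding * sign_reflect by (simp add: a_def tD)
    finally show ?case .
  qed
  show fib: "AE x in \<mu>. conj_vec (f (1 - x + delta k)) \<in> V x"
    using AE_nu_reflect r.AE_theta[OF AE_nu]
  proof eventually_elim
    case (elim x)
    then have "V (1 - x + delta k) = V x" by (intro fiber_eq) simp
    then show ?case using conj_vec_fiber[OF spaceD(2)[OF f]] by metis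
  qed
  show "AE x in \<mu>. J (z k) (S0 f) x = a k x *\<^sub>C c k x (conj_vec (f (1 - x + delta k)))"
    using J[OF S0_space[OF f]] t.AE_theta[OF S0_AE[of f]] fib AE_unitary
  proof eventually_elim
    case (elim x)
    have "c k x (sqrt (r.D (x + delta k)) *\<^sub>R conj_vec (f (1 - x + delta k)))
       = complex_of_real (sqrt (r.D (x + delta k))) *\<^sub>C c k x (conj_vec (f (1 - x + delta k)))"
      using unitary_onD(2)[of "V x" "c k x"] elim(3,4) by (simp add: scaleR_eq_scaleC)
    then show ?case
      unfolding elim(1) elim(2) reflect_translate
      by (simp add: scaleC_scaleC a_def tD real_sqrt_mult mult_ac)
  qed
qed

lemma standard_real_form_invariant:
  assumes M: "gw_module \<sigma> z G J" and basis: "unitary_basis \<sigma> z" and compat: "reflection_compatible G"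
  shows "invariant_real_form G J (standard_real_form G)"
proof -
  have J: "clifford_module G J" using M by (simp add: gw_module_def)
  have gen: "eq_ae G (S0 (J (z k) f)) (J (z k) (S0 f))" if f: "f \<in> gw_space G" for k f
    unfolding eq_ae_def
    using S0_generator[OF M f, of k] generator_S0[OF M f, of k] AE_generator_fiber[OF M f, of k]
      compat[unfolded reflection_compatible_def, THEN conjunct2, THEN conjunct2]
  proof eventually_elim
    case (elim x)
    define w where "w = f (1 - x + delta k)"
    have "conj_vec (c k (1 - x) w) = conj_op (c k (1 - x)) (conj_vec w)"
      by (simp add: conj_op_def)
    also have "\<dots> = (- 1) ^ (k + 1) *\<^sub>C c k x (conj_vec w)"
      using elim(3,4) by (simp add: w_def)
    finally have *: "conj_vec (c k (1 - x) w) = (- 1) ^ (k + 1) *\<^sub>C c k x (conj_vec w)" .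
    have "(- 1 :: complex) ^ (k + 1) * (- 1) ^ (k + 1) = 1"
      by (simp flip: power_mult_distrib)
    then show ?case
      unfolding elim(1,2) unfolding *[unfolded w_def]
      by (simp only: scaleC_scaleC mult.assoc mult_1_right)
  qed
  have gen': "eq_ae G (S0 (J (\<sigma> (z k)) f)) (J (\<sigma> (z k)) (S0 f))" if f: "f \<in> gw_space G" for k f
  proof -
    have sig: "AE x in \<mu>. J (\<sigma> (z k)) g x = ((- 1) ^ of_bool (x k = 1) * \<i>) *\<^sub>C J (z k) g x"
      if "g \<in> gw_space G" for g
      using M that unfolding gw_module_def eq_ae_def by blast
    show ?thesis
      unfolding eq_ae_def
      using S0_AE[of "J (\<sigma> (z k)) f"] S0_AE[of "J (z k) f"] r.AE_theta[OF sig[OF f]]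
        sig[OF S0_space[OF f]] gen[OF f, of k, unfolded eq_ae_def]
    proof eventually_elim
      case (elim x)
      have "S0 (J (\<sigma> (z k)) f) x = cnj ((- 1) ^ of_bool ((1 - x) k = 1) * \<i>) *\<^sub>C S0 (J (z k) f) x"
        unfolding elim(1,2,3) by (simp only: conj_vec_scaleC scaleC_scaleR)
      also have "cnj ((- 1) ^ of_bool ((1 - x) k = 1) * \<i>) = (- 1) ^ of_bool (x k = 1) * \<i>"
        by (cases "x k") simp_all
      finally show ?case unfolding elim(4,5) .
    qed
  qed
  have "invariant_real_structure G J S0"
    unfolding invariant_real_structure_def
    using S0_semilinear S0_S0 S0_norm commutes_with_clifford[OF J basis S0_semilinear S0_norm gen gen'] by blast
  then show ?thesis
    unfolding invariant_real_form_def standard_real_form_eq by blast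
qed

end

section \<open>Disintegration of an invariant real structure\<close>

text \<open>If two families have conjugate Gram matrices up to the factor \<open>d\<close>, then approximations
  transfer from one to the other.\<close>

lemma gram_closure:
  fixes p :: "nat \<Rightarrow> 'a::complex_hilbert" and q :: "nat \<Rightarrow> 'b::complex_hilbert"
  assumes pp: "\<And>i j. cinner (p i) (p j) = complex_of_real d * cnj (cinner (q i) (q j))"
    and up: "\<And>j. cinner u (p j) = complex_of_real d * cnj (cinner v (q j))"
    and uu: "cinner u u = complex_of_real d * cnj (cinner v v)"
    and d: "d \<ge> 0" and v: "v \<in> closure (cspan (range q))"
  shows "u \<in> closure (cspan (range p))"
  unfolding closure_approachable
proof (intro allI impI)
  fix r :: real assume "r > 0"
  then have "r / (sqrt d + 1) > 0" using d by (simp add: add_nonneg_pos)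
  then obtain t where t: "t \<in> cspan (range q)" "dist t v < r / (sqrt d + 1)"
    using v unfolding closure_approachable by blast
  have "\<exists>N a. t = (\<Sum>i<N. a i *\<^sub>C q i)"
    using t(1)
  proof (induction t rule: complex_vs.span_induct_alt)
    case base
    then show ?case by (intro exI[of _ 0]) simp
  next
    case (step c x y)
    then obtain N a k where y: "y = (\<Sum>i<N. a i *\<^sub>C q i)" "x = q k" by auto
    let ?M = "max N (Suc k)"
    let ?a = "\<lambda>i. (if i < N then a i else 0) + (if i = k then c else 0)"
    have "(\<Sum>i<?M. ?a i *\<^sub>C q i) = (\<Sum>i<?M. (if i < N then a i else 0) *\<^sub>C q i) + (\<Sum>i<?M. (if i = k then c else 0) *\<^sub>C q i)"
      by (simp only: scaleC_add_left sum.distrib)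
    also have "(\<Sum>i<?M. (if i < N then a i else 0) *\<^sub>C q i) = y"
      unfolding y by (rule sum.mono_neutral_cong_right) auto
    also have "(\<Sum>i<?M. (if i = k then c else 0) *\<^sub>C q i) = (\<Sum>i\<in>{k}. c *\<^sub>C q i)"
      by (rule sum.mono_neutral_cong_right) auto
    finally have "c *\<^sub>C x + y = (\<Sum>i<?M. ?a i *\<^sub>C q i)" using y(2) by (simp add: add.commute)
    then show ?case by (intro exI[of _ ?M] exI[of _ ?a])
  qed
  then obtain N a where a: "t = (\<Sum>i<N. a i *\<^sub>C q i)" by blast
  \<comment> \<open>The norm of \<open>t - v\<close> and the distance from \<open>u\<close> to the conjugate combination of the \<open>p i\<close> are
      compared by putting \<open>v\<close> and \<open>u\<close> in front of the two families.\<close>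
  define p' where "p' i = (case i of 0 \<Rightarrow> u | Suc j \<Rightarrow> p j)" for i
  define q' where "q' i = (case i of 0 \<Rightarrow> v | Suc j \<Rightarrow> q j)" for i
  define a' where "a' i = (case i of 0 \<Rightarrow> - 1 | Suc j \<Rightarrow> a j)" for i
  have pu: "cinner (p j) u = complex_of_real d * cnj (cinner (q j) v)" for j
    using up[of j] cinner_commute[of "p j" u] cinner_commute[of "q j" v] by simp
  have "cinner (p' i) (p' j) = complex_of_real d * cnj (cinner (q' i) (q' j))" for i j
    unfolding p'_def q'_def by (cases i; cases j) (simp_all only: nat.case pp up uu pu)
  then have "norm (\<Sum>i<Suc N. cnj (a' i) *\<^sub>C p' i) = sqrt d * norm (\<Sum>i<Suc N. a' i *\<^sub>C q' i)"
    using d by (intro gram_norm_cnj)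
  moreover have "(\<Sum>i<Suc N. a' i *\<^sub>C q' i) = t - v"
    unfolding sum.lessThan_Suc_shift by (simp add: a'_def q'_def a)
  moreover have "(\<Sum>i<Suc N. cnj (a' i) *\<^sub>C p' i) = (\<Sum>i<N. cnj (a i) *\<^sub>C p i) - u"
    unfolding sum.lessThan_Suc_shift by (simp add: a'_def p'_def)
  ultimately have "dist (\<Sum>i<N. cnj (a i) *\<^sub>C p i) u = sqrt d * dist t v"
    by (simp add: dist_norm)
  also have "\<dots> \<le> (sqrt d + 1) * dist t v"
    by (simp add: mult_right_mono)
  also have "\<dots> < r"
    using t(2) d by (simp add: pos_less_divide_eq add_nonneg_pos mult.commute)
  finally have "dist (\<Sum>i<N. cnj (a i) *\<^sub>C p i) u < r" .
  moreover have "(\<Sum>i<N. cnj (a i) *\<^sub>C p i) \<in> cspan (range p)"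
    by (intro complex_vs.span_sum complex_vs.span_scale complex_vs.span_base) simp
  ultimately show "\<exists>y\<in>cspan (range p). dist y u < r" by blast
qed

text \<open>A Garding-Wightman module together with an arbitrary invariant real structure \<open>S\<close>.\<close>

locale gw_real_structure = garding_wightman G
  for G :: "'h::{complex_hilbert, second_countable_topology} gw" +
  fixes \<sigma> :: "'z::real_inner \<Rightarrow> 'z" and z :: "nat \<Rightarrow> 'z"
    and J :: "'z \<Rightarrow> (X \<Rightarrow> 'h) \<Rightarrow> (X \<Rightarrow> 'h)" and S :: "(X \<Rightarrow> 'h) \<Rightarrow> (X \<Rightarrow> 'h)"
  assumes module: "gw_module \<sigma> z G J" and basis: "unitary_basis \<sigma> z"
    and real_structure: "invariant_real_structure G J S"
begin

lemma clifford: "clifford_module G J"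
  using module by (simp add: gw_module_def)

lemma S_semilinear: "semilinear_map cnj G G S"
  and S_S: "f \<in> gw_space G \<Longrightarrow> eq_ae G (S (S f)) f"
  and S_norm: "f \<in> gw_space G \<Longrightarrow> gw_norm G (S f) = gw_norm G f"
  and S_J: "f \<in> gw_space G \<Longrightarrow> eq_ae G (S (J v f)) (J v (S f))"
  using real_structure unfolding invariant_real_structure_def by blast+

lemmas S_space = semilinearD(1)[OF S_semilinear] and S_cong = semilinearD(2)[OF S_semilinear]
  and S_add = semilinearD(3)[OF S_semilinear] and S_scale = semilinearD(4)[OF S_semilinear]
lemmas J_space = cliffordD(2)[OF clifford] and J_cong = cliffordD(3)[OF clifford]

lemma S_diff: "f \<in> gw_space G \<Longrightarrow> g \<in> gw_space G \<Longrightarrow> eq_ae G (S (\<lambda>x. f x - g x)) (\<lambda>x. S f x - S g x)"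
  by (rule semilinear_diff[OF S_semilinear triple]) simp

lemma space_mu: "space \<mu> = UNIV"
  using sets_eq_imp_space_eq[OF sets_mu] by simp

lemma coordinate_measurable [measurable]: "Measurable.pred \<mu> (\<lambda>x. x k = 1)"
  using coordinate_set_in_X_algebra[of k] by (simp add: pred_def sets_mu space_mu)

text \<open>The operators \<open>J (\<sigma> (z k)) (J (z k) _)\<close> are multiplications by \<open>\<plusminus> \<i>\<close>, the sign being
  determined by the coordinate \<open>x k\<close>; since \<open>S\<close> is antilinear, it interchanges the two signs.\<close>

lemma S_sign:
  assumes f: "f \<in> gw_space G"
  shows "AE x in \<mu>. S (\<lambda>x. (- 1) ^ of_bool (x k = 1) *\<^sub>C f x) x = - ((- 1) ^ of_bool (x k = 1) *\<^sub>C S f x)"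
proof -
  let ?m = "\<lambda>x::X. (- 1 :: complex) ^ of_bool (x k = 1)"
  have pos: "inner (z k) (z k) = 1" using basis by (simp add: unitary_basis_def)
  have JJ: "AE x in \<mu>. J (z k) (J (z k) g) x = - g x" if g: "g \<in> gw_space G" for g
    using cliffordD(6)[OF clifford g, of "z k" "z k"] unfolding eq_ae_def
  proof eventually_elim
    case (elim x)
    then have "2 *\<^sub>R J (z k) (J (z k) g) x = 2 *\<^sub>R (- g x)"
      by (simp add: pos scaleR_2 scaleR_minus_left)
    then show ?case unfolding scaleR_cancel_left by simp
  qed
  have sig: "AE x in \<mu>. J (\<sigma> (z k)) g x = (?m x * \<i>) *\<^sub>C J (z k) g x" if "g \<in> gw_space G" for g
    using module that unfolding gw_module_def eq_ae_def by blast
  have JsJ: "AE x in \<mu>. J (\<sigma> (z k)) (J (z k) g) x = (- \<i>) *\<^sub>C (?m x *\<^sub>C g x)" if g: "g \<in> gw_space G" for g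
    using sig[OF J_space[OF g, of "z k"]] JJ[OF g]
    by eventually_elim (simp add: scaleC_scaleC mult.commute)
  have m: "(\<lambda>x. ?m x *\<^sub>C f x) \<in> gw_space G"
  proof (rule space_dominated[OF f])
    note [measurable] = spaceD(1)[OF f]
    show "(\<lambda>x. ?m x *\<^sub>C f x) \<in> borel_measurable \<mu>"
      by (intro measurable_scaleC) measurable
    show "?m x *\<^sub>C f x \<in> V x" for x by (rule fiber_scale[OF spaceD(2)[OF f]])
  qed (simp add: norm_power)
  have "eq_ae G (S (J (\<sigma> (z k)) (J (z k) f))) (S (\<lambda>x. (- \<i>) *\<^sub>C (?m x *\<^sub>C f x)))"
    by (intro S_cong J_space f space_scale m) (use JsJ[OF f] in \<open>simp add: eq_ae_def\<close>)
  moreover have "eq_ae G (S (\<lambda>x. (- \<i>) *\<^sub>C (?m x *\<^sub>C f x))) (\<lambda>x. cnj (- \<i>) *\<^sub>C S (\<lambda>x. ?m x *\<^sub>C f x) x)"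
    by (rule S_scale[OF m])
  moreover have "eq_ae G (S (J (\<sigma> (z k)) (J (z k) f))) (J (\<sigma> (z k)) (S (J (z k) f)))"
    by (intro S_J J_space f)
  moreover have "eq_ae G (J (\<sigma> (z k)) (S (J (z k) f))) (J (\<sigma> (z k)) (J (z k) (S f)))"
    by (intro J_cong S_space J_space f S_J)
  ultimately have "AE x in \<mu>. \<i> *\<^sub>C S (\<lambda>x. ?m x *\<^sub>C f x) x = \<i> *\<^sub>C (- (?m x *\<^sub>C S f x))"
    unfolding eq_ae_def using JsJ[OF S_space[OF f]]
    by eventually_elim simp
  then show ?thesis
    by eventually_elim (simp only: complex_vs.scale_left_imp_eq[OF complex_i_not_zero])
qed

lemma S_coordinate:
  assumes f: "f \<in> gw_space G"
  shows "AE x in \<mu>. S (\<lambda>x. if x k = 1 then f x else 0) x = (if (1 - x) k = 1 then S f x else 0)"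
proof -
  let ?m = "\<lambda>x::X. (- 1 :: complex) ^ of_bool (x k = 1)"
  define g where "g = (\<lambda>x. if x k = 1 then f x else 0)"
  have g: "g \<in> gw_space G"
    unfolding g_def by (rule space_restrict[OF f]) measurable
  have eq: "(\<lambda>x. ?m x *\<^sub>C f x) = (\<lambda>x. f x - (2 :: complex) *\<^sub>C g x)"
    by (rule ext) (simp add: g_def scaleC_add_left[of 1 1, simplified])
  have "eq_ae G (S (\<lambda>x. f x - 2 *\<^sub>C g x)) (\<lambda>x. S f x - S (\<lambda>x. 2 *\<^sub>C g x) x)"
    by (intro S_diff f space_scale g)
  moreover have "eq_ae G (S (\<lambda>x. 2 *\<^sub>C g x)) (\<lambda>x. cnj 2 *\<^sub>C S g x)"
    by (rule S_scale[OF g])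
  ultimately have "AE x in \<mu>. S f x - 2 *\<^sub>C S g x = - (?m x *\<^sub>C S f x)"
    using S_sign[OF f, of k] unfolding eq_ae_def eq by eventually_elim simp
  then have "AE x in \<mu>. S g x = (if (1 - x) k = 1 then S f x else 0)"
  proof eventually_elim
    case (elim x)
    have two: "(2 :: complex) *\<^sub>C v = v + v" for v :: 'h
      using scaleC_add_left[of 1 1 v] by simp
    show ?case
    proof (cases "x k = 1")
      case True
      then have "2 *\<^sub>C S g x = 2 *\<^sub>C 0" using elim by simp
      then show ?thesis using True complex_vs.scale_left_imp_eq[of 2 "S g x" 0] by simp
    next
      case False
      then have "2 *\<^sub>C S g x = 2 *\<^sub>C S f x" using elim by (simp add: two algebra_simps)
      then show ?thesis using False complex_vs.scale_left_imp_eq[of 2 "S g x" "S f x"] by simp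
    qed
  qed
  then show ?thesis by (simp only: g_def)
qed

lemma reflect_measurable_mu [measurable]: "(\<lambda>x. 1 - x) \<in> measurable \<mu> \<mu>"
  using reflect_measurable sets_mu measurable_cong_sets by blast

text \<open>Disintegration of the isometry of \<open>S\<close> over subsets of \<open>X\<close>.  The sets \<open>E\<close> for which \<open>S\<close> intertwines multiplication by the indicators of \<open>E\<close> and \<open>1 - E\<close>
  are stable under intersections and contain the generators of the \<open>\<sigma>\<close>-algebra; two finite measures that
  agree on them are equal.\<close>

lemma S_measure:
  assumes f: "f \<in> gw_space G" and E: "E \<in> sets \<mu>"
  shows "(\<integral>\<^sup>+x. ennreal ((norm (S f x))\<^sup>2) * indicator E (1 - x) \<partial>\<mu>) = (\<integral>\<^sup>+x. ennreal ((norm (f x))\<^sup>2) * indicator E x \<partial>\<mu>)"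
proof -
  define \<E> where "\<E> = {E \<in> sets \<mu>. \<forall>f\<in>gw_space G.
      eq_ae G (S (\<lambda>x. if x \<in> E then f x else 0)) (\<lambda>x. if 1 - x \<in> E then S f x else 0)}"
  note Sf = S_space[OF f]
  note [measurable] = spaceD(1)[OF f] spaceD(1)[OF Sf]
  define M where "M = distr (density \<mu> (\<lambda>x. ennreal ((norm (S f x))\<^sup>2))) \<mu> (\<lambda>x. 1 - x)"
  define N where "N = density \<mu> (\<lambda>x. ennreal ((norm (f x))\<^sup>2))"
  have [measurable]: "(\<lambda>x. 1 - x) \<in> measurable (density \<mu> (\<lambda>x. ennreal ((norm (S f x))\<^sup>2))) \<mu>" by simp
  have M: "emeasure M E = (\<integral>\<^sup>+x. ennreal ((norm (S f x))\<^sup>2) * indicator E (1 - x) \<partial>\<mu>)" if [measurable]: "E \<in> sets \<mu>" for E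
  proof -
    have "emeasure M E = emeasure (density \<mu> (\<lambda>x. ennreal ((norm (S f x))\<^sup>2))) ((\<lambda>x. 1 - x) -` E \<inter> space \<mu>)"
      unfolding M_def by (subst emeasure_distr) simp_all
    also have "\<dots> = (\<integral>\<^sup>+x. ennreal ((norm (S f x))\<^sup>2) * indicator ((\<lambda>x. 1 - x) -` E \<inter> space \<mu>) x \<partial>\<mu>)"
      by (rule emeasure_density) simp_all
    also have "\<dots> = (\<integral>\<^sup>+x. ennreal ((norm (S f x))\<^sup>2) * indicator E (1 - x) \<partial>\<mu>)"
      by (intro nn_integral_cong) (simp add: indicator_def)
    finally show ?thesis .
  qed
  have N: "emeasure N E = (\<integral>\<^sup>+x. ennreal ((norm (f x))\<^sup>2) * indicator E x \<partial>\<mu>)" if "E \<in> sets \<mu>" for E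
    unfolding N_def using that by (intro emeasure_density) simp_all
  have "M = N"
  proof (rule measure_eqI_generator_eq[where E = \<E> and \<Omega> = UNIV and A = "\<lambda>_. UNIV"])
    show "Int_stable \<E>"
    proof (rule Int_stableI)
      fix A B assume A: "A \<in> \<E>" and B: "B \<in> \<E>"
      have "eq_ae G (S (\<lambda>x. if x \<in> A \<inter> B then f x else 0)) (\<lambda>x. if 1 - x \<in> A \<inter> B then S f x else 0)"
        if f: "f \<in> gw_space G" for f
      proof -
        have [measurable]: "B \<in> sets \<mu>" using B by (simp add: \<E>_def)
        have "(\<lambda>x. if x \<in> B then f x else 0) \<in> gw_space G"
          by (rule space_restrict[OF f]) (simp add: space_mu pred_def)
        then have "eq_ae G (S (\<lambda>x. if x \<in> A then (if x \<in> B then f x else 0) else 0))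
            (\<lambda>x. if 1 - x \<in> A then S (\<lambda>x. if x \<in> B then f x else 0) x else 0)"
          using A unfolding \<E>_def by fast
        moreover have "eq_ae G (S (\<lambda>x. if x \<in> B then f x else 0)) (\<lambda>x. if 1 - x \<in> B then S f x else 0)"
          using B f unfolding \<E>_def by fast
        ultimately have "eq_ae G (S (\<lambda>x. if x \<in> A then (if x \<in> B then f x else 0) else 0))
            (\<lambda>x. if 1 - x \<in> A \<inter> B then S f x else 0)"
          unfolding eq_ae_def by eventually_elim simp
        moreover have "(\<lambda>x. if x \<in> A then (if x \<in> B then f x else 0) else 0) = (\<lambda>x. if x \<in> A \<inter> B then f x else 0)"
          by (rule ext) simp
        ultimately show ?thesis by simp
      qed
      then show "A \<inter> B \<in> \<E>" using A B by (auto simp: \<E>_def)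
    qed
    have gen: "range (\<lambda>k. {x::X. x k = 1}) \<subseteq> \<E>"
    proof safe
      fix k
      have "{x. x k = 1} \<in> sets \<mu>" using coordinate_set_in_X_algebra[of k] sets_mu by simp
      then show "{x. x k = 1} \<in> \<E>"
        using S_coordinate[of _ k] unfolding \<E>_def eq_ae_def mem_Collect_eq by blast
    qed
    have sub: "\<E> \<subseteq> sets \<mu>" by (auto simp: \<E>_def)
    have "sigma_sets UNIV \<E> = sets \<mu>"
    proof (rule antisym)
      show "sigma_sets UNIV \<E> \<subseteq> sets \<mu>"
        using sets.sigma_sets_subset[OF sub] space_mu by simp
      have "sets \<mu> = sigma_sets UNIV (range (\<lambda>k. {x::X. x k = 1}))"
        unfolding sets_mu X_algebra_def by (rule sets_measure_of) simp
      then show "sets \<mu> \<subseteq> sigma_sets UNIV \<E>" using sigma_sets_mono'[OF gen, of UNIV] by simp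
    qed
    then show "sets M = sigma_sets UNIV \<E>" "sets N = sigma_sets UNIV \<E>" by (simp_all add: M_def N_def)
    fix E assume E: "E \<in> \<E>"
    then have [measurable]: "E \<in> sets \<mu>" by (simp add: \<E>_def)
    define g where "g = (\<lambda>x. if x \<in> E then f x else 0)"
    have g: "g \<in> gw_space G"
      unfolding g_def by (rule space_restrict[OF f]) (simp add: space_mu pred_def)
    have "emeasure M E = (\<integral>\<^sup>+x. ennreal ((norm (S g x))\<^sup>2) \<partial>\<mu>)"
    proof -
      have "eq_ae G (S g) (\<lambda>x. if 1 - x \<in> E then S f x else 0)"
        using E f unfolding \<E>_def g_def by fast
      then have "AE x in \<mu>. ennreal ((norm (S f x))\<^sup>2) * indicator E (1 - x) = ennreal ((norm (S g x))\<^sup>2)"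
        unfolding eq_ae_def by eventually_elim simp
      then show ?thesis unfolding M[OF \<open>E \<in> sets \<mu>\<close>] by (rule nn_integral_cong_AE)
    qed
    also have "\<dots> = (\<integral>\<^sup>+x. ennreal ((norm (g x))\<^sup>2) \<partial>\<mu>)"
      using spaceD(6)[OF g] spaceD(6)[OF S_space[OF g]] S_norm[OF g] by simp
    also have "\<dots> = emeasure N E"
      unfolding N[OF \<open>E \<in> sets \<mu>\<close>] by (intro nn_integral_cong) (simp add: g_def)
    finally show "emeasure M E = emeasure N E" .
  next
    have "eq_ae G (S (\<lambda>x. if x \<in> UNIV then f x else 0)) (\<lambda>x. if 1 - x \<in> UNIV then S f x else 0)" for f
      by (simp add: eq_ae_def)
    then show "range (\<lambda>_. UNIV) \<subseteq> \<E>"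
      using sets.top[of \<mu>] space_mu unfolding \<E>_def by auto
    have "UNIV \<in> sets \<mu>" using sets.top[of \<mu>] space_mu by simp
    have "emeasure M UNIV = (\<integral>\<^sup>+x. ennreal ((norm (S f x))\<^sup>2) \<partial>\<mu>)"
      unfolding M[OF \<open>UNIV \<in> sets \<mu>\<close>] by simp
    then show "emeasure M UNIV \<noteq> \<infinity>" using spaceD(5)[OF Sf] by simp
  qed auto
  then show ?thesis using M[OF E] N[OF E] by simp
qed

text \<open>For a field \<open>f\<close> without zeros, \<open>\<integral> \<parallel>f\<parallel>\<^sup>2\<close> over \<open>1 - E\<close> equals \<open>\<integral> \<parallel>S f\<parallel>\<^sup>2\<close> over \<open>E\<close>, so it vanishes
  if \<open>E\<close> is a null set.\<close>

lemma reflect_null_sets: "null_sets (distr \<mu> X_algebra (\<lambda>x. 1 - x)) = null_sets \<mu>"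
proof -
  have [measurable]: "(\<lambda>x. 1 - x) \<in> measurable \<mu> X_algebra"
    using reflect_measurable sets_mu measurable_cong_sets by blast
  obtain w where w: "w \<in> borel_measurable \<mu>" "\<And>x. w x > 0" "(\<integral>\<^sup>+x. ennreal ((w x)\<^sup>2) \<partial>\<mu>) < \<infinity>"
    using obtain_weight by blast
  obtain e where e: "\<And>x. frame (\<nu> x) (V x) (e x)" "\<And>j. (\<lambda>x. e x j) \<in> borel_measurable \<mu>"
    using obtain_frame by metis
  define f where "f = (\<lambda>x. w x *\<^sub>R e x 0)"
  have norm_e: "norm (e x 0) = 1" for x
  proof -
    have "1 \<le> \<nu> x" using triple unfolding gw_triple_def Let_def by blast
    then have "enat 0 < \<nu> x" by (cases "\<nu> x") (auto simp: one_enat_def)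
    then have "complex_of_real ((norm (e x 0))\<^sup>2) = complex_of_real 1"
      using frameD(1)[OF e(1), of x 0 0] unfolding cinner_self by simp
    then have "(norm (e x 0))\<^sup>2 = 1" using of_real_eq_iff by blast
    then show ?thesis using power2_eq_imp_eq[of "norm (e x 0)" 1] by simp
  qed
  have f: "f \<in> gw_space G"
  proof (rule spaceI)
    show "f \<in> borel_measurable \<mu>" unfolding f_def using w(1) e(2) by measurable
    show "f x \<in> V x" for x unfolding f_def by (intro fiber_scaleR frameD(3)[OF e(1)])
    show "(\<integral>\<^sup>+x. ennreal ((norm (f x))\<^sup>2) \<partial>\<mu>) < \<infinity>" using w(3) by (simp add: f_def norm_e)
  qed
  note Sf = S_space[OF f]
  note [measurable] = spaceD(1)[OF f] spaceD(1)[OF Sf] spaceD(1)[OF S_space[OF Sf]]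
  have imp: "(\<lambda>x. 1 - x) -` E \<inter> space \<mu> \<in> null_sets \<mu>" if E: "E \<in> null_sets \<mu>" for E
  proof -
    have [measurable]: "E \<in> sets \<mu>" using E by auto
    have "AE x in \<mu>. x \<notin> E" by (rule AE_not_in[OF E])
    then have "(\<integral>\<^sup>+x. ennreal ((norm (S f x))\<^sup>2) * indicator E x \<partial>\<mu>) = (\<integral>\<^sup>+x. 0 \<partial>\<mu>)"
      by (intro nn_integral_cong_AE) (auto elim: eventually_mono)
    then have "(\<integral>\<^sup>+x. ennreal ((norm (S (S f) x))\<^sup>2) * indicator E (1 - x) \<partial>\<mu>) = 0"
      using S_measure[OF Sf, of E] by simp
    then have "AE x in \<mu>. ennreal ((norm (S (S f) x))\<^sup>2) * indicator E (1 - x) = 0"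
      by (subst (asm) nn_integral_0_iff_AE) measurable
    then have "AE x in \<mu>. x \<notin> (\<lambda>x. 1 - x) -` E \<inter> space \<mu>"
      using S_S[OF f] unfolding eq_ae_def
    proof eventually_elim
      case (elim x)
      have "f x \<noteq> 0" using norm_e[of x] w(2)[of x] by (auto simp: f_def)
      then show ?case using elim by (auto simp: indicator_def split: if_splits)
    qed
    then show ?thesis by (subst AE_iff_null_sets) auto
  qed
  show ?thesis
  proof (rule set_eqI)
    fix E
    have iff: "E \<in> null_sets (distr \<mu> X_algebra (\<lambda>x. 1 - x)) \<longleftrightarrow>
        E \<in> sets \<mu> \<and> (\<lambda>x. 1 - x) -` E \<inter> space \<mu> \<in> null_sets \<mu>"
      by (subst null_sets_distr_iff) (auto simp: sets_mu)
    have "E = (\<lambda>x. 1 - x) -` ((\<lambda>x. 1 - x) -` E \<inter> space \<mu>) \<inter> space \<mu>"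
      by (auto simp: space_mu)
    then show "E \<in> null_sets (distr \<mu> X_algebra (\<lambda>x. 1 - x)) \<longleftrightarrow> E \<in> null_sets \<mu>"
      using imp[of E] imp[of "(\<lambda>x. 1 - x) -` E \<inter> space \<mu>"] iff by (metis null_setsD2)
  qed
qed

sublocale r: quasi_invariant \<mu> "\<lambda>x. 1 - x"
  using reflect_null_sets by unfold_locales (auto simp: sets_mu sigma_finite)

lemma S_norm_pointwise:
  assumes f: "f \<in> gw_space G"
  shows "AE x in \<mu>. (norm (S f x))\<^sup>2 = r.D x * (norm (f (1 - x)))\<^sup>2"
proof -
  note [measurable] = spaceD(1)[OF f] spaceD(1)[OF S_space[OF f]]
  have [measurable]: "(\<lambda>x. f (1 - x)) \<in> borel_measurable \<mu>" by measurable
  have "density \<mu> (\<lambda>x. ennreal ((norm (S f x))\<^sup>2)) = density \<mu> (\<lambda>x. ennreal (r.D x * (norm (f (1 - x)))\<^sup>2))"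
  proof (rule measure_eqI)
    fix E assume "E \<in> sets (density \<mu> (\<lambda>x. ennreal ((norm (S f x))\<^sup>2)))"
    then have [measurable]: "E \<in> sets \<mu>" by simp
    define E' where "E' = (\<lambda>x. 1 - x) -` E \<inter> space \<mu>"
    have [measurable]: "E' \<in> sets \<mu>" unfolding E'_def by measurable
    have ind: "indicator E' x = (indicator E (1 - x) :: ennreal)" for x
      by (simp add: E'_def indicator_def space_mu)
    have "emeasure (density \<mu> (\<lambda>x. ennreal ((norm (S f x))\<^sup>2))) E = (\<integral>\<^sup>+x. ennreal ((norm (S f x))\<^sup>2) * indicator E x \<partial>\<mu>)"
      by (rule emeasure_density) simp_all
    also have "\<dots> = (\<integral>\<^sup>+x. ennreal ((norm (S f x))\<^sup>2) * indicator E' (1 - x) \<partial>\<mu>)"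
      by (simp add: ind)
    also have "\<dots> = (\<integral>\<^sup>+x. ennreal ((norm (f x))\<^sup>2) * indicator E' x \<partial>\<mu>)"
      by (rule S_measure[OF f]) simp
    also have "\<dots> = (\<integral>\<^sup>+x. ennreal ((norm (f x))\<^sup>2) * indicator E (1 - x) \<partial>\<mu>)"
      by (simp add: ind)
    also have "\<dots> = (\<integral>\<^sup>+x. ennreal (r.D x) * (ennreal ((norm (f (1 - x)))\<^sup>2) * indicator E x) \<partial>\<mu>)"
      using r.nn_integral_theta[of "\<lambda>x. ennreal ((norm (f (1 - x)))\<^sup>2) * indicator E x"] by simp
    also have "\<dots> = emeasure (density \<mu> (\<lambda>x. ennreal (r.D x * (norm (f (1 - x)))\<^sup>2))) E"
      by (subst emeasure_density) (simp_all add: ennreal_mult' mult.assoc)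
    finally show "emeasure (density \<mu> (\<lambda>x. ennreal ((norm (S f x))\<^sup>2))) E
       = emeasure (density \<mu> (\<lambda>x. ennreal (r.D x * (norm (f (1 - x)))\<^sup>2))) E" .
  qed simp
  then have "AE x in \<mu>. ennreal ((norm (S f x))\<^sup>2) = ennreal (r.D x * (norm (f (1 - x)))\<^sup>2)"
    by (subst (asm) density_unique_iff) measurable
  then show ?thesis by eventually_elim simp
qed

text \<open>Polarization of the pointwise isometry.\<close>

lemma S_cinner:
  assumes f: "f \<in> gw_space G" and g: "g \<in> gw_space G"
  shows "AE x in \<mu>. cinner (S f x) (S g x) = complex_of_real (r.D x) * cnj (cinner (f (1 - x)) (g (1 - x)))"
proof -
  have ig: "(\<lambda>x. \<i> *\<^sub>C g x) \<in> gw_space G" by (rule space_scale[OF g])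
  have 1: "AE x in \<mu>. (norm (S f x + S h x))\<^sup>2 = r.D x * (norm (f (1 - x) + h (1 - x)))\<^sup>2"
    if h: "h \<in> gw_space G" for h
    using S_norm_pointwise[OF space_add[OF f h]] S_add[OF f h] unfolding eq_ae_def
    by eventually_elim simp
  have 2: "AE x in \<mu>. (norm (S f x - S h x))\<^sup>2 = r.D x * (norm (f (1 - x) - h (1 - x)))\<^sup>2"
    if h: "h \<in> gw_space G" for h
    using S_norm_pointwise[OF space_diff[OF f h]] S_diff[OF f h] unfolding eq_ae_def
    by eventually_elim simp
  have "AE x in \<mu>. S (\<lambda>x. \<i> *\<^sub>C g x) x = - (\<i> *\<^sub>C S g x)"
    using S_scale[OF g, of \<i>] unfolding eq_ae_def by eventually_elim simp
  then show ?thesis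
    using 1[OF g] 2[OF g] 1[OF ig] 2[OF ig]
  proof eventually_elim
    case (elim x)
    have 3: "(norm (S f x - \<i> *\<^sub>C S g x))\<^sup>2 = r.D x * (norm (f (1 - x) + \<i> *\<^sub>C g (1 - x)))\<^sup>2"
      "(norm (S f x + \<i> *\<^sub>C S g x))\<^sup>2 = r.D x * (norm (f (1 - x) - \<i> *\<^sub>C g (1 - x)))\<^sup>2"
      using elim(4,5) unfolding elim(1) by simp_all
    show ?case
      unfolding cinner_polarization[of "S f x"] cinner_polarization[of "f (1 - x)"] elim(2,3) 3
      by (simp add: complex_eq_iff algebra_simps)
  qed
qed

text \<open>The main step: a measurable field of orthonormal bases in which \<open>S\<close> is the conjugation of
  coordinates composed with the reflection.  As the reflection exchanges \<open>x 0 = 0\<close> and \<open>x 0 = 1\<close>,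
  any field of bases can be used on the first set, and \<open>S\<close> dictates the one on the second.\<close>

lemma adapted_frame:
  obtains a :: "X \<Rightarrow> nat \<Rightarrow> 'h" where "\<And>x. frame (\<nu> x) (V x) (a x)"
    "\<And>j. (\<lambda>x. a x j) \<in> borel_measurable \<mu>"
    "AE x in \<mu>. \<nu> (1 - x) = \<nu> x"
    "\<And>f. f \<in> gw_space G \<Longrightarrow> AE x in \<mu>. \<forall>j.
       cinner (S f x) (a x j) = complex_of_real (sqrt (r.D x)) * cnj (cinner (f (1 - x)) (a (1 - x) j))"
proof -
  obtain w where w: "w \<in> borel_measurable \<mu>" "\<And>x. w x > 0" "(\<integral>\<^sup>+x. ennreal ((w x)\<^sup>2) \<partial>\<mu>) < \<infinity>"
    using obtain_weight by blast
  obtain e where e: "\<And>x. frame (\<nu> x) (V x) (e x)" "\<And>j. (\<lambda>x. e x j) \<in> borel_measurable \<mu>"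
    using obtain_frame by metis
  note [measurable] = w(1) e(2)
  define \<epsilon> where "\<epsilon> j = (\<lambda>x. w x *\<^sub>R e x j)" for j
  have norm_e: "norm (e x j) \<le> 1" for x j
  proof -
    have "complex_of_real ((norm (e x j))\<^sup>2) = complex_of_real (of_bool (enat j < \<nu> x))"
      using frameD(1)[OF e(1), of x j j] unfolding cinner_self by simp
    then have "(norm (e x j))\<^sup>2 = of_bool (enat j < \<nu> x)" using of_real_eq_iff by blast
    then have "(norm (e x j))\<^sup>2 \<le> 1\<^sup>2" by simp
    then show ?thesis by (rule power2_le_imp_le) simp
  qed
  have \<epsilon>: "\<epsilon> j \<in> gw_space G" for j
  proof (rule spaceI)
    show "\<epsilon> j \<in> borel_measurable \<mu>" unfolding \<epsilon>_def by measurable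
    show "\<epsilon> j x \<in> V x" for x unfolding \<epsilon>_def by (intro fiber_scaleR frameD(3)[OF e(1)])
    have "(\<integral>\<^sup>+x. ennreal ((norm (\<epsilon> j x))\<^sup>2) \<partial>\<mu>) \<le> (\<integral>\<^sup>+x. ennreal ((w x)\<^sup>2) \<partial>\<mu>)"
    proof (intro nn_integral_mono ennreal_leI power_mono)
      fix x show "norm (\<epsilon> j x) \<le> w x"
        using mult_left_mono[OF norm_e[of x j], of "w x"] w(2)[of x] by (simp add: \<epsilon>_def)
    qed simp
    also have "\<dots> < \<infinity>" by (rule w(3))
    finally show "(\<integral>\<^sup>+x. ennreal ((norm (\<epsilon> j x))\<^sup>2) \<partial>\<mu>) < \<infinity>" .
  qed
  define \<epsilon>0 where "\<epsilon>0 j = (\<lambda>x. if x 0 \<noteq> 1 then \<epsilon> j x else 0)" for j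
  define \<epsilon>1 where "\<epsilon>1 j = (\<lambda>x. if x 0 = 1 then \<epsilon> j x else 0)" for j
  have \<epsilon>0: "\<epsilon>0 j \<in> gw_space G" and \<epsilon>1: "\<epsilon>1 j \<in> gw_space G" for j
    unfolding \<epsilon>0_def \<epsilon>1_def by (intro space_restrict[OF \<epsilon>] pred_intros_logic coordinate_measurable)+
  define b where "b j = S (\<epsilon>0 j)" for j
  define g where "g j = S (\<epsilon>1 j)" for j
  have b: "b j \<in> gw_space G" and g: "g j \<in> gw_space G" for j
    unfolding b_def g_def by (intro S_space \<epsilon>0 \<epsilon>1)+
  note [measurable] = spaceD(1)[OF b]
  define s where "s x = inverse (w (1 - x) * sqrt (r.D x))" for x
  \<comment> \<open>Over \<open>x 0 = 1\<close>, the images under \<open>S\<close> of the weighted basis fields on \<open>x 0 = 0\<close>, rescaled by \<open>s\<close>,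
      are orthonormal with \<open>\<nu> (1 - x)\<close> members.  They are complete because \<open>S\<close> maps the fields \<open>g i\<close>,
      which live on \<open>x 0 = 0\<close>, back to the weighted basis fields on \<open>x 0 = 1\<close>.\<close>
  have good: "AE x in \<mu>. x 0 = 1 \<longrightarrow> frame (\<nu> x) (V x) (\<lambda>j. s x *\<^sub>R b j x) \<and> \<nu> (1 - x) = \<nu> x"
  proof -
    have "AE x in \<mu>. \<forall>i j. cinner (b i x) (b j x) = complex_of_real (r.D x) * cnj (cinner (\<epsilon>0 i (1 - x)) (\<epsilon>0 j (1 - x)))"
      unfolding b_def by (intro AE_all_countable[THEN iffD2] allI S_cinner \<epsilon>0)
    moreover have "AE x in \<mu>. \<forall>i j. cinner (S (g i) x) (b j x) = complex_of_real (r.D x) * cnj (cinner (g i (1 - x)) (\<epsilon>0 j (1 - x)))"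
      unfolding b_def by (intro AE_all_countable[THEN iffD2] allI S_cinner \<epsilon>0 g)
    moreover have "AE x in \<mu>. \<forall>i. cinner (S (g i) x) (S (g i) x) = complex_of_real (r.D x) * cnj (cinner (g i (1 - x)) (g i (1 - x)))"
      by (intro AE_all_countable[THEN iffD2] allI S_cinner g)
    moreover have "AE x in \<mu>. \<forall>i. S (g i) x = \<epsilon>1 i x"
      unfolding g_def using S_S[OF \<epsilon>1] unfolding eq_ae_def AE_all_countable by blast
    ultimately show ?thesis
      using r.D_pos
    proof eventually_elim
      case (elim x)
      show ?case
      proof
        assume x: "x 0 = 1"
        define y where "y = 1 - x"
        have wy: "w y > 0" by (rule w(2))
        have s: "s x = inverse (w y * sqrt (r.D x))" "s x > 0"
          using wy elim(5) by (simp_all add: s_def y_def)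
        have \<epsilon>0y: "\<epsilon>0 j (1 - x) = \<epsilon> j y" for j using x by (simp add: \<epsilon>0_def y_def)
        have Sg: "S (g i) x = \<epsilon> i x" for i using elim(4) x by (simp add: \<epsilon>1_def)
        have \<epsilon>e: "\<epsilon> j u = complex_of_real (w u) *\<^sub>C e u j" for j u by (simp add: \<epsilon>_def scaleR_eq_scaleC)
        define p where "p j = s x *\<^sub>R b j x" for j
        have span_b: "b j x \<in> cspan (range p)" for j
        proof -
          have "b j x = complex_of_real (inverse (s x)) *\<^sub>C p j"
            using s(2) by (simp add: p_def scaleC_scaleR(3) del: of_real_inverse)
          then show ?thesis by (simp add: complex_vs.span_base complex_vs.span_scale)
        qed
        have V_y: "V y \<subseteq> closure (cspan (range (\<lambda>j. \<epsilon> j y)))"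
        proof -
          have "e y j \<in> cspan (range (\<lambda>j. \<epsilon> j y))" for j
          proof -
            have "e y j = complex_of_real (inverse (w y)) *\<^sub>C \<epsilon> j y"
              using wy by (simp add: \<epsilon>_def scaleC_scaleR(3) less_imp_neq[THEN not_sym] del: of_real_inverse)
            then show ?thesis by (simp add: complex_vs.span_base complex_vs.span_scale)
          qed
          then have "cspan (range (e y)) \<subseteq> cspan (range (\<lambda>j. \<epsilon> j y))"
            by (intro complex_vs.span_minimal complex_vs.subspace_span) auto
          then show ?thesis using closure_mono frameD(2)[OF e(1)] by metis
        qed
        have "\<epsilon> i x \<in> closure (cspan (range (\<lambda>j. b j x)))" for i
        proof (rule gram_closure)
          show "g i y \<in> closure (cspan (range (\<lambda>j. \<epsilon> j y)))"
            using V_y spaceD(2)[OF g] by blast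
          show "cinner (b i x) (b j x) = complex_of_real (r.D x) * cnj (cinner (\<epsilon> i y) (\<epsilon> j y))" for i j
            using elim(1) unfolding \<epsilon>0y by blast
          show "cinner (\<epsilon> i x) (b j x) = complex_of_real (r.D x) * cnj (cinner (g i y) (\<epsilon> j y))" for j
            using elim(2) unfolding Sg \<epsilon>0y unfolding y_def by blast
          show "cinner (\<epsilon> i x) (\<epsilon> i x) = complex_of_real (r.D x) * cnj (cinner (g i y) (g i y))"
            using elim(3) unfolding Sg unfolding y_def by blast
        qed simp
        moreover have "closure (cspan (range (\<lambda>j. b j x))) \<subseteq> closure (cspan (range p))"
          using span_b by (intro closure_mono complex_vs.span_minimal complex_vs.subspace_span) auto
        ultimately have \<epsilon>p: "\<epsilon> i x \<in> closure (cspan (range p))" for i by blast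
        have "e x i \<in> closure (cspan (range p))" for i
        proof -
          have "e x i = complex_of_real (inverse (w x)) *\<^sub>C \<epsilon> i x"
            using w(2)[of x] by (simp add: \<epsilon>_def scaleC_scaleR(3) less_imp_neq[THEN not_sym] del: of_real_inverse)
          then show ?thesis
            using complex_vs.subspace_scale[OF csubspace_closure_cspan \<epsilon>p] by metis
        qed
        then have "closure (cspan (range (e x))) \<subseteq> closure (cspan (range p))"
          by (intro closure_cspan_least csubspace_closure_cspan closed_closure) auto
        then have "V x \<subseteq> closure (cspan (range p))" using frameD(2)[OF e(1)] by metis
        moreover have "closure (cspan (range p)) \<subseteq> V x"
          using spaceD(2)[OF b] by (intro closure_cspan_least fiber_closed fiber_csubspace)
            (auto simp: p_def intro: fiber_scaleR)
        moreover have "cinner (p i) (p j) = of_bool (i = j \<and> enat i < \<nu> y)" for i j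
        proof -
          have "cinner (p i) (p j) = complex_of_real (s x * s x * r.D x * w y * w y) * of_bool (i = j \<and> enat i < \<nu> y)"
            using elim(1) unfolding \<epsilon>0y
            by (simp add: p_def scaleR_eq_scaleC cinner_scaleC_left cinner_scaleC_right \<epsilon>e frameD(1)[OF e(1)])
          also have "s x * s x * r.D x * w y * w y = 1"
          proof -
            have "s x * s x * r.D x * w y * w y = s x * s x * (sqrt (r.D x) * sqrt (r.D x)) * w y * w y"
              by simp
            also have "\<dots> = (s x * (w y * sqrt (r.D x))) * (s x * (w y * sqrt (r.D x)))"
              by (simp only: mult_ac)
            also have "s x * (w y * sqrt (r.D x)) = 1" unfolding s(1) using wy elim(5) by (intro left_inverse) simp
            finally show ?thesis unfolding mult_1_left .
          qed
          finally show ?thesis by simp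
        qed
        ultimately have fr: "frame (\<nu> y) (V x) p" unfolding frame_def by blast
        moreover have "\<nu> x = \<nu> y" by (rule frame_dimension_unique[OF fr e(1)])
        ultimately show "frame (\<nu> x) (V x) (\<lambda>j. s x *\<^sub>R b j x) \<and> \<nu> (1 - x) = \<nu> x"
          unfolding p_def y_def by simp
      qed
    qed
  qed
  then obtain N where N: "N \<in> null_sets \<mu>"
    "{x \<in> space \<mu>. \<not> (x 0 = 1 \<longrightarrow> frame (\<nu> x) (V x) (\<lambda>j. s x *\<^sub>R b j x) \<and> \<nu> (1 - x) = \<nu> x)} \<subseteq> N"
    unfolding eventually_ae_filter by blast
  have [measurable]: "N \<in> sets \<mu>" using N(1) by auto
  \<comment> \<open>On the exceptional null set \<open>N\<close> the old basis is kept, so that \<open>a x\<close> is a frame everywhere.\<close>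
  define a where "a x j = (if x 0 = 1 \<and> x \<notin> N then s x *\<^sub>R b j x else e x j)" for x j
  have a_frame: "frame (\<nu> x) (V x) (a x)" for x
  proof (cases "x 0 = 1 \<and> x \<notin> N")
    case True
    then have "frame (\<nu> x) (V x) (\<lambda>j. s x *\<^sub>R b j x)" using N(2) space_mu by blast
    moreover have "a x = (\<lambda>j. s x *\<^sub>R b j x)" using True by (simp add: a_def fun_eq_iff)
    ultimately show ?thesis by simp
  next
    case False
    then have "a x = e x" by (auto simp: a_def fun_eq_iff)
    then show ?thesis using e(1) by simp
  qed
  have [measurable]: "s \<in> borel_measurable \<mu>"
  proof -
    have "(\<lambda>x. w (1 - x)) \<in> borel_measurable \<mu>" by (rule r.theta_compose[OF w(1)])
    then show ?thesis unfolding s_def[abs_def] by measurable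
  qed
  have a_meas: "(\<lambda>x. a x j) \<in> borel_measurable \<mu>" for j
    unfolding a_def by measurable
  have nu_sym: "AE x in \<mu>. \<nu> (1 - x) = \<nu> x"
    using good r.AE_theta[OF good]
  proof eventually_elim
    case (elim x)
    then show ?case by (cases "x 0 = 1") auto
  qed
  have on1: "AE x in \<mu>. x 0 = 1 \<longrightarrow> (\<forall>j. cinner (S f x) (a x j) =
      complex_of_real (sqrt (r.D x)) * cnj (cinner (f (1 - x)) (a (1 - x) j)))"
    if f: "f \<in> gw_space G" for f
  proof -
    have "AE x in \<mu>. \<forall>j. cinner (S f x) (b j x) = complex_of_real (r.D x) * cnj (cinner (f (1 - x)) (\<epsilon>0 j (1 - x)))"
      unfolding b_def by (intro AE_all_countable[THEN iffD2] allI S_cinner \<epsilon>0 f)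
    then show ?thesis
      using AE_not_in[OF N(1)] r.D_pos
    proof eventually_elim
      case (elim x)
      show ?case
      proof (intro impI allI)
        fix j assume x: "x 0 = 1"
        have "cinner (S f x) (a x j) = complex_of_real (s x) * cinner (S f x) (b j x)"
          using x elim(2) by (simp add: a_def scaleR_eq_scaleC cinner_scaleC_right)
        also have "\<dots> = complex_of_real (s x * r.D x * w (1 - x)) * cnj (cinner (f (1 - x)) (e (1 - x) j))"
          using elim(1) x by (simp add: \<epsilon>0_def \<epsilon>_def scaleR_eq_scaleC cinner_scaleC_right)
        also have "e (1 - x) j = a (1 - x) j" using x by (simp add: a_def)
        also have "s x * r.D x * w (1 - x) = sqrt (r.D x)"
          using w(2)[of "1 - x"] elim(3) by (simp add: s_def divide_simps)
        finally show "cinner (S f x) (a x j) =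
          complex_of_real (sqrt (r.D x)) * cnj (cinner (f (1 - x)) (a (1 - x) j))" .
      qed
    qed
  qed
  \<comment> \<open>Over \<open>x 0 = 0\<close> the relation follows from the one at \<open>1 - x\<close> for the field \<open>S f\<close>, as \<open>S (S f) = f\<close>.\<close>
  have all: "AE x in \<mu>. \<forall>j. cinner (S f x) (a x j) =
      complex_of_real (sqrt (r.D x)) * cnj (cinner (f (1 - x)) (a (1 - x) j))"
    if f: "f \<in> gw_space G" for f
    using on1[OF f] r.AE_theta[OF on1[OF S_space[OF f]]] r.AE_theta[OF S_S[OF f, unfolded eq_ae_def]] r.D_theta
  proof eventually_elim
    case (elim x)
    show ?case
    proof (cases "x 0 = 1")
      case False
      show ?thesis
      proof
        fix j
        have "cinner (f (1 - x)) (a (1 - x) j) = complex_of_real (sqrt (r.D (1 - x))) * cnj (cinner (S f x) (a x j))"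
          using elim(2,3) False by simp
        then have "complex_of_real (sqrt (r.D x)) * cnj (cinner (f (1 - x)) (a (1 - x) j))
           = complex_of_real (sqrt (r.D x) * sqrt (r.D (1 - x))) * cinner (S f x) (a x j)"
          by simp
        also have "sqrt (r.D x) * sqrt (r.D (1 - x)) = 1"
          using elim(4) by (simp add: mult.commute flip: real_sqrt_mult)
        finally show "cinner (S f x) (a x j) =
          complex_of_real (sqrt (r.D x)) * cnj (cinner (f (1 - x)) (a (1 - x) j))"
          by (simp only: of_real_1 mult_1_left)
      qed
    qed (use elim(1) in blast)
  qed
  show ?thesis by (rule that[OF a_frame a_meas nu_sym all])
qed

end

section \<open>Transport of a module along a field of frames\<close>

lemma frame_hilbert_subspace:
  assumes b: "frame n V b"
  shows "hilbert_subspace_of_dim V n"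
proof -
  let ?I = "{j. enat j < n}"
  define B where "B = b ` ?I"
  have inj: "inj_on b ?I"
  proof (rule inj_onI)
    fix i j assume "i \<in> ?I" "j \<in> ?I" "b i = b j"
    then show "i = j" using frameD(1)[OF b, of i j] frameD(1)[OF b, of i i] by (auto split: if_splits)
  qed
  have sub: "range b \<subseteq> insert 0 B" using frame_zero[OF b] by (auto simp: B_def)
  have "cspan (range b) = cspan B"
  proof (rule antisym)
    show "cspan (range b) \<subseteq> cspan B"
      using complex_vs.span_mono[OF sub] by simp
    show "cspan B \<subseteq> cspan (range b)" by (rule complex_vs.span_mono) (auto simp: B_def)
  qed
  then have span: "closure (cspan B) = V" using frameD(2)[OF b] by simp
  have "orthonormal_basis_of V B"
    unfolding orthonormal_basis_of_def
  proof (intro conjI ballI span)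
    show "B \<subseteq> V" using frameD(3)[OF b] by (auto simp: B_def)
    fix u v assume "u \<in> B" "v \<in> B"
    then obtain i j where ij: "enat i < n" "enat j < n" "u = b i" "v = b j" by (auto simp: B_def)
    then have "b i = b j \<longleftrightarrow> i = j" using inj by (auto simp: inj_on_def)
    then show "cinner u v = (if u = v then 1 else 0)" using ij frameD(1)[OF b, of i j] by simp
  qed
  moreover have "countable B" by (simp add: B_def)
  moreover have "case n of enat m \<Rightarrow> finite B \<and> card B = m | \<infinity> \<Rightarrow> infinite B"
  proof (cases n)
    case (enat m)
    then have "?I = {..<m}" by auto
    then show ?thesis using enat inj by (simp add: B_def card_image)
  next
    case infinity
    then have "?I = UNIV" by auto
    then have "infinite B" using inj finite_imageD[of b UNIV] by (auto simp: B_def)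
    then show ?thesis using infinity by simp
  qed
  ultimately show ?thesis
    unfolding hilbert_subspace_of_dim_def using frameD(4,5)[OF b] by blast
qed

lemma cinner_frame_map_frame_map:
  assumes e: "frame n V e" and e': "frame n V' e'" and v: "v \<in> V" and w: "w \<in> V"
  shows "cinner (frame_map e e' v) (frame_map e e' w) = cinner v w"
proof -
  let ?T = "frame_map e e'"
  have V: "csubspace V" by (rule frameD(4)[OF e])
  have norm: "norm (?T v + a *\<^sub>C ?T u) = norm (v + a *\<^sub>C u)" if u: "u \<in> V" for a u
  proof -
    have "?T v + a *\<^sub>C ?T u = ?T (v + a *\<^sub>C u)"
      using frame_map_linear[OF e e' v complex_vs.subspace_scale[OF V u, of a]] frame_map_linear(2)[OF e e' u u, of a] by simp
    then show ?thesis
      using norm_frame_map[OF e e' complex_vs.subspace_add[OF V v complex_vs.subspace_scale[OF V u, of a]]] by simp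
  qed
  show ?thesis
    unfolding cinner_polarization[of "?T v"] cinner_polarization[of v]
    using norm[OF w, of 1] norm[OF w, of "-1"] norm[OF w, of \<i>] norm[OF w, of "- \<i>"] by simp
qed

lemma cinner_frame_map_swap:
  assumes e: "frame n V e" and e': "frame n V' e'" and v: "v \<in> V" and w: "w \<in> V'"
  shows "cinner (frame_map e e' v) w = cinner v (frame_map e' e w)"
  using cinner_frame_map_frame_map[OF e e' v frame_map_in[OF e' e w]] frame_map_inverse[OF e' e w] by simp

lemma frame_map_image:
  assumes e: "frame n V e" and e': "frame n V' e'"
  shows "frame_map e e' ` V = V'"
proof
  show "frame_map e e' ` V \<subseteq> V'" using frame_map_in[OF e e'] by blast
  show "V' \<subseteq> frame_map e e' ` V"
    using frame_map_in[OF e' e] frame_map_inverse[OF e' e] by (metis image_eqI subsetI)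
qed

lemma frame_map_measurable [measurable]:
  fixes p :: "'x \<Rightarrow> nat \<Rightarrow> 'a::{complex_hilbert, second_countable_topology}"
    and q :: "'x \<Rightarrow> nat \<Rightarrow> 'b::{complex_hilbert, second_countable_topology}"
  assumes [measurable]: "\<And>j. (\<lambda>x. p x j) \<in> borel_measurable M" "\<And>j. (\<lambda>x. q x j) \<in> borel_measurable M"
    "f \<in> borel_measurable M"
  shows "(\<lambda>x. frame_map (p x) (q x) (f x)) \<in> borel_measurable M"
  unfolding frame_map_def by measurable

text \<open>Frames \<open>a x\<close> of the given fibres and frames \<open>b x\<close> of new fibres \<open>V' x\<close> of the same dimension.  The
  \<open>b x\<close> depend only on \<open>\<nu> x\<close>, as the new fibres must; the \<open>a x\<close> need only be measurable in \<open>x\<close>.\<close>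

locale frame_transport = garding_wightman G
  for G :: "'h::{complex_hilbert, second_countable_topology} gw" +
  fixes a :: "X \<Rightarrow> nat \<Rightarrow> 'h" and V' :: "X \<Rightarrow> 'g::{complex_hilbert, second_countable_topology} set"
    and b :: "X \<Rightarrow> nat \<Rightarrow> 'g"
  assumes a_frame: "frame (gw_mult G x) (gw_fiber G x) (a x)"
    and a_measurable: "(\<lambda>x. a x j) \<in> borel_measurable (gw_measure G)"
    and b_frame: "frame (gw_mult G x) (V' x) (b x)"
    and b_eq: "gw_mult G x = gw_mult G y \<Longrightarrow> b x = b y"
begin

text \<open>The unitary operator from the old to the new fibre at \<open>x\<close>, and its inverse.\<close>

definition U :: "X \<Rightarrow> 'h \<Rightarrow> 'g" where "U x = frame_map (a x) (b x)"
definition U' :: "X \<Rightarrow> 'g \<Rightarrow> 'h" where "U' x = frame_map (b x) (a x)"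

text \<open>The transported operators \<open>U x \<circ> c k x \<circ> U' (x + delta k)\<close>.  Where the fibres at \<open>x\<close> and
  \<open>x + delta k\<close> may differ, which is a null set, this composition need not be measurable in \<open>x\<close> and is
  replaced by the identity.\<close>

definition c' :: "nat \<Rightarrow> X \<Rightarrow> 'g \<Rightarrow> 'g" where
  "c' k x v = (if \<nu> (x + delta k) = \<nu> x then U x (c k x (U' (x + delta k) v)) else v)"

text \<open>The transported triple; measure and multiplicity function are unchanged.\<close>

definition G' :: "'g gw" where
  "G' = \<lparr>gw_measure = \<mu>, gw_mult = \<nu>, gw_coeff = c', gw_fiber = V'\<rparr>"

text \<open>The induced unitary operator between the direct integrals, and its inverse.\<close>

definition T :: "(X \<Rightarrow> 'h) \<Rightarrow> (X \<Rightarrow> 'g)" where "T f = (\<lambda>x. U x (f x))"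
definition T' :: "(X \<Rightarrow> 'g) \<Rightarrow> (X \<Rightarrow> 'h)" where "T' f = (\<lambda>x. U' x (f x))"

lemma G'_sel [simp]: "gw_measure G' = \<mu>" "gw_mult G' = \<nu>" "gw_coeff G' = c'" "gw_fiber G' = V'"
  by (simp_all add: G'_def)

lemma V'_eq: "\<nu> x = \<nu> y \<Longrightarrow> V' x = V' y"
  using b_eq[of x y] frameD(2)[OF b_frame[of x]] frameD(2)[OF b_frame[of y]] by simp

lemmas U_in = frame_map_in[OF a_frame b_frame, folded U_def]
  and U'_in = frame_map_in[OF b_frame a_frame, folded U'_def]
  and U_norm = norm_frame_map[OF a_frame b_frame, folded U_def]
  and U'_norm = norm_frame_map[OF b_frame a_frame, folded U'_def]
  and U_coord = cinner_frame_map[OF a_frame b_frame, folded U_def]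
  and U_add = frame_map_linear(1)[OF a_frame b_frame, folded U_def]
  and U'_add = frame_map_linear(1)[OF b_frame a_frame, folded U'_def]
  and U'_U = frame_map_inverse[OF a_frame b_frame, folded U_def U'_def]
  and U_U' = frame_map_inverse[OF b_frame a_frame, folded U_def U'_def]
  and U_cinner = cinner_frame_map_frame_map[OF a_frame b_frame, folded U_def]
  and U_swap = cinner_frame_map_swap[OF a_frame b_frame, folded U_def U'_def]
  and U'_swap = cinner_frame_map_swap[OF b_frame a_frame, folded U_def U'_def]

lemma U_scale: "v \<in> V x \<Longrightarrow> U x (s *\<^sub>C v) = s *\<^sub>C U x v"
  and U'_scale: "w \<in> V' x \<Longrightarrow> U' x (s *\<^sub>C w) = s *\<^sub>C U' x w"
  unfolding U_def U'_def using frame_map_linear(2)[OF a_frame b_frame] frame_map_linear(2)[OF b_frame a_frame] by blast+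

lemma b_measurable: "(\<lambda>x. b x j) \<in> borel_measurable \<mu>"
proof -
  define B where "B n = b (SOME x. \<nu> x = n)" for n
  have "b x = B (\<nu> x)" for x
    unfolding B_def by (rule b_eq) (metis (mono_tags) someI)
  then have "(\<lambda>x. b x j) = (\<lambda>x. B (\<nu> x) j)" by simp
  moreover have "(\<lambda>x. B (\<nu> x) j) \<in> borel_measurable \<mu>"
    by (rule measurable_compose[OF nu_measurable]) simp
  ultimately show ?thesis by simp
qed

lemma U_measurable [measurable]: "f \<in> borel_measurable \<mu> \<Longrightarrow> (\<lambda>x. U x (f x)) \<in> borel_measurable \<mu>"
  and U'_measurable [measurable]: "g \<in> borel_measurable \<mu> \<Longrightarrow> (\<lambda>x. U' x (g x)) \<in> borel_measurable \<mu>"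
  unfolding U_def U'_def by (intro frame_map_measurable a_measurable b_measurable; assumption)+

lemma coeff_transport_measurable:
  assumes f: "f \<in> measurable_fields G'"
  shows "(\<lambda>x. c' k x (f x)) \<in> borel_measurable \<mu>"
proof -
  interpret t: quasi_invariant \<mu> "\<lambda>x. x + delta k" by (simp add: quasi_invariant_translate)
  have fm [measurable]: "f \<in> borel_measurable \<mu>" and fV: "f x \<in> V' x" for x
    using f by (auto simp: measurable_fields_def)
  have P [measurable]: "Measurable.pred \<mu> (\<lambda>x. \<nu> (x + delta k) = \<nu> x)"
    by (rule nu_equal_measurable[OF t.theta_measurable_mu])
  define h where "h = (\<lambda>x. if \<nu> (x + delta k) = \<nu> x then U' (x + delta k) (f x) else 0)"
  have "(\<lambda>x. U' (x + delta k) (f x)) \<in> borel_measurable \<mu>"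
    unfolding U'_def by (intro frame_map_measurable fm t.theta_compose[OF a_measurable] t.theta_compose[OF b_measurable])
  then have "h \<in> borel_measurable \<mu>" unfolding h_def by (intro measurable_If P[unfolded pred_def]) simp_all
  moreover have "h x \<in> V x" for x
  proof (cases "\<nu> (x + delta k) = \<nu> x")
    case True
    then have "f x \<in> V' (x + delta k)" using fV[of x] V'_eq[OF True] by simp
    from U'_in[OF this] show ?thesis using True fiber_eq[OF True] by (simp add: h_def)
  qed (simp add: h_def)
  ultimately have "(\<lambda>x. c k x (h x)) \<in> borel_measurable \<mu>"
    by (intro coeff_measurable) (simp add: measurable_fields_def)
  then have "(\<lambda>x. U x (c k x (h x))) \<in> borel_measurable \<mu>" by (rule U_measurable)
  then have "(\<lambda>x. if \<nu> (x + delta k) = \<nu> x then U x (c k x (h x)) else f x) \<in> borel_measurable \<mu>"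
    by (intro measurable_If P[unfolded pred_def] fm)
  moreover have "(\<lambda>x. if \<nu> (x + delta k) = \<nu> x then U x (c k x (h x)) else f x) = (\<lambda>x. c' k x (f x))"
    by (simp add: fun_eq_iff c'_def h_def)
  ultimately show ?thesis by simp
qed

lemma AE_nu_Delta: "AE x in \<mu>. \<forall>d\<in>Delta. \<nu> (x + d) = \<nu> x \<and> V (x + d) = V x \<and> V' (x + d) = V' x"
  using AE_nu by eventually_elim (metis fiber_eq V'_eq)

lemma delta_swap: "x + delta k + delta l = x + delta l + delta k" for x :: X
  by (simp only: add.assoc add.commute[of "delta k"])

lemma delta_add_Delta: "delta k + delta l \<in> Delta"
proof -
  have "{j. (delta k + delta l) j = 1} \<subseteq> {k, l}" by (auto simp: delta_def)
  then show ?thesis unfolding Delta_def using finite_subset by blast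
qed

lemma AE_unitary_translate: "AE x in \<mu>. \<forall>k l. unitary_on (V (x + delta k)) (c l (x + delta k))"
  unfolding AE_all_countable[of _ \<mu>]
proof
  fix k
  interpret t: quasi_invariant \<mu> "\<lambda>x. x + delta k" by (simp add: quasi_invariant_translate)
  show "\<forall>l. AE x in \<mu>. unitary_on (V (x + delta k)) (c l (x + delta k))"
    using t.AE_theta[OF AE_unitary] unfolding AE_all_countable .
qed

lemma gw_triple_transport: "gw_triple G'"
proof -
  have unit: "AE x in \<mu>. \<forall>k. unitary_on (V' x) (c' k x)"
    using AE_nu_Delta AE_unitary
  proof eventually_elim
    case (elim x)
    show ?case
    proof
      fix k
      have nu: "\<nu> (x + delta k) = \<nu> x" "V (x + delta k) = V x" "V' (x + delta k) = V' x"
        using elim(1) delta_in_Delta by blast+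
      have un: "unitary_on (V x) (c k x)" using elim(2) by blast
      note A = unitary_onD[OF un]
      note B = U'_in[of _ "x + delta k", unfolded nu]
        U'_norm[of _ "x + delta k", unfolded nu]
        U'_add[of _ "x + delta k", unfolded nu]
        U'_scale[of _ "x + delta k", unfolded nu]
      have c': "c' k x = (\<lambda>v. U x (c k x (U' (x + delta k) v)))" using nu by (simp add: c'_def fun_eq_iff)
      have "U' (x + delta k) ` V' x = V x"
        using frame_map_image[OF b_frame[of "x + delta k"] a_frame[of "x + delta k"]] unfolding U'_def nu .
      moreover have "c k x ` V x = V x" using un by (simp add: unitary_on_def)
      moreover have "U x ` V x = V' x" using frame_map_image[OF a_frame b_frame] unfolding U_def .
      ultimately have "U x ` c k x ` U' (x + delta k) ` V' x = V' x" by simp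
      then have "(\<lambda>v. U x (c k x (U' (x + delta k) v))) ` V' x = V' x"
        unfolding image_image .
      then show "unitary_on (V' x) (c' k x)"
        unfolding unitary_on_def c'
        by (simp add: B A U_add U_scale U_norm)
    qed
  qed
  have adj: "AE x in \<mu>. \<forall>k. \<forall>v\<in>V' x. \<forall>w\<in>V' x. cinner (c' k x v) w = cinner v (c' k (x + delta k) w)"
    using AE_nu_Delta AE_unitary AE_adjoint AE_unitary_translate
  proof eventually_elim
    case (elim x)
    show ?case
    proof (intro allI ballI)
      fix k v w assume v: "v \<in> V' x" and w: "w \<in> V' x"
      let ?y = "x + delta k"
      have nu: "\<nu> ?y = \<nu> x" "V ?y = V x" "V' ?y = V' x"
        using elim(1) delta_in_Delta by blast+
      have un: "unitary_on (V x) (c k x)" "unitary_on (V x) (c k ?y)"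
        using elim(2) elim(4)[rule_format, of k k] unfolding nu(2) by blast+
      have v': "U' ?y v \<in> V x" using U'_in[of v ?y] v nu by simp
      have w': "U' x w \<in> V x" using U'_in[of w x] w by simp
      have "cinner (c' k x v) w = cinner (U x (c k x (U' ?y v))) w" using nu by (simp add: c'_def)
      also have "\<dots> = cinner (c k x (U' ?y v)) (U' x w)"
        by (rule U_swap[OF unitary_onD(1)[OF un(1) v'] w])
      also have "\<dots> = cinner (U' ?y v) (c k ?y (U' x w))" using elim(3) v' w' by blast
      also have "\<dots> = cinner v (U ?y (c k ?y (U' x w)))"
      proof (rule U'_swap)
        show "v \<in> V' ?y" using v nu by simp
        show "c k ?y (U' x w) \<in> V ?y" using unitary_onD(1)[OF un(2) w'] nu by simp
      qed
      also have "U ?y (c k ?y (U' x w)) = c' k ?y w" using nu unfolding c'_def translate_translate by simp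
      finally show "cinner (c' k x v) w = cinner v (c' k ?y w)" .
    qed
  qed
  have com: "AE x in \<mu>. \<forall>k l. \<forall>v\<in>V' x. c' k x (c' l (x + delta k) v) = c' l x (c' k (x + delta l) v)"
    using AE_nu_Delta AE_commute AE_unitary_translate
  proof eventually_elim
    case (elim x)
    have nu: "\<nu> (x + delta k) = \<nu> x" "V (x + delta k) = V x" "V' (x + delta k) = V' x" for k
      using elim(1) delta_in_Delta by blast+
    have nu2: "\<nu> (x + delta k + delta l) = \<nu> x" "V (x + delta k + delta l) = V x" "V' (x + delta k + delta l) = V' x" for k l
      using elim(1) delta_add_Delta[of k l] unfolding add.assoc by blast+
    have *: "c' k x (c' l (x + delta k) v) = U x (c k x (c l (x + delta k) (U' (x + delta k + delta l) v)))"
      if v: "v \<in> V' x" for k l v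
    proof -
      have "U' (x + delta k + delta l) v \<in> V (x + delta k)"
        using U'_in[of v "x + delta k + delta l"] v nu2 nu by simp
      then have "c l (x + delta k) (U' (x + delta k + delta l) v) \<in> V (x + delta k)"
        using elim(3) unitary_onD(1) by blast
      then show ?thesis using nu nu2 by (simp add: c'_def U'_U)
    qed
    show ?case
    proof (intro allI ballI)
      fix k l v assume v: "v \<in> V' x"
      have "U' (x + delta k + delta l) v \<in> V x"
        using U'_in[of v "x + delta k + delta l"] v nu2 by simp
      then show "c' k x (c' l (x + delta k) v) = c' l x (c' k (x + delta l) v)"
        unfolding *[OF v] delta_swap[of x l k] using elim(2) by simp
    qed
  qed
  have dim: "\<forall>x. hilbert_subspace_of_dim (V' x) (\<nu> x)" using frame_hilbert_subspace[OF b_frame] by blast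
  show ?thesis
    using triple unit adj com dim V'_eq coeff_transport_measurable
    unfolding gw_triple_def Let_def G'_sel by blast
qed

sublocale p: garding_wightman G' by unfold_locales (rule gw_triple_transport)

lemma T_space: "f \<in> gw_space G \<Longrightarrow> T f \<in> gw_space G'"
proof -
  assume f: "f \<in> gw_space G"
  show ?thesis
  proof (rule p.spaceI)
    have "norm (T f x) = norm (f x)" for x unfolding T_def by (rule U_norm[OF spaceD(2)[OF f]])
    then show "(\<integral>\<^sup>+x. ennreal ((norm (T f x))\<^sup>2) \<partial>gw_measure G') < \<infinity>" using spaceD(5)[OF f] by simp
  qed (use spaceD[OF f] U_in in \<open>simp_all add: T_def\<close>)
qed

lemma T'_space: "f \<in> gw_space G' \<Longrightarrow> T' f \<in> gw_space G"
proof -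
  assume f: "f \<in> gw_space G'"
  note D = p.spaceD[OF f, simplified]
  show ?thesis
  proof (rule spaceI)
    have "norm (T' f x) = norm (f x)" for x unfolding T'_def by (rule U'_norm[OF D(2)])
    then show "(\<integral>\<^sup>+x. ennreal ((norm (T' f x))\<^sup>2) \<partial>\<mu>) < \<infinity>" using D(5) by simp
  qed (use D U'_in in \<open>simp_all add: T'_def\<close>)
qed

lemma T'_T: "f \<in> gw_space G \<Longrightarrow> T' (T f) = f"
  unfolding T_def T'_def by (rule ext) (rule U'_U[OF spaceD(2)])

lemma T_T': "f \<in> gw_space G' \<Longrightarrow> T (T' f) = f"
  unfolding T_def T'_def by (rule ext) (rule U_U', use p.spaceD(2) in simp)

lemma T_add: "f \<in> gw_space G \<Longrightarrow> g \<in> gw_space G \<Longrightarrow> T (\<lambda>x. f x + g x) = (\<lambda>x. T f x + T g x)"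
  unfolding T_def by (rule ext) (intro U_add spaceD(2))

lemma T_scale: "f \<in> gw_space G \<Longrightarrow> T (\<lambda>x. s *\<^sub>C f x) = (\<lambda>x. s *\<^sub>C T f x)"
  unfolding T_def by (rule ext) (intro U_scale spaceD(2))

lemma T'_add: "f \<in> gw_space G' \<Longrightarrow> g \<in> gw_space G' \<Longrightarrow> T' (\<lambda>x. f x + g x) = (\<lambda>x. T' f x + T' g x)"
  unfolding T'_def by (rule ext) (rule U'_add, use p.spaceD(2) in simp_all)

lemma T'_scale: "f \<in> gw_space G' \<Longrightarrow> T' (\<lambda>x. s *\<^sub>C f x) = (\<lambda>x. s *\<^sub>C T' f x)"
  unfolding T'_def by (rule ext) (rule U'_scale, use p.spaceD(2) in simp)

lemma T_cong: "eq_ae G f g \<Longrightarrow> eq_ae G' (T f) (T g)"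
  and T'_cong: "eq_ae G' f' g' \<Longrightarrow> eq_ae G (T' f') (T' g')"
  unfolding eq_ae_def T_def T'_def G'_sel by (erule eventually_mono, simp)+

lemma T_inner: "f \<in> gw_space G \<Longrightarrow> g \<in> gw_space G \<Longrightarrow> gw_inner G' (T f) (T g) = gw_inner G f g"
  unfolding gw_inner_def T_def by (simp add: U_cinner spaceD(2))

lemma T_norm: "f \<in> gw_space G \<Longrightarrow> gw_norm G' (T f) = gw_norm G f"
  unfolding gw_norm_def T_def by (simp add: U_norm spaceD(2))

lemma T_semilinear: "semilinear_map id G G' T"
  unfolding semilinear_map_def
  by (simp add: T_space T_cong T_add T_scale) (simp add: eq_ae_def)

text \<open>The transported Clifford action.\<close>

definition J' :: "('z \<Rightarrow> (X \<Rightarrow> 'h) \<Rightarrow> (X \<Rightarrow> 'h)) \<Rightarrow> 'z \<Rightarrow> (X \<Rightarrow> 'g) \<Rightarrow> (X \<Rightarrow> 'g)" where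
  "J' J v f = T (J v (T' f))"

lemma clifford_module_transport:
  assumes J: "clifford_module G J"
  shows "clifford_module G' (J' J)"
proof -
  note JS = cliffordD(2)[OF J] and JT = cliffordD(2)[OF J T'_space]
  have Tc: "eq_ae G' (T f) h" if "eq_ae G f g" "T g = h" for f g h using T_cong[OF that(1)] that(2) by simp
  have semi: "semilinear_map id G' G' (J' J v)" for v
    unfolding semilinear_map_def J'_def id_apply
  proof (intro conjI ballI allI impI)
    fix f assume f: "f \<in> gw_space G'"
    show "T (J v (T' f)) \<in> gw_space G'" by (intro T_space JT f)
    show "eq_ae G' (T (J v (T' f))) (T (J v (T' g)))" if "g \<in> gw_space G'" "eq_ae G' f g" for g
      by (intro T_cong cliffordD(3)[OF J] T'_space T'_cong f that)
    show "eq_ae G' (T (J v (T' (\<lambda>x. f x + g x)))) (\<lambda>x. T (J v (T' f)) x + T (J v (T' g)) x)"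
      if g: "g \<in> gw_space G'" for g
      unfolding T'_add[OF f g]
      by (rule Tc[OF semilinearD(3)[OF cliffordD(1)[OF J T'_space[OF f]]]]) (intro T'_space T_add JT f g)+
    show "eq_ae G' (T (J v (T' (\<lambda>x. a *\<^sub>C f x)))) (\<lambda>x. a *\<^sub>C T (J v (T' f)) x)" for a
      unfolding T'_scale[OF f]
      by (rule Tc[OF semilinearD(4)[OF cliffordD(1)[OF J T'_space[OF f]], unfolded id_apply]])
        (intro T'_space T_scale JT f)+
  qed
  have scaleR: "T (\<lambda>x. r *\<^sub>R f x) = (\<lambda>x. r *\<^sub>R T f x)" if "f \<in> gw_space G" for r f
    using T_scale[OF that, of "complex_of_real r"] by (simp add: scaleC_scaleR(3))
  obtain C where C: "\<forall>v. \<forall>f\<in>gw_space G. gw_norm G (J v f) \<le> C * norm v * gw_norm G f"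
    using J unfolding clifford_module_def by blast
  show ?thesis
    unfolding clifford_module_def
  proof (intro conjI ballI allI exI[of _ C])
    show "semilinear_map id G' G' (J' J v)" for v by (rule semi)
    fix f assume f: "f \<in> gw_space G'"
    note f' = T'_space[OF f]
    show "eq_ae G' (J' J (v + w) f) (\<lambda>x. J' J v f x + J' J w f x)" for v w
      unfolding J'_def by (rule Tc[OF cliffordD(4)[OF J f']]) (intro T_add JT f)
    show "eq_ae G' (J' J (r *\<^sub>R v) f) (\<lambda>x. r *\<^sub>R J' J v f x)" for r v
      unfolding J'_def by (rule Tc[OF cliffordD(5)[OF J f']]) (intro scaleR JT f)
    show "eq_ae G' (\<lambda>x. J' J v (J' J w f) x + J' J w (J' J v f) x) (\<lambda>x. - (2 * inner v w) *\<^sub>R f x)" for v w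
    proof -
      have "eq_ae G' (T (\<lambda>x. J v (J w (T' f)) x + J w (J v (T' f)) x)) (T (\<lambda>x. - (2 * inner v w) *\<^sub>R T' f x))"
        by (rule T_cong[OF cliffordD(6)[OF J f']])
      then show ?thesis
        unfolding J'_def T'_T[OF JT[OF f]] T_add[OF JS[OF JT[OF f]] JS[OF JT[OF f]]] scaleR[OF f'] T_T'[OF f] .
    qed
    show "gw_inner G' (J' J v f) g = - gw_inner G' f (J' J v g)" if g: "g \<in> gw_space G'" for v g
    proof -
      have "gw_inner G' (J' J v f) g = gw_inner G' (T (J v (T' f))) (T (T' g))"
        by (simp add: J'_def T_T'[OF g])
      also have "\<dots> = - gw_inner G (T' f) (J v (T' g))"
        using J T_inner[OF JT[OF f] T'_space[OF g]] f' T'_space[OF g] unfolding clifford_module_def by simp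
      also have "\<dots> = - gw_inner G' (T (T' f)) (T (J v (T' g)))"
        by (simp only: T_inner[OF f' JT[OF g]])
      finally show ?thesis by (simp add: J'_def T_T'[OF f])
    qed
    show "gw_norm G' (J' J v f) \<le> C * norm v * gw_norm G' f" for v
      using C f' T_norm[OF JT[OF f]] T_norm[OF f'] by (simp add: J'_def T_T'[OF f])
  qed
qed

lemma gw_module_transport:
  assumes M: "gw_module \<sigma> z G J"
  shows "gw_module \<sigma> z G' (J' J)"
proof -
  have J: "clifford_module G J" using M by (simp add: gw_module_def)
  let ?m = "\<lambda>k x. (- 1) ^ ((\<Sum>j<k. of_bool (x j = 1)) + 1) * \<i> *
    complex_of_real (sqrt (density_of (translate \<mu> (delta k)) \<mu> x))"
  let ?s = "\<lambda>k (x::X). (- 1) ^ of_bool (x k = 1) * \<i>"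
  have 1: "AE x in \<mu>. J' J (z k) f x = ?m k x *\<^sub>C c' k x (f (x + delta k))"
    if f: "f \<in> gw_space G'" for k f
  proof -
    have "AE x in \<mu>. J (z k) (T' f) x = ?m k x *\<^sub>C c k x (T' f (x + delta k))"
      using M T'_space[OF f] unfolding gw_module_def eq_ae_def by blast
    then show ?thesis
      using AE_nu_Delta AE_unitary
    proof eventually_elim
      case (elim x)
      have nu: "\<nu> (x + delta k) = \<nu> x" "V (x + delta k) = V x"
        using elim(2) delta_in_Delta by blast+
      have "T' f (x + delta k) \<in> V x" using spaceD(2)[OF T'_space[OF f], of "x + delta k"] nu by simp
      then have "c k x (T' f (x + delta k)) \<in> V x" using elim(3) unitary_onD(1) by blast
      moreover have "c' k x (f (x + delta k)) = U x (c k x (T' f (x + delta k)))"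
        using nu by (simp add: c'_def T'_def)
      ultimately show ?case
        unfolding J'_def T_def elim(1) by (simp only: U_scale)
    qed
  qed
  have 2: "AE x in \<mu>. J' J (\<sigma> (z k)) f x = ?s k x *\<^sub>C J' J (z k) f x"
    if f: "f \<in> gw_space G'" for k f
  proof -
    have "AE x in \<mu>. J (\<sigma> (z k)) (T' f) x = ?s k x *\<^sub>C J (z k) (T' f) x"
      using M T'_space[OF f] unfolding gw_module_def eq_ae_def by blast
    then show ?thesis
      by eventually_elim
        (simp only: J'_def T_def U_scale[OF spaceD(2)[OF cliffordD(2)[OF J T'_space[OF f]]]])
  qed
  show ?thesis
    unfolding gw_module_def eq_ae_def G'_sel
    using gw_triple_transport clifford_module_transport[OF J] 1 2 by blast
qed

lemma unitarily_equivalent_transport: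
  assumes J: "clifford_module G J"
    and R: "\<And>f. f \<in> R \<Longrightarrow> f \<in> gw_space G" and R': "\<And>g. g \<in> R' \<Longrightarrow> g \<in> gw_space G'"
    and iff: "\<And>f. f \<in> gw_space G \<Longrightarrow> T f \<in> R' \<longleftrightarrow> f \<in> R"
  shows "unitarily_equivalent G J R G' (J' J) R'"
  unfolding unitarily_equivalent_def
proof (intro exI[of _ T] conjI ballI allI T_semilinear T_inner)
  show "\<exists>f\<in>gw_space G. eq_ae G' (T f) g" if "g \<in> gw_space G'" for g
    using T'_space[OF that] T_T'[OF that] by (intro bexI[of _ "T' g"]) (simp_all add: eq_ae_def)
  show "eq_ae G' (T (J v f)) (J' J v (T f))" if "f \<in> gw_space G" for v f
    by (simp add: J'_def T'_T[OF that] eq_ae_def)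
  show "T f \<in> R'" if "f \<in> R" for f using iff[OF R[OF that]] that by simp
  show "\<exists>f\<in>R. eq_ae G' (T f) g" if "g \<in> R'" for g
  proof (rule bexI[of _ "T' g"])
    show "eq_ae G' (T (T' g)) g" by (simp add: T_T'[OF R'[OF that]] eq_ae_def)
    show "T' g \<in> R" using iff[OF T'_space[OF R'[OF that]]] T_T'[OF R'[OF that]] that by simp
  qed
qed

end

section \<open>Model fibres\<close>

lemma orthonormal_sequence:
  assumes inf: "infinite_dimensional (UNIV :: 'k::real_inner set)"
  obtains u :: "nat \<Rightarrow> 'k::real_inner" where "\<And>i j. inner (u i) (u j) = of_bool (i = j)"
proof -
  define P where "P f n r \<longleftrightarrow> norm r = 1 \<and> (\<forall>m<n. inner r (f m) = 0)" for f :: "nat \<Rightarrow> 'k" and n :: nat and r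
  have "\<exists>u. \<forall>n. P u n (u n)"
  proof (rule dependent_wf_choice[OF wf_less])
    show "P f n r = P g n r" if "\<And>m. (m, n) \<in> {(x, y). x < y} \<Longrightarrow> f m = g m" for f g n r
      using that by (simp add: P_def)
    fix n and f :: "nat \<Rightarrow> 'k" assume "\<And>m. (m, n) \<in> {(x, y). x < y} \<Longrightarrow> P f m (f m)"
    then have f: "\<And>m. m < n \<Longrightarrow> norm (f m) = 1" "\<And>m l. m < n \<Longrightarrow> l < m \<Longrightarrow> inner (f m) (f l) = 0"
      by (auto simp: P_def)
    have orth: "inner (f i) (f j) = (if i = j then 1 else 0)" if "i < n" "j < n" for i j
    proof (cases i j rule: linorder_cases)
      case less
      then show ?thesis using f(2)[OF that(2) less] by (subst inner_commute) simp
    next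
      case equal
      then show ?thesis using f(1)[OF that(1)] by (simp add: norm_eq_1)
    next
      case greater
      then show ?thesis using f(2)[OF that(1) greater] by simp
    qed
    have "\<not> UNIV \<subseteq> span (f ` {..<n})"
    proof
      assume "UNIV \<subseteq> span (f ` {..<n})"
      moreover have "finite (f ` {..<n})" by simp
      ultimately show False using inf unfolding infinite_dimensional_def by blast
    qed
    then obtain v where v: "v \<notin> span (f ` {..<n})" by blast
    define p where "p = (\<Sum>m<n. inner v (f m) *\<^sub>R f m)"
    have "p \<in> span (f ` {..<n})"
      unfolding p_def by (intro span_sum span_scale span_base) auto
    then have "v - p \<noteq> 0" using v by auto
    have "inner (v - p) (f m) = 0" if "m < n" for m
    proof -
      have "inner p (f m) = (\<Sum>i<n. if i = m then inner v (f m) else 0)"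
        unfolding p_def inner_sum_left by (intro sum.cong) (auto simp: orth that)
      then show ?thesis using that by (simp add: inner_diff_left)
    qed
    then have "P f n ((1 / norm (v - p)) *\<^sub>R (v - p))"
      using \<open>v - p \<noteq> 0\<close> unfolding P_def by simp
    then show "\<exists>r. P f n r" by blast
  qed
  then obtain u where "\<And>n. P u n (u n)" by blast
  then have u: "\<And>n. norm (u n) = 1" "\<And>m n. m < n \<Longrightarrow> inner (u n) (u m) = 0"
    by (simp_all add: P_def)
  have "inner (u i) (u j) = of_bool (i = j)" for i j
  proof (cases i j rule: linorder_cases)
    case less
    then show ?thesis using u(2)[OF less] by (subst inner_commute) simp
  next
    case equal
    then show ?thesis using u(1)[of i] by (simp add: norm_eq_1)
  next
    case greater
    then show ?thesis using u(2)[OF greater] by simp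
  qed
  then show ?thesis by (rule that)
qed

text \<open>The first \<open>n\<close> vectors of a sequence of real vectors, as vectors of the complexification, padded
  with zeros.\<close>

definition model_frame :: "(nat \<Rightarrow> 'k::{real_inner, complete_space}) \<Rightarrow> enat \<Rightarrow> nat \<Rightarrow> 'k complexification" where
  "model_frame u n j = (if enat j < n then Cplx (u j) 0 else 0)"

text \<open>The vectors of \<open>W\<close> with vanishing imaginary part, as vectors of the real space.\<close>

definition real_points :: "'k::{real_inner, complete_space} complexification set \<Rightarrow> 'k set" where
  "real_points W = {a. Cplx a 0 \<in> W}"

lemma conj_model_frame [simp]: "conj_vec (model_frame u n j) = model_frame u n j"
  by (simp add: model_frame_def) (simp add: conj_vec_def)

lemma Cplx_real_add: "Cplx (a + b) 0 = Cplx a 0 + Cplx b 0"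
  and Cplx_real_scaleR: "Cplx (r *\<^sub>R a) 0 = r *\<^sub>R Cplx a 0"
  and Cplx_real_zero: "Cplx 0 0 = 0"
  and Cplx_decompose: "Cplx a b = Cplx a 0 + \<i> *\<^sub>C Cplx b 0"
  for a b :: "'k::{real_inner, complete_space}"
  by (simp_all add: plus_complexification_def scaleR_complexification_def zero_complexification_def
      scaleC_complexification_def)

lemma bounded_linear_Cplx_real: "bounded_linear (\<lambda>a. Cplx a (0 :: 'k::{real_inner, complete_space}))"
  by (rule bounded_linear_intro[of _ 1])
    (auto simp: Cplx_real_add Cplx_real_scaleR norm_complexification_def inner_complexification_def norm_eq_sqrt_inner)

text \<open>The closed span of a model frame is stable under conjugation, hence the complexification of its
  real points.\<close>

lemma
  fixes u :: "nat \<Rightarrow> 'k::{real_inner, complete_space}" and n :: enat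
  assumes u: "\<And>i j. inner (u i) (u j) = of_bool (i = j)"
  defines "K \<equiv> real_points (closure (cspan (range (model_frame u n))))"
  shows frame_model_frame: "frame n (complexified K) (model_frame u n)"
    and closed_real_points: "closed K" and subspace_real_points: "subspace K"
proof -
  define W where "W = closure (cspan (range (model_frame u n)))"
  have W: "csubspace W" "closed W"
    unfolding W_def by (rule csubspace_closure_cspan closed_closure)+
  have K: "K = (\<lambda>a. Cplx a 0) -` W" by (auto simp: K_def real_points_def W_def)
  show "closed K"
    unfolding K by (intro closed_vimage W(2) bounded_linear.continuous_on[OF bounded_linear_Cplx_real] continuous_on_id)
  show "subspace K"
    unfolding K using complex_vs.subspace_0[OF W(1)] complex_vs.subspace_add[OF W(1)] csubspace_imp_scaleR[OF W(1)]
    by (intro subspaceI) (simp_all add: Cplx_real_add Cplx_real_scaleR Cplx_real_zero)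
  have "W \<subseteq> conj_vec -` W"
    unfolding W_def
  proof (rule closure_cspan_least, fold W_def)
    show "closed (conj_vec -` W)"
      by (intro closed_vimage W(2) bounded_linear.continuous_on[OF bounded_linear_conj_vec] continuous_on_id)
    show "csubspace (conj_vec -` W)"
      using complex_vs.subspace_0[OF W(1)] complex_vs.subspace_add[OF W(1)] complex_vs.subspace_scale[OF W(1)]
      by (intro complex_vs.subspaceI) (simp_all add: conj_vec_add conj_vec_scaleC)
    have "model_frame u n j \<in> W" for j
      unfolding W_def by (rule subsetD[OF closure_subset]) (simp add: complex_vs.span_base)
    then show "range (model_frame u n) \<subseteq> conj_vec -` W" by auto
  qed
  then have conj: "conj_vec v \<in> W" if "v \<in> W" for v using that by blast
  have "complexified K = W"
  proof
    show "complexified K \<subseteq> W"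
    proof
      fix v assume "v \<in> complexified K"
      then obtain a b where v: "v = Cplx a b" "Cplx a 0 \<in> W" "Cplx b 0 \<in> W"
        by (auto simp: complexified_def K)
      show "v \<in> W"
        unfolding v(1) Cplx_decompose[of a b]
        by (intro complex_vs.subspace_add[OF W(1)] complex_vs.subspace_scale[OF W(1)] v)
    qed
    show "W \<subseteq> complexified K"
    proof
      fix v assume v: "v \<in> W"
      obtain a b where ab: "v = Cplx a b" by (cases v)
      have real: "Cplx (re_part w) 0 \<in> W" if w: "w \<in> W" for w
      proof -
        have "Cplx (re_part w) 0 = (1 / 2) *\<^sub>R (w + conj_vec w)"
          by (simp add: conj_vec_def plus_complexification_def scaleR_complexification_def scaleR_2[symmetric])
        then show ?thesis
          using csubspace_imp_scaleR[OF W(1) complex_vs.subspace_add[OF W(1) w conj[OF w]]] by simp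
      qed
      have "Cplx a 0 \<in> W" using real[OF v] by (simp add: ab)
      moreover have "Cplx b 0 \<in> W"
        using real[OF complex_vs.subspace_scale[OF W(1) v, of "- \<i>"]] by (simp add: ab scaleC_complexification_def uminus_complexification_def)
      ultimately show "v \<in> complexified K" by (simp add: complexified_def K ab)
    qed
  qed
  moreover have "cinner (model_frame u n i) (model_frame u n j) = of_bool (i = j \<and> enat i < n)" for i j
    using u[of i j] by (auto simp: model_frame_def cinner_complexification_def complex_eq_iff
        zero_complexification_def)
  ultimately show "frame n (complexified K) (model_frame u n)"
    by (simp add: frame_def W_def)
qed

section \<open>The normal form of an invariant real form\<close>

text \<open>A bounded linear map on \<open>V\<close> that vanishes on a frame is zero.\<close>

lemma frame_zero_ext:
  fixes L :: "'a::complex_hilbert \<Rightarrow> 'b::complex_hilbert"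
  assumes e: "frame n V e" and add: "\<And>v w. v \<in> V \<Longrightarrow> w \<in> V \<Longrightarrow> L (v + w) = L v + L w"
    and scale: "\<And>s v. v \<in> V \<Longrightarrow> L (s *\<^sub>C v) = s *\<^sub>C L v"
    and bound: "\<And>v. v \<in> V \<Longrightarrow> norm (L v) \<le> C * norm v"
    and zero: "\<And>j. L (e j) = 0" and v: "v \<in> V"
  shows "L v = 0"
proof -
  note V = frameD(4)[OF e] and eV = frameD(3)[OF e]
  define P where "P N = (\<Sum>j<N. cinner v (e j) *\<^sub>C e j)" for N
  have P: "P N \<in> V \<and> L (P N) = 0" for N
  proof (induction N)
    case 0
    have "L (0 *\<^sub>C e 0) = 0 *\<^sub>C L (e 0)" by (rule scale[OF eV])
    then show ?case using complex_vs.subspace_0[OF V] by (simp add: P_def)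
  next
    case (Suc N)
    have "cinner v (e N) *\<^sub>C e N \<in> V" by (rule complex_vs.subspace_scale[OF V eV])
    then show ?case
      using Suc add[of "P N" "cinner v (e N) *\<^sub>C e N"] scale[OF eV[of N], of "cinner v (e N)"] zero[of N]
        complex_vs.subspace_add[OF V] by (simp add: P_def)
  qed
  have "norm (L v) \<le> C * norm (v - P N)" for N
  proof -
    have d: "v - P N \<in> V" using complex_vs.subspace_diff[OF V v] P by blast
    have "L v = L (v - P N)" using add[OF d, of "P N"] P[of N] by simp
    then show ?thesis using bound[OF d] by simp
  qed
  moreover have "(\<lambda>N. C * norm (v - P N)) \<longlonglongrightarrow> C * norm (v - v)"
    using frame_expansion[OF e v] unfolding sums_def P_def[symmetric] by (intro tendsto_intros)
  ultimately have "norm (L v) \<le> C * norm (v - v)"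
    by (intro LIMSEQ_le_const) auto
  then show ?thesis by simp
qed

text \<open>The adapted frames are sent to real model frames; then the transported \<open>S\<close> is the standard real
  structure.\<close>

lemma (in gw_real_structure) normal_form:
  assumes inf: "infinite_dimensional (UNIV :: 'k::{real_inner, complete_space, second_countable_topology} set)"
  shows "\<exists>(G' :: 'k::{real_inner, complete_space, second_countable_topology} complexification gw) K' J'.
    gw_module \<sigma> z G' J' \<and> complexified_fibers G' K' \<and> reflection_compatible G' \<and>
    unitarily_equivalent G J {f \<in> gw_space G. eq_ae G (S f) f} G' J' (standard_real_form G')"
proof -
  obtain a where a: "\<And>x. frame (\<nu> x) (V x) (a x)" "\<And>j. (\<lambda>x. a x j) \<in> borel_measurable \<mu>"
    and nu_sym: "AE x in \<mu>. \<nu> (1 - x) = \<nu> x"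
    and S_coord: "\<And>f. f \<in> gw_space G \<Longrightarrow> AE x in \<mu>. \<forall>j.
       cinner (S f x) (a x j) = complex_of_real (sqrt (r.D x)) * cnj (cinner (f (1 - x)) (a (1 - x) j))"
    using adapted_frame by blast
  obtain u :: "nat \<Rightarrow> 'k" where u: "\<And>i j. inner (u i) (u j) = of_bool (i = j)"
    using orthonormal_sequence[OF inf] by blast
  define K where "K n = real_points (closure (cspan (range (model_frame u n))))" for n
  define b where "b x = model_frame u (\<nu> x)" for x
  define V' where "V' x = complexified (K (\<nu> x))" for x
  have b: "frame (\<nu> x) (V' x) (b x)" for x
    unfolding b_def V'_def K_def by (rule frame_model_frame[OF u])
  interpret t: frame_transport G a V' b
    by unfold_locales (simp_all add: a b[unfolded b_def] b_def)
  have refl_equiv: "equivalent_measures (reflect \<mu>) \<mu>"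
    unfolding equivalent_measures_def reflect_def by (rule reflect_null_sets)
  have fib: "complexified_fibers t.G' (\<lambda>x. K (\<nu> x))"
    unfolding complexified_fibers_def t.G'_sel
  proof (intro conjI allI impI)
    show "closed (K (\<nu> x))" "subspace (K (\<nu> x))" for x
      unfolding K_def by (rule closed_real_points[OF u] subspace_real_points[OF u])+
    show "V' x = complexified (K (\<nu> x))" for x by (simp add: V'_def)
    show "\<nu> x = \<nu> y \<Longrightarrow> K (\<nu> x) = K (\<nu> y)" for x y by simp
    show "AE x in \<mu>. (\<forall>d\<in>Delta. K (\<nu> (x + d)) = K (\<nu> x)) \<and> K (\<nu> (1 - x)) = K (\<nu> x)"
      using AE_nu nu_sym by eventually_elim metis
  qed
  interpret s: reflection_symmetric t.G' "\<lambda>x. K (\<nu> x)"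
    by (unfold_locales, unfold t.G'_sel) (rule fib refl_equiv nu_sym)+
  have S0_T: "eq_ae t.G' (s.S0 (t.T f)) (t.T (S f))" if f: "f \<in> gw_space G" for f
    unfolding eq_ae_def t.G'_sel
    using s.S0_AE[of "t.T f", unfolded t.G'_sel] S_coord[OF f] nu_sym
  proof eventually_elim
    case (elim x)
    have fx: "f (1 - x) \<in> V (1 - x)" and Sfx: "S f x \<in> V x"
      by (rule spaceD(2)[OF f], rule spaceD(2)[OF S_space[OF f]])
    have "t.U (1 - x) (f (1 - x)) \<in> V' (1 - x)" by (rule t.U_in[OF fx])
    then have Ux: "t.U (1 - x) (f (1 - x)) \<in> V' x" unfolding V'_def elim(3) .
    show ?case
    proof (rule frame_ext[OF b])
      show "s.S0 (t.T f) x \<in> V' x"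
        using s.S0_fiber[of "t.T f" x] t.p.spaceD(2)[OF t.T_space[OF f]] by simp
      show "t.T (S f) x \<in> V' x" unfolding t.T_def by (rule t.U_in[OF Sfx])
      fix j
      have bb: "conj_vec (b (1 - x) j) = b x j" unfolding b_def elim(3) by simp
      have "cinner (conj_vec (t.U (1 - x) (f (1 - x)))) (b x j) = cnj (cinner (f (1 - x)) (a (1 - x) j))"
        unfolding bb[symmetric] cinner_conj_vec t.U_coord[OF fx] by (rule refl)
      then have "cinner (s.S0 (t.T f) x) (b x j) = complex_of_real (sqrt (r.D x)) * cnj (cinner (f (1 - x)) (a (1 - x) j))"
        unfolding elim(1) scaleR_eq_scaleC cinner_scaleC_left unfolding t.T_def by (simp only:)
      also have "\<dots> = cinner (S f x) (a x j)" using elim(2) by (simp only:)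
      also have "\<dots> = cinner (t.T (S f) x) (b x j)" unfolding t.T_def t.U_coord[OF Sfx] by (rule refl)
      finally show "cinner (s.S0 (t.T f) x) (b x j) = cinner (t.T (S f) x) (b x j)" .
    qed
  qed
  have M': "gw_module \<sigma> z t.G' (t.J' J)" by (rule t.gw_module_transport[OF module])
  have S0_J': "eq_ae t.G' (s.S0 (t.J' J v f)) (t.J' J v (s.S0 f))" if f: "f \<in> gw_space t.G'" for v f
  proof -
    define g where "g = t.T' f"
    have g: "g \<in> gw_space G" and Tg: "t.T g = f"
      unfolding g_def by (rule t.T'_space[OF f], rule t.T_T'[OF f])
    have "eq_ae t.G' (s.S0 (t.T (J v g))) (t.T (S (J v g)))" by (rule S0_T[OF J_space[OF g]])
    also have "eq_ae t.G' (t.T (S (J v g))) (t.T (J v (S g)))" by (rule t.T_cong[OF S_J[OF g]])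
    also have "eq_ae t.G' (t.T (J v (S g))) (t.T (J v (t.T' (s.S0 f))))"
    proof (intro t.T_cong J_cong S_space g t.T'_space s.S0_space f)
      have "eq_ae G (t.T' (t.T (S g))) (t.T' (s.S0 (t.T g)))"
        by (rule t.T'_cong[OF eq_ae_sym[OF S0_T[OF g]]])
      then show "eq_ae G (S g) (t.T' (s.S0 f))" unfolding t.T'_T[OF S_space[OF g]] Tg .
    qed
    finally show ?thesis unfolding t.J'_def g_def[symmetric] .
  qed
  obtain w where w: "w \<in> borel_measurable \<mu>" "\<And>x. w x > 0" "(\<integral>\<^sup>+x. ennreal ((w x)\<^sup>2) \<partial>\<mu>) < \<infinity>"
    using obtain_weight by blast
  define \<beta> where "\<beta> j = (\<lambda>x. w x *\<^sub>R b x j)" for j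
  have \<beta>: "\<beta> j \<in> gw_space t.G'" for j
  proof (rule t.p.spaceI)
    show "\<beta> j \<in> borel_measurable (gw_measure t.G')"
      unfolding \<beta>_def t.G'_sel by (intro borel_measurable_scaleR w(1) t.b_measurable)
    show "\<beta> j x \<in> gw_fiber t.G' x" for x
      unfolding \<beta>_def using t.p.fiber_scaleR[of "b x j" x "w x"] frameD(3)[OF b, of x j] by simp
    have "(\<integral>\<^sup>+x. ennreal ((norm (\<beta> j x))\<^sup>2) \<partial>\<mu>) \<le> (\<integral>\<^sup>+x. ennreal ((w x)\<^sup>2) \<partial>\<mu>)"
    proof (intro nn_integral_mono ennreal_leI power_mono)
      fix x
      have "complex_of_real ((norm (b x j))\<^sup>2) = complex_of_real (of_bool (enat j < \<nu> x))"
        using frameD(1)[OF b, of x j j] unfolding cinner_self by simp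
      then have "(norm (b x j))\<^sup>2 = of_bool (enat j < \<nu> x)" using of_real_eq_iff by blast
      then have "(norm (b x j))\<^sup>2 \<le> 1\<^sup>2" by simp
      then have "norm (b x j) \<le> 1" by (rule power2_le_imp_le) simp
      then show "norm (\<beta> j x) \<le> w x"
        using mult_left_mono[of "norm (b x j)" 1 "w x"] w(2)[of x] by (simp add: \<beta>_def)
    qed simp
    also have "\<dots> < \<infinity>" by (rule w(3))
    finally show "(\<integral>\<^sup>+x. ennreal ((norm (\<beta> j x))\<^sup>2) \<partial>gw_measure t.G') < \<infinity>" by simp
  qed
  \<comment> \<open>The weighted basis fields \<open>\<beta> j\<close> turn the commutation of \<open>S0\<close> with the generators into the
      compatibility condition on each basis vector.\<close>
  have basis_compat: "AE x in \<mu>. conj_op (t.c' k (1 - x)) (b x j) = (- 1) ^ (k + 1) *\<^sub>C t.c' k x (b x j)" for k j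
  proof -
    interpret d: quasi_invariant \<mu> "\<lambda>x. x + delta k" by (simp add: quasi_invariant_translate)
    have unit: "AE x in \<mu>. \<forall>k. unitary_on (V' x) (t.c' k x)" using t.p.AE_unitary unfolding t.G'_sel .
    show ?thesis
      using s.S0_generator[OF M' \<beta>, of k j, unfolded t.G'_sel] s.generator_S0[OF M' \<beta>, of k j, unfolded t.G'_sel]
        S0_J'[OF \<beta>, of "z k" j, unfolded eq_ae_def t.G'_sel] d.D_pos d.AE_theta[OF r.D_pos] nu_sym
        r.AE_theta[OF AE_nu] unit r.AE_theta[OF unit]
    proof eventually_elim
      case (elim x)
      define A where "A = ((- 1) ^ ((\<Sum>j<k. of_bool (x j = 1)) + 1) * \<i>) *
          complex_of_real (sqrt (density_of (translate \<mu> (delta k)) \<mu> x * r.D (x + delta k)))"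
      define w' where "w' = w (1 - x + delta k)"
      have "density_of (translate \<mu> (delta k)) \<mu> x > 0" using elim(4) by (simp only: translate_def)
      then have A: "A \<noteq> 0" using elim(5) by (simp add: A_def)
      have "\<nu> (1 - x + delta k) = \<nu> x" using elim(6,7) delta_in_Delta by metis
      then have \<beta>x: "\<beta> j (1 - x + delta k) = complex_of_real w' *\<^sub>C b x j"
        by (simp only: \<beta>_def b_def w'_def scaleR_eq_scaleC)
      have bx: "b x j \<in> V' x" and bx': "b x j \<in> V' (1 - x)"
        using frameD(3)[OF b, of x j] unfolding V'_def elim(6) by blast+
      have cb: "conj_vec (b x j) = b x j" by (simp add: b_def)
      have "(A * (- 1) ^ (k + 1)) *\<^sub>C conj_vec (t.c' k (1 - x) (\<beta> j (1 - x + delta k)))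
          = A *\<^sub>C t.c' k x (conj_vec (\<beta> j (1 - x + delta k)))"
        using elim(1,2,3) unfolding A_def by (simp only:)
      then have "A *\<^sub>C ((- 1) ^ (k + 1) *\<^sub>C conj_vec (t.c' k (1 - x) (\<beta> j (1 - x + delta k))))
          = A *\<^sub>C t.c' k x (conj_vec (\<beta> j (1 - x + delta k)))"
        by (simp only: scaleC_scaleC)
      then have "(- 1) ^ (k + 1) *\<^sub>C conj_vec (t.c' k (1 - x) (complex_of_real w' *\<^sub>C b x j))
          = t.c' k x (complex_of_real w' *\<^sub>C b x j)"
        using A unfolding \<beta>x complex_vs.scale_cancel_left by (simp only: conj_vec_scaleC complex_cnj_complex_of_real cb simp_thms)
      moreover have "t.c' k (1 - x) (complex_of_real w' *\<^sub>C b x j) = complex_of_real w' *\<^sub>C t.c' k (1 - x) (b x j)"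
        by (rule unitary_onD(2)[OF elim(9)[rule_format] bx'])
      moreover have "t.c' k x (complex_of_real w' *\<^sub>C b x j) = complex_of_real w' *\<^sub>C t.c' k x (b x j)"
        by (rule unitary_onD(2)[OF elim(8)[rule_format] bx])
      ultimately have "complex_of_real w' *\<^sub>C ((- 1) ^ (k + 1) *\<^sub>C conj_vec (t.c' k (1 - x) (b x j)))
          = complex_of_real w' *\<^sub>C t.c' k x (b x j)"
        by (simp only: conj_vec_scaleC complex_cnj_complex_of_real scaleC_scaleC mult.commute)
      then have *: "(- 1) ^ (k + 1) *\<^sub>C conj_vec (t.c' k (1 - x) (b x j)) = t.c' k x (b x j)"
        using w(2)[of "1 - x + delta k"] unfolding complex_vs.scale_cancel_left w'_def by simp
      have "(- 1 :: complex) ^ (k + 1) * (- 1) ^ (k + 1) = 1"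
        by (simp flip: power_mult_distrib)
      then show ?case
        unfolding conj_op_def cb *[symmetric] by (simp only: scaleC_scaleC scaleC_one)
    qed
  qed
  have "AE x in \<mu>. \<forall>k. \<forall>v\<in>V' x. conj_op (t.c' k (1 - x)) v = (- 1) ^ (k + 1) *\<^sub>C t.c' k x v"
  proof -
    have unit: "AE x in \<mu>. \<forall>k. unitary_on (V' x) (t.c' k x)" using t.p.AE_unitary unfolding t.G'_sel .
    have "AE x in \<mu>. \<forall>k j. conj_op (t.c' k (1 - x)) (b x j) = (- 1) ^ (k + 1) *\<^sub>C t.c' k x (b x j)"
      using basis_compat unfolding AE_all_countable by blast
    then show ?thesis
      using nu_sym unit r.AE_theta[OF unit]
    proof eventually_elim
      case (elim x)
      show ?case
      proof (intro allI ballI)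
        fix k v assume v: "v \<in> V' x"
        have V'x: "V' (1 - x) = V' x" unfolding V'_def elim(2) by (rule refl)
        have conj: "conj_vec v \<in> V' x" if "v \<in> V' x" for v using s.conj_vec_fiber[of v x] that by simp
        note A = unitary_onD[OF elim(3)[rule_format, of k]]
          and B = unitary_onD[OF elim(4)[rule_format, of k], unfolded V'x]
        define L where "L v = conj_op (t.c' k (1 - x)) v - (- 1) ^ (k + 1) *\<^sub>C t.c' k x v" for v
        have "L v = 0"
        proof (rule frame_zero_ext[OF b _ _ _ _ v])
          show "L (v + w) = L v + L w" if "v \<in> V' x" "w \<in> V' x" for v w
            using that conj by (simp add: L_def conj_op_def conj_vec_add A(4) B(4) scaleC_add_right)
          show "L (s *\<^sub>C v) = s *\<^sub>C L v" if "v \<in> V' x" for s v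
            using that conj by (simp add: L_def conj_op_def conj_vec_scaleC A(2) B(2) scaleC_add_right
                scaleC_scaleC mult.commute)
          show "norm (L v) \<le> 2 * norm v" if "v \<in> V' x" for v
          proof -
            have "norm (L v) \<le> norm (conj_op (t.c' k (1 - x)) v) + norm ((- 1) ^ (k + 1) *\<^sub>C t.c' k x v)"
              unfolding L_def by (rule norm_triangle_ineq4)
            also have "norm (conj_op (t.c' k (1 - x)) v) = norm v"
              using B(3)[OF conj[OF that]] by (simp add: conj_op_def)
            also have "norm ((- 1) ^ (k + 1) *\<^sub>C t.c' k x v) = norm v"
              using A(3)[OF that] unfolding norm_scaleC by (simp add: norm_power norm_mult)
            finally show ?thesis by simp
          qed
          show "L (b x j) = 0" for j using elim(1) unfolding L_def by simp
        qed
        then show "conj_op (t.c' k (1 - x)) v = (- 1) ^ (k + 1) *\<^sub>C t.c' k x v"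
          unfolding L_def by (simp only: right_minus_eq)
      qed
    qed
  qed
  then have compat: "reflection_compatible t.G'"
    unfolding reflection_compatible_def t.G'_sel by (intro conjI refl_equiv nu_sym)
  have "unitarily_equivalent G J {f \<in> gw_space G. eq_ae G (S f) f} t.G' (t.J' J) (standard_real_form t.G')"
  proof (rule t.unitarily_equivalent_transport[OF clifford])
    show "t.T f \<in> standard_real_form t.G' \<longleftrightarrow> f \<in> {f \<in> gw_space G. eq_ae G (S f) f}"
      if f: "f \<in> gw_space G" for f
    proof -
      have "eq_ae t.G' (s.S0 (t.T f)) (t.T f) \<longleftrightarrow> eq_ae t.G' (t.T (S f)) (t.T f)"
        using eq_ae_trans[OF S0_T[OF f]] eq_ae_trans[OF eq_ae_sym[OF S0_T[OF f]]] by blast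
      also have "\<dots> \<longleftrightarrow> eq_ae G (S f) f"
        using t.T_cong[of "S f" f] t.T'_cong[of "t.T (S f)" "t.T f", unfolded t.T'_T[OF f] t.T'_T[OF S_space[OF f]]]
        by blast
      finally show ?thesis using f t.T_space[OF f] unfolding s.standard_real_form_eq by simp
    qed
  qed (simp_all add: s.standard_real_form_eq)
  then show ?thesis using M' fib compat by blast
qed

theorem theorem3p9:
  fixes \<sigma> :: "'z::{real_inner, complete_space, second_countable_topology} \<Rightarrow> 'z"
    and z :: "nat \<Rightarrow> 'z"
  assumes "infinite_dimensional (UNIV :: 'z set)"
    and "orthogonal_complex_structure \<sigma>"
    and "unitary_basis \<sigma> z"
  shows
    "(\<forall>(G :: 'k::{real_inner, complete_space, second_countable_topology} complexification gw) K J.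
        gw_module \<sigma> z G J \<and> complexified_fibers G K \<and> reflection_compatible G
        \<longrightarrow> invariant_real_form G J (standard_real_form G)) \<and>
     (infinite_dimensional (UNIV :: 'k set) \<longrightarrow>
       (\<forall>(G :: 'h::{complex_hilbert, second_countable_topology} gw) J R.
          gw_module \<sigma> z G J \<and> invariant_real_form G J R
          \<longrightarrow> (\<exists>(G' :: 'k complexification gw) K' J'.
                gw_module \<sigma> z G' J' \<and> complexified_fibers G' K' \<and> reflection_compatible G' \<and>
                unitarily_equivalent G J R G' J' (standard_real_form G'))))"
proof (intro conjI allI impI; elim conjE)
  fix G :: "'k complexification gw" and K J
  assume M: "gw_module \<sigma> z G J" and K: "complexified_fibers G K" and compat: "reflection_compatible G"
  interpret reflection_symmetric G K
    using M K compat by unfold_locales (auto simp: gw_module_def reflection_compatible_def)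
  show "invariant_real_form G J (standard_real_form G)"
    by (rule standard_real_form_invariant[OF M assms(3) compat])
next
  fix G :: "'h gw" and J R
  assume inf: "infinite_dimensional (UNIV :: 'k set)"
    and M: "gw_module \<sigma> z G J" and R: "invariant_real_form G J R"
  obtain S where RS: "invariant_real_structure G J S" "R = {f \<in> gw_space G. eq_ae G (S f) f}"
    using R unfolding invariant_real_form_def by blast
  interpret gw_real_structure G \<sigma> z J S
    using M RS(1) assms(3) by unfold_locales (auto simp: gw_module_def)
  show "\<exists>(G' :: 'k complexification gw) K' J'.
      gw_module \<sigma> z G' J' \<and> complexified_fibers G' K' \<and> reflection_compatible G' \<and>
      unitarily_equivalent G J R G' J' (standard_real_form G')"
    unfolding RS(2) by (rule normal_form[OF inf])
qed

end
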